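(* Let $(M,\mathcal{T})$ be a triangulated closed 3-manifold such that $d_i\geq 23$ for all $i\in\mathcal{T}_0$. Then there exists a ball packing $\pmb{r}\in\mathbb{R}^N_+$, real or virtual, such that $\widetilde{\pmb{K}}(\pmb{r})=\pmb{0}$. If there is a real ball packing $\pmb{r}$ satisfying $\widetilde{\pmb{K}}(\pmb{r})=\pmb{0}$, then for any initial data $\pmb{r}(0)\in\mathbb{R}^N_+$ the solution of the extended combinatorial Yamabe flow $$\frac{dr_i}{dt}=-\widetilde{K}_i\sinh r_i,\qquad i\in\mathcal{T}_0,$$ converges exponentially fast to $\pmb{r}$ as $t\to\infty$.
   Context: $M$ is a closed 3-manifold with a (finite) triangulation $\mathcal{T}=\{\mathcal{T}_0,\mathcal{T}_1,\mathcal{T}_2,\mathcal{T}_3\}$ (vertices, edges, faces, tetrahedra), $\mathcal{T}_0=\{1,\dots,N\}$; $\{ijkl\}\in\mathcal{T}_3$ denotes the tetrahedron with vertices $i,j,k,l$. The tetra-degree $d_i$ is the number of tetrahedra incident to the vertex $i$. $\mathbb{R}_+=(0,\infty)$. A (hyperbolic) ball packing is a vector $\pmb{r}=(r_1,\dots,r_N)\in\mathbb{R}^N_+$. For $(r_i,r_j,r_k,r_l)\in\mathbb{R}_+^4$ write $y_a=\coth r_a$ and $Q=(y_i+y_j+y_k+y_l)^2-2(y_i^2+y_j^2+y_k^2+y_l^2)+4$. A non-degenerate tetrahedron in $\mathbb{H}^3$ (curvature $-1$) with edge lengths $l_{ab}=r_a+r_b$ exists iff $Q>0$ and is then unique up to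 isometry; in this case the tetrahedron is called real, otherwise virtual. A ball packing is real if all tetrahedra of $\mathcal{T}_3$ are real, and virtual otherwise. For a real tetrahedron $\alpha_{ijkl}$ is its solid angle at $i$ (sum of the three dihedral angles at the edges through $i$, minus $\pi$). The set $\{Q\le 0\}\subset\mathbb{R}_+^4$ is the disjoint union of the four sets $D_a$, $a\in\{i,j,k,l\}$, where $D_a=\{y_a\geq y_b+y_c+y_d+2(y_by_c+y_cy_d+y_dy_b+1)^{1/2}\}$ with $\{a,b,c,d\}=\{i,j,k,l\}$. The extended solid angle at $i$ is $\widetilde\alpha_{ijkl}=\alpha_{ijkl}$ if $Q>0$, $\widetilde\alpha_{ijkl}=2\pi$ on $D_i$, and $\widetilde\alpha_{ijkl}=0$ on $D_j\cup D_k\cup D_l$. The extended combinatorial scalar curvature is $\widetilde{K}_i=4\pi-\sum\widetilde{\alpha}_{ijkl}$, summed over all tetrahedra incident to $i$, and $\widetilde{\pmb K}=(\widetilde K_1,\dots,\widetilde K_N)$. For every initial data in $\mathbb{R}^N_+$ the extended flow has a unique solution in $\mathbb{R}^N_+$, defined for all $t\in[0,\infty)$. Converging exponentially fast to $\pmb r$ means $|\pmb r(t)-\pmb r|\le Ce^{-\lambda t}$ for some $C,\lambda>0$ and all $t\ge 0$. *)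

theory Defs
  imports "HOL-Analysis.Analysis"
begin

section \<open>Closed 3-manifolds and their triangulations\<close>

definition closed_3_manifold :: "'m topology \<Rightarrow> bool" where
  "closed_3_manifold M \<longleftrightarrow>
     Hausdorff_space M \<and> second_countable M \<and> compact_space M \<and>
     (\<forall>x \<in> topspace M. \<exists>U. openin M U \<and> x \<in> U \<and>
        subtopology M U homeomorphic_space (euclidean :: (real^3) topology))"

text \<open>The vertex set \<open>{1,\<dots>,N}\<close> is rendered as a finite type \<open>'n\<close>, so that \<open>real^'n\<close> is the space of
  vectors indexed by the vertices.  A simplex is identified with its set of vertices.\<close>

definition simplicial_complex :: "'n::finite set set \<Rightarrow> bool" where
  "simplicial_complex T \<longleftrightarrow>
     (\<forall>i. {i} \<in> T) \<and>
     (\<forall>s \<in> T. 1 \<le> card s \<and> card s \<le> 4) \<and>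
     (\<forall>s \<in> T. \<forall>t. t \<subseteq> s \<and> t \<noteq> {} \<longrightarrow> t \<in> T)"

text \<open>Points of the realization are given by barycentric coordinates.\<close>

definition geometric_realization :: "'n::finite set set \<Rightarrow> (real^'n) set" where
  "geometric_realization T =
     {x. (\<forall>i. 0 \<le> x $ i) \<and> (\<Sum>i\<in>UNIV. x $ i) = 1 \<and> {i. x $ i \<noteq> 0} \<in> T}"

definition triangulates :: "'n::finite set set \<Rightarrow> 'm topology \<Rightarrow> bool" where
  "triangulates T M \<longleftrightarrow>
     simplicial_complex T \<and> M homeomorphic_space top_of_set (geometric_realization T)"

definition tetrahedra :: "'n::finite set set \<Rightarrow> 'n set set" where
  "tetrahedra T = {s \<in> T. card s = 4}"

definition tetra_degree :: "'n::finite set set \<Rightarrow> 'n \<Rightarrow> nat" where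
  "tetra_degree T i = card {s \<in> tetrahedra T. i \<in> s}"


section \<open>Hyperbolic 3-space (hyperboloid model)\<close>

definition lorentz :: "real \<times> (real^3) \<Rightarrow> real \<times> (real^3) \<Rightarrow> real" where
  "lorentz p q = snd p \<bullet> snd q - fst p * fst q"

definition hyp_space :: "(real \<times> (real^3)) set" where
  "hyp_space = {p. lorentz p p = -1 \<and> fst p > 0}"

definition hyp_dist :: "real \<times> (real^3) \<Rightarrow> real \<times> (real^3) \<Rightarrow> real" where
  "hyp_dist p q = arcosh (- lorentz p q)"

text \<open>The orthogonal projection of \<open>q\<close> to the tangent space of the hyperboloid at \<open>p\<close>.  It is a positive
  multiple of the initial velocity of the geodesic from \<open>p\<close> to \<open>q\<close>, and the Lorentz form is positive
  definite on that tangent space.\<close>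

definition hyp_direction :: "real \<times> (real^3) \<Rightarrow> real \<times> (real^3) \<Rightarrow> real \<times> (real^3)" where
  "hyp_direction p q = q + lorentz p q *\<^sub>R p"

definition lorentz_angle :: "real \<times> (real^3) \<Rightarrow> real \<times> (real^3) \<Rightarrow> real" where
  "lorentz_angle x y = arccos (lorentz x y / (sqrt (lorentz x x) * sqrt (lorentz y y)))"

definition lorentz_reject :: "real \<times> (real^3) \<Rightarrow> real \<times> (real^3) \<Rightarrow> real \<times> (real^3)" where
  "lorentz_reject a x = x - (lorentz x a / lorentz a a) *\<^sub>R a"

text \<open>The angle along the edge \<open>pq\<close> between the half-planes bounded by the line through \<open>p\<close> and \<open>q\<close> that
  contain \<open>u\<close> and \<open>w\<close>: it is measured at \<open>p\<close>, between the inward normals to the edge in the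
  two half-planes.\<close>

definition dihedral_angle ::
  "real \<times> (real^3) \<Rightarrow> real \<times> (real^3) \<Rightarrow> real \<times> (real^3) \<Rightarrow> real \<times> (real^3) \<Rightarrow> real" where
  "dihedral_angle p q u w =
     (let a = hyp_direction p q in
      lorentz_angle (lorentz_reject a (hyp_direction p u)) (lorentz_reject a (hyp_direction p w)))"

definition hyp_solid_angle ::
  "real \<times> (real^3) \<Rightarrow> real \<times> (real^3) \<Rightarrow> real \<times> (real^3) \<Rightarrow> real \<times> (real^3) \<Rightarrow> real" where
  "hyp_solid_angle p q u w =
     dihedral_angle p q u w + dihedral_angle p u q w + dihedral_angle p w q u - pi"


section \<open>Ball packings and the extended curvature\<close>

definition ball_packing :: "real^'n::finite \<Rightarrow> bool" where
  "ball_packing r \<longleftrightarrow> (\<forall>i. r $ i > 0)"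

text \<open>The map \<open>v\<close> places the vertices of \<open>s\<close> as a tetrahedron in hyperbolic space whose edge lengths are
  the sums of the radii.  Hyperbolic planes are the sections of the hyperboloid by linear
  hyperplanes, so the spanning condition says that the tetrahedron is non-degenerate.\<close>

definition realizes_tetra :: "real^'n::finite \<Rightarrow> 'n set \<Rightarrow> ('n \<Rightarrow> real \<times> (real^3)) \<Rightarrow> bool" where
  "realizes_tetra r s v \<longleftrightarrow>
     v ` s \<subseteq> hyp_space \<and>
     (\<forall>a \<in> s. \<forall>b \<in> s. a \<noteq> b \<longrightarrow> hyp_dist (v a) (v b) = r $ a + r $ b) \<and>
     span (v ` s) = UNIV"

definition real_tetra :: "real^'n::finite \<Rightarrow> 'n set \<Rightarrow> bool" where
  "real_tetra r s \<longleftrightarrow> (\<exists>v. realizes_tetra r s v)"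

definition real_packing :: "'n::finite set set \<Rightarrow> real^'n \<Rightarrow> bool" where
  "real_packing T r \<longleftrightarrow> ball_packing r \<and> (\<forall>s \<in> tetrahedra T. real_tetra r s)"

text \<open>The description is well defined for a real tetrahedron, which is unique up to isometry.\<close>

definition solid_angle :: "real^'n::finite \<Rightarrow> 'n set \<Rightarrow> 'n \<Rightarrow> real" where
  "solid_angle r s i =
     (THE \<alpha>. \<exists>v j k l. realizes_tetra r s v \<and> s = {i, j, k, l} \<and> distinct [i, j, k, l] \<and>
        \<alpha> = hyp_solid_angle (v i) (v j) (v k) (v l))"

definition coth :: "real \<Rightarrow> real" where
  "coth x = cosh x / sinh x"

definition tetra_Q :: "real^'n::finite \<Rightarrow> 'n set \<Rightarrow> real" where
  "tetra_Q r s = (\<Sum>a\<in>s. coth (r $ a))\<^sup>2 - 2 * (\<Sum>a\<in>s. (coth (r $ a))\<^sup>2) + 4"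

text \<open>Whether \<open>r\<close> lies in \<open>D\<^sub>a\<close>.  The last sum runs over the three unordered pairs of vertices of the
  face opposite to \<open>a\<close>.\<close>

definition virtual_at :: "real^'n::finite \<Rightarrow> 'n set \<Rightarrow> 'n \<Rightarrow> bool" where
  "virtual_at r s a \<longleftrightarrow>
     coth (r $ a) \<ge> (\<Sum>b\<in>s - {a}. coth (r $ b))
       + 2 * sqrt ((\<Sum>e | e \<subseteq> s - {a} \<and> card e = 2. \<Prod>b\<in>e. coth (r $ b)) + 1)"

text \<open>If \<open>Q \<le> 0\<close> and \<open>r\<close> is not in \<open>D\<^sub>i\<close> then it lies in exactly one of the sets \<open>D\<^sub>a\<close> of the other three
  vertices, and the extended angle at \<open>i\<close> is zero.\<close>

definition ext_solid_angle :: "real^'n::finite \<Rightarrow> 'n set \<Rightarrow> 'n \<Rightarrow> real" where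
  "ext_solid_angle r s i =
     (if tetra_Q r s > 0 then solid_angle r s i
      else if virtual_at r s i then 2 * pi
      else 0)"

definition ext_curvature :: "'n::finite set set \<Rightarrow> real^'n \<Rightarrow> real^'n" where
  "ext_curvature T r = (\<chi> i. 4 * pi - (\<Sum>s | s \<in> tetrahedra T \<and> i \<in> s. ext_solid_angle r s i))"


section \<open>The extended combinatorial Yamabe flow\<close>

definition ext_yamabe_solution ::
  "'n::finite set set \<Rightarrow> real^'n \<Rightarrow> (real \<Rightarrow> real^'n) \<Rightarrow> bool" where
  "ext_yamabe_solution T r0 \<rho> \<longleftrightarrow>
     \<rho> 0 = r0 \<and>
     (\<forall>t \<ge> 0. ball_packing (\<rho> t)) \<and>
     (\<forall>t \<ge> 0. \<forall>i. ((\<lambda>t. \<rho> t $ i) has_real_derivative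
        - (ext_curvature T (\<rho> t) $ i) * sinh (\<rho> t $ i)) (at t within {0..}))"

definition converges_exponentially ::
  "(real \<Rightarrow> real^'n::finite) \<Rightarrow> real^'n \<Rightarrow> bool" where
  "converges_exponentially \<rho> r \<longleftrightarrow>
     (\<exists>C lam. C > 0 \<and> lam > 0 \<and> (\<forall>t \<ge> 0. norm (\<rho> t - r) \<le> C * exp (- lam * t)))"

end

theory Submission
  imports Defs
begin

text \<open>Write \<open>y a = coth (r $ a)\<close>, \<open>x i = (\<Sum>a\<in>s. y a) - 2 * y i\<close> and \<open>\<phi> i = arctan (x i / sqrt Q)\<close>.
  The dihedral angle of a real tetrahedron at the edge opposite to \<open>k l\<close> is \<open>\<phi> k + \<phi> l\<close>, so the
  solid angle at \<open>i\<close> is \<open>2 * (\<Sum>j\<in>s - {i}. \<phi> j) - pi\<close>; with \<open>\<phi>\<close> continued by \<open>pi / 2\<close> or \<open>- pi / 2\<close>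
  to \<open>Q \<le> 0\<close>, the same formula gives the extended solid angle, which is therefore continuous.

  The Jacobian of the solid angles with respect to the radii is inverse, up to a negative factor,
  to a matrix with off-diagonal entries \<open>1 + 3 * y k * y l\<close>, and this matrix is positive definite
  where \<open>Q > 0\<close>. As the extended angles take finitely many values where \<open>Q \<le> 0\<close>, the extended
  curvature is a monotone operator, strictly so at a real packing. Hence, for a real packing \<open>r\<close>
  of zero curvature, \<open>\<Sum>i. \<integral>(x - r $ i) / sinh x\<close> (from \<open>r $ i\<close> to \<open>\<rho> t $ i\<close>) is a Lyapunov
  function with exponential decay.

  If \<open>r $ i\<close> is small and minimal in a tetrahedron, the angle at \<open>i\<close> exceeds \<open>4 * pi / 23\<close>,
  because it is at least about that of a regular Euclidean tetrahedron; if \<open>r $ i\<close> is large, the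
  angle is small. So with degrees at least 23 the vector field points inwards on the boundary of a
  large box: this keeps solutions bounded and gives a zero of the curvature by Brouwer's theorem.\<close>

section \<open>Angles of a tetrahedron in terms of the coth of the radii\<close>

text \<open>On the segment from a real packing to another packing a tetrahedron may turn virtual and
  real again, and at the wall \<open>Q = 0\<close> the extended angles are continuous while their
  derivatives may blow up like \<open>1 / sqrt Q\<close>. So the Jacobian is not integrated along
  the segment. Monotonicity is drawn from continuity alone: at each time the relevant function takes
  one of finitely many values or has negative derivative. Strictness comes from a compact
  neighbourhood of the real packing; the rest of the segment only has to do no harm. The Jacobian is
  treated through its inverse because that matrix is, up to factors, a diagonal matrix plus two
  positive rank one terms, and a sign condition on the diagonal fails at most once. The number 23 is
  the first integer above \<open>4 * pi / \<alpha>\<close>, about 22.79, where \<alpha>, about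
  0.5513, is the solid angle of a regular Euclidean tetrahedron. The margin between \<alpha> and
  \<open>4 * pi / 23\<close> is below one percent, and all numerical constants are chosen to fit
  into it.\<close>

definition coth_Q :: "'a set \<Rightarrow> ('a \<Rightarrow> real) \<Rightarrow> real" where
  "coth_Q s y = (\<Sum>a\<in>s. y a)\<^sup>2 - 2 * (\<Sum>a\<in>s. (y a)\<^sup>2) + 4"

text \<open>Half the partial derivative of \<open>coth_Q s y\<close> in \<open>y i\<close>. It is
  linear in \<open>y\<close>, so applied to a variation of \<open>y\<close> it gives its own
  derivative.\<close>

definition coth_excess :: "'a set \<Rightarrow> ('a \<Rightarrow> real) \<Rightarrow> 'a \<Rightarrow> real" where
  "coth_excess s y i = (\<Sum>a\<in>s. y a) - 2 * y i"

text \<open>The terms in \<open>y i\<close> cancel, so only the face opposite to \<open>i\<close>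
  matters. This form makes \<open>4 * face_form = coth_Q + coth_excess\<^sup>2\<close> immediate,
  the identity behind the sign arguments below.\<close>

definition face_form :: "'a set \<Rightarrow> ('a \<Rightarrow> real) \<Rightarrow> 'a \<Rightarrow> real" where
  "face_form s y i = (coth_Q s y + (coth_excess s y i)\<^sup>2) / 4"

text \<open>Geometrically, \<open>half_dihedral s y i\<close> is the angle, at an edge of the face opposite to \<open>i\<close>,
  between this face and the plane through the edge and the centre of the sphere tangent to all six
  edges; the inradius \<open>R\<close> of the face satisfies \<open>(coth R)\<^sup>2 = face_form s y i\<close>.\<close>

definition half_dihedral :: "'a set \<Rightarrow> ('a \<Rightarrow> real) \<Rightarrow> 'a \<Rightarrow> real" where
  "half_dihedral s y i = arcsin (max (-1) (min 1 (coth_excess s y i / (2 * sqrt (face_form s y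
      i)))))"

definition tetra_angle :: "'a set \<Rightarrow> ('a \<Rightarrow> real) \<Rightarrow> 'a \<Rightarrow> real" where
  "tetra_angle s y i = 2 * (\<Sum>j\<in>s - {i}. half_dihedral s y j) - pi"

lemma card_4E:
  assumes "card s = 4" "i \<in> s"
  obtains j k l where "s = {i, j, k, l}" "distinct [i, j, k, l]"
proof -
  have "card (s - {i}) = 3"
    using assms by (simp add: card.infinite card_Diff_singleton)
  then obtain j k l where "s - {i} = {j, k, l}" "j \<noteq> k" "k \<noteq> l" "j \<noteq> l"
    by (auto simp: card_3_iff)
  then show ?thesis
    using that[of j k l] assms by (metis Diff_iff distinct_length_2_or_more distinct_singleton
      insertCI insert_Diff)
qed

lemma card_4E2:
  assumes "card s = 4" "i \<in> s" "j \<in> s" "i \<noteq> j"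
  obtains k l where "s = {i, j, k, l}" "distinct [i, j, k, l]"
proof -
  obtain a b c where "s = {i, a, b, c}" "distinct [i, a, b, c]"
    using card_4E assms by metis
  then show ?thesis
    using assms that[of b c] that[of a c] that[of a b] by auto
qed

lemma coth_Q_explicit:
  assumes "distinct [i, j, k, l]"
  shows "coth_Q {i, j, k, l} y =
    (y i + y j + y k + y l)\<^sup>2 - 2 * ((y i)\<^sup>2 + (y j)\<^sup>2 + (y k)\<^sup>2 + (y l)\<^sup>2) + 4"
  using assms by (simp add: coth_Q_def add.assoc)

lemma coth_excess_explicit:
  assumes "distinct [i, j, k, l]"
  shows "coth_excess {i, j, k, l} y i = y j + y k + y l - y i"
    "coth_excess {i, j, k, l} y j = y i + y k + y l - y j"
    "coth_excess {i, j, k, l} y k = y i + y j + y l - y k"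
    "coth_excess {i, j, k, l} y l = y i + y j + y k - y l"
  using assms by (simp_all add: coth_excess_def)

lemma face_form_explicit:
  assumes "distinct [i, j, k, l]"
  shows "face_form {i, j, k, l} y i = 1 + y j * y k + y k * y l + y l * y j"
    "face_form {i, j, k, l} y j = 1 + y i * y k + y k * y l + y l * y i"
    "face_form {i, j, k, l} y k = 1 + y i * y j + y j * y l + y l * y i"
    "face_form {i, j, k, l} y l = 1 + y i * y j + y j * y k + y k * y i"
  unfolding face_form_def coth_Q_explicit[OF assms] coth_excess_explicit[OF assms] by
    (auto simp: algebra_simps power2_eq_square)

section \<open>Signs of the excesses and virtual tetrahedra\<close>

locale coth_tetra =
  fixes s :: "'a set" and y :: "'a \<Rightarrow> real"
  assumes card_s: "card s = 4" and y_gt_1: "\<And>a. a \<in> s \<Longrightarrow> y a > 1"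
begin

abbreviation "Q \<equiv> coth_Q s y"
abbreviation "X \<equiv> coth_excess s y"
abbreviation "A \<equiv> face_form s y"
text \<open>For \<open>y = coth r\<close> this is \<open>1 / (sinh r)\<^sup>2\<close>, minus the
  derivative of coth; it converts variations of radii into variations of \<open>y\<close>.\<close>

abbreviation "w i \<equiv> (y i)\<^sup>2 - 1"

lemma fin [simp]: "finite s"
  using card_s by (metis card.infinite zero_neq_numeral)

lemma w_pos: "i \<in> s \<Longrightarrow> w i > 0"
  using y_gt_1[of i] by (simp add: one_less_power)

lemma y_pos: "i \<in> s \<Longrightarrow> y i > 0"
  using y_gt_1[of i] by simp

lemma face_form_gt_1:
  assumes "i \<in> s" shows "A i > 1"
proof -
  obtain j k l where s: "s = {i, j, k, l}" "distinct [i, j, k, l]"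
    using card_4E[OF card_s assms] .
  show ?thesis
    using y_pos unfolding s(1) face_form_explicit[OF s(2)] by (simp add: add_pos_pos)
qed

lemma four_face_form: "4 * A i = Q + (X i)\<^sup>2"
  by (simp add: face_form_def)

text \<open>The sum is \<open>2 * (y k + y l)\<close> for the other two vertices. Hence at most one
  excess is nonpositive, which is why the sets \<open>D_a\<close> are disjoint.\<close>

lemma coth_excess_pair_pos:
  assumes "i \<in> s" "j \<in> s" "i \<noteq> j" shows "X i + X j > 0"
proof -
  obtain k l where s: "s = {i, j, k, l}" "distinct [i, j, k, l]"
    using card_4E2[OF card_s assms] .
  show ?thesis
    using y_pos[of k] y_pos[of l] s(1) unfolding coth_excess_explicit[OF s(2)] s(1) by simp
qed

text \<open>If \<open>X i\<close> were nonnegative, \<open>Q \<le> 0\<close> would force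
  \<open>(X i)\<^sup>2 \<ge> 4 * A i\<close>. But \<open>X i\<close> is at most the sum of the two
  smaller ones of the other three values, and the square of that sum is less than
  \<open>4 * A i\<close>.\<close>

lemma coth_excess_neg_if_max:
  assumes "Q \<le> 0" "i \<in> s" "\<And>a. a \<in> s \<Longrightarrow> y a \<le> y i"
  shows "X i < 0"
proof (rule ccontr)
  assume "\<not> X i < 0"
  obtain j k l where s: "s = {i, j, k, l}" "distinct [i, j, k, l]"
    using card_4E[OF card_s assms(2)] .
  have ge: "(X i)\<^sup>2 \<ge> 4 * A i"
    using four_face_form[of i] assms(1) by linarith
  have *: False if "0 \<le> b + c + d - a" "a \<ge> b" "a \<ge> c" "a \<ge> d" "a > 1" "b > 1" "c > 1" "d > 1"
    "(b + c + d - a)\<^sup>2 \<ge> 4 * (1 + b * c + c * d + d * b)" "d \<ge> b" "d \<ge> c" for a b c d :: real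
  proof -
    have "(b + c + d - a)\<^sup>2 \<le> (b + c)\<^sup>2"
      using that by (intro power_mono) auto
    moreover have "b * b \<le> d * b" "c * c \<le> c * d" 
      using that by (auto intro!: mult_mono)
    moreover have "d * b \<ge> 0" "c * d \<ge> 0" "b * c \<ge> 0" using that by auto
    moreover have "(b + c)\<^sup>2 = b * b + c * c + 2 * (b * c)"
      by (simp add: power2_eq_square algebra_simps)
    ultimately show False
      using that(9) by (simp add: mult.commute)
  qed
  have bs: "y j > 1" "y k > 1" "y l > 1" "y i > 1" "y j \<le> y i" "y k \<le> y i" "y l \<le> y i"
    using y_gt_1 assms(3) s by auto
  have X: "0 \<le> y j + y k + y l - y i" 
    using \<open>\<not> X i < 0\<close> unfolding s(1) coth_excess_explicit[OF s(2)] by simp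
  have ge': "(y j + y k + y l - y i)\<^sup>2 \<ge> 4 * (1 + y j * y k + y k * y l + y l * y j)"
    using ge unfolding s(1) coth_excess_explicit[OF s(2)] face_form_explicit[OF s(2)] .
  consider "y l \<ge> y j" "y l \<ge> y k" | "y k \<ge> y j" "y k \<ge> y l" | "y j \<ge> y k" "y j \<ge> y l" by linarith
  then show False
  proof cases
    case 1
    then show ?thesis using *[of "y j" "y k" "y l" "y i"] X bs ge' by auto
  next
    case 2
    then show ?thesis using *[of "y l" "y j" "y k" "y i"] X bs ge' by (auto simp: algebra_simps)
  next
    case 3
    then show ?thesis using *[of "y k" "y l" "y j" "y i"] X bs ge' by (auto simp: algebra_simps)
  qed
qed

lemma coth_excess_neg_unique:
  assumes "X i \<le> 0" "i \<in> s" "j \<in> s" "i \<noteq> j" shows "X j > 0"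
  using coth_excess_pair_pos[OF assms(2-4)] assms(1) by linarith

lemma coth_excess_pos_of_max:
  assumes "i \<in> s" "\<And>a. a \<in> s \<Longrightarrow> y a \<le> y i" "j \<in> s" "j \<noteq> i"
  shows "X j > 0"
proof -
  obtain k l where s: "s = {i, j, k, l}" "distinct [i, j, k, l]"
    using card_4E2[OF card_s assms(1,3)] assms(4) by metis
  show ?thesis
    using y_gt_1[of k] y_gt_1[of l] assms(2)[of j] s unfolding s(1) coth_excess_explicit[OF s(2)]
      by simp
qed

lemma virtual_vertex:
  assumes "Q \<le> 0"
  obtains m where "m \<in> s" "X m < 0" "\<And>j. j \<in> s \<Longrightarrow> j \<noteq> m \<Longrightarrow> X j > 0"
proof -
  have "s \<noteq> {}" using card_s by auto
  then obtain m where "m \<in> s" "\<And>a. a \<in> s \<Longrightarrow> y a \<le> y m"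
    using Max_in[of "y ` s"] Max_ge[of "y ` s"] by (metis (no_types, lifting) fin finite_imageI
      image_iff image_is_empty)
  then show ?thesis
    using that[of m] coth_excess_neg_if_max[OF assms, of m] coth_excess_neg_unique[of m] by force
qed

text \<open>Both descriptions of the angle are needed: the clamped arcsin is continuous across
  \<open>Q = 0\<close>, the arctan is easy to differentiate.\<close>

lemma half_dihedral_real:
  assumes "Q > 0" "i \<in> s"
  shows "half_dihedral s y i = arctan (X i / sqrt Q)"
proof -
  have A: "A i > 0" using face_form_gt_1[OF assms(2)] by simp
  have "2 * sqrt (A i) = sqrt (Q + (X i)\<^sup>2)"
    using four_face_form[of i] by (metis real_sqrt_four real_sqrt_mult)
  also have "\<dots> = sqrt Q * sqrt (1 + (X i / sqrt Q)\<^sup>2)"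
    using assms by (simp add: real_sqrt_mult[symmetric] power_divide field_simps)
  finally have e: "X i / (2 * sqrt (A i)) = (X i / sqrt Q) / sqrt (1 + (X i / sqrt Q)\<^sup>2)"
    by simp
  also have "\<dots> = sin (arctan (X i / sqrt Q))"
    by (simp add: sin_arctan)
  finally have e: "X i / (2 * sqrt (A i)) = sin (arctan (X i / sqrt Q))" .
  have "max (-1) (min 1 (sin (arctan (X i / sqrt Q)))) = sin (arctan (X i / sqrt Q))"
    using sin_le_one[of "arctan (X i / sqrt Q)"] sin_ge_minus_one[of "arctan (X i / sqrt Q)"]
      by linarith
  then show ?thesis
    unfolding half_dihedral_def e using arctan_bounded[of "X i / sqrt Q"] by (simp add: arcsin_sin)
qed

text \<open>As \<open>4 * A i = Q + (X i)\<^sup>2\<close>, the argument of arcsin leaves the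
  interval from -1 to 1 exactly when \<open>Q < 0\<close>, so the clamp produces the constant
  continuation.\<close>

lemma half_dihedral_virtual:
  assumes "Q \<le> 0" "i \<in> s"
  shows "half_dihedral s y i = sgn (X i) * (pi / 2)"
proof -
  have A: "A i > 0" using face_form_gt_1[OF assms(2)] by simp
  have ge: "4 * A i \<le> (X i)\<^sup>2"
    using four_face_form[of i] assms(1) by linarith
  then have "sqrt (4 * A i) \<le> \<bar>X i\<bar>"
    using real_le_lsqrt real_sqrt_le_iff by (metis real_sqrt_abs)
  then have "2 * sqrt (A i) \<le> \<bar>X i\<bar>"
    by (simp add: real_sqrt_mult)
  moreover have "X i \<noteq> 0"
    using ge A by auto
  moreover have "sqrt (A i) > 0" using A by simp
  ultimately consider "X i > 0" "X i / (2 * sqrt (A i)) \<ge> 1" | "X i < 0" "X i / (2 * sqrt (A i))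
      \<le> -1"
    by (cases "X i > 0") (auto simp: field_simps)
  then show ?thesis
    by cases (auto simp: half_dihedral_def min_def max_def)
qed

text \<open>Only the virtual vertex \<open>m\<close> has the value \<open>- pi / 2\<close>; the sum
  over the remaining vertices is \<open>3 * pi / 2\<close> at \<open>m\<close> and
  \<open>pi / 2\<close> elsewhere.\<close>

lemma tetra_angle_virtual:
  assumes "Q \<le> 0" "i \<in> s"
  shows "tetra_angle s y i = (if X i < 0 then 2 * pi else 0)"
proof -
  obtain m where m: "m \<in> s" "X m < 0" "\<And>j. j \<in> s \<Longrightarrow> j \<noteq> m \<Longrightarrow> X j > 0"
    using virtual_vertex[OF assms(1)] by blast
  obtain j k l where s: "s = {i, j, k, l}" "distinct [i, j, k, l]"
    using card_4E[OF card_s assms(2)] .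
  have "s - {i} = {j, k, l}" using s by auto
  then have "tetra_angle s y i = 2 * (half_dihedral s y j + half_dihedral s y k + half_dihedral s
      y l) - pi"
    using s by (simp add: tetra_angle_def)
  moreover have "half_dihedral s y a = (if a = m then - pi/2 else pi/2)" if "a \<in> s" for a
    using half_dihedral_virtual[OF assms(1) that] m(2) m(3)[OF that] by (cases "a = m")
      (auto simp: sgn_if)
  ultimately show ?thesis
    using s m by (auto split: if_splits dest: less_asym)
qed

end

section \<open>Definiteness of the Jacobian\<close>

text \<open>The quotient rule for \<open>arctan (X / sqrt Q)\<close>: the inner sum is half the
  variation of \<open>Q\<close>, and \<open>1 + X\<^sup>2 / Q = 4 * face_form / Q\<close>.\<close>

definition half_dihedral_deriv :: "'a set \<Rightarrow> ('a \<Rightarrow> real) \<Rightarrow> ('a \<Rightarrow> real) \<Rightarrow> 'a \<Rightarrow> real" where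
  "half_dihedral_deriv s y d j = (coth_Q s y * coth_excess s d j - coth_excess s y j * (\<Sum>a\<in>s.
      coth_excess s y a * d a)) /
     (4 * sqrt (coth_Q s y) * face_form s y j)"

definition tetra_angle_deriv :: "'a set \<Rightarrow> ('a \<Rightarrow> real) \<Rightarrow> ('a \<Rightarrow> real) \<Rightarrow> 'a \<Rightarrow> real" where
  "tetra_angle_deriv s y d i = 2 * (\<Sum>j\<in>s - {i}. half_dihedral_deriv s y d j)"

text \<open>Here \<open>u\<close> stands for the variations of \<open>half_dihedral\<close> and
  \<open>z\<close> for those of half the solid angles. In terms of \<open>u\<close> every
  coefficient acquires a factor \<open>face_form\<close>, which cancels the denominator of
  \<open>half_dihedral_deriv\<close>.\<close>

lemma row_identity:
  fixes a b c d :: real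
  assumes "Om = 1 + a * b + a * c + a * d + b * c + b * d + c * d + a * b * c * d"
    "z1 = u2 + u3 + u4" "z2 = u1 + u3 + u4" "z3 = u1 + u2 + u4" "z4 = u1 + u2 + u3"
  shows "(a\<^sup>2 - 1) * (z1 + z2 + z3 + z4)
      + 3 * (a\<^sup>2 - 1) * (c * d * z2 + b * d * z3 + b * c * z4) + 3 * (Om - (a\<^sup>2 - 1)) * z1
    = 3 * ((a\<^sup>2 - 1) * ((1 + b * c + c * d + d * b) * u1)
       + (1 + a * b) * ((1 + a * c + c * d + d * a) * u2)
       + (1 + a * c) * ((1 + a * b + b * d + d * a) * u3)
       + (1 + a * d) * ((1 + a * b + b * c + c * a) * u4))"
  unfolding assms by (simp add: algebra_simps power2_eq_square)

text \<open>Consider the matrix with diagonal entries \<open>a\<^sup>2 - 1\<close> and off-diagonal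
  entries \<open>1 + a * b\<close>. Its row for \<open>a\<close> sends the excesses of the values to
  \<open>Q * a\<close> and the excesses of the variation to \<open>a * xi + 4 * a'\<close>, so the
  terms with \<open>xi\<close> cancel.\<close>

lemma column_identity:
  fixes a b c d :: real
  assumes "Q = (a + b + c + d)\<^sup>2 - 2 * (a\<^sup>2 + b\<^sup>2 + c\<^sup>2 + d\<^sup>2) + 4"
    "xi = (b + c + d - a) * a' + (a + c + d - b) * b' + (a + b + d - c) * c' + (a + b + c - d) * d'"
  shows "(a\<^sup>2 - 1) * (Q * (b' + c' + d' - a') - (b + c + d - a) * xi)
       + (1 + a * b) * (Q * (a' + c' + d' - b') - (a + c + d - b) * xi)
       + (1 + a * c) * (Q * (a' + b' + d' - c') - (a + b + d - c) * xi)
       + (1 + a * d) * (Q * (a' + b' + c' - d') - (a + b + c - d) * xi) = 4 * Q * a'"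
  unfolding assms by (simp add: algebra_simps power2_eq_square)

section \<open>The inverse of the Jacobian as a quadratic form\<close>

context coth_tetra
begin

abbreviation "P \<equiv> \<Prod>a\<in>s. y a"

text \<open>One plus the second and fourth elementary symmetric functions. For
  \<open>y = coth r\<close> it is the cosh of the sum of the four radii divided by the product of
  their sinh.\<close>

abbreviation "Om \<equiv> 1 + ((\<Sum>a\<in>s. y a)\<^sup>2 - (\<Sum>a\<in>s. (y a)\<^sup>2)) / 2 + P"

text \<open>A third of what remains of the diagonal entry \<open>3 * Om / w i - 2\<close> after the
  two rank one terms have taken off \<open>1\<close> and
  \<open>3 * P / (y i)\<^sup>2\<close>.\<close>

definition response_weight :: "'a \<Rightarrow> real" where
  "response_weight i = Om / w i - P / (y i)\<^sup>2 - 1"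

definition response_form :: "('a \<Rightarrow> real) \<Rightarrow> ('a \<Rightarrow> real) \<Rightarrow> real" where
  "response_form z z' = (\<Sum>a\<in>s. z a) * (\<Sum>a\<in>s. z' a) + 3 * P * (\<Sum>a\<in>s. z a / y a) * (\<Sum>a\<in>s. z' a / y a)
     + 3 * (\<Sum>a\<in>s. response_weight a * z a * z' a)"

lemma response_form_rows:
  "response_form z z' = (\<Sum>i\<in>s. z i * ((\<Sum>a\<in>s. z' a) + 3 * (P / y i) * (\<Sum>a\<in>s. z' a / y a) + 3 *
      response_weight i * z' i))"
proof -
  have "(\<Sum>i\<in>s. z i * (S + 3 * (p / y i) * V + 3 * response_weight i * z' i)) =
      (\<Sum>i\<in>s. z i) * S + 3 * p * (\<Sum>i\<in>s. z i / y i) * V + 3 * (\<Sum>a\<in>s. response_weight a * z a * z'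
          a)" for S V p
    by (simp add: sum.distrib sum_distrib_left sum_distrib_right algebra_simps)
  from this[of "sum z' s" P "\<Sum>a\<in>s. z' a / y a"] show ?thesis
    unfolding response_form_def by simp
qed

lemma response_form_diff:
  "response_form (\<lambda>a. z a - t * z' a) (\<lambda>a. z a - t * z' a) = response_form z z - 2 * t *
      response_form z z' + t\<^sup>2 * response_form z' z'"
proof -
  have 1: "(\<Sum>a\<in>s. z a - t * z' a) = (\<Sum>a\<in>s. z a) - t * (\<Sum>a\<in>s. z' a)"
    "(\<Sum>a\<in>s. (z a - t * z' a) / y a) = (\<Sum>a\<in>s. z a / y a) - t * (\<Sum>a\<in>s. z' a / y a)"
    by (simp_all add: sum_subtractf sum_distrib_left diff_divide_distrib)
  have 2: "(\<Sum>a\<in>s. response_weight a * (z a - t * z' a) * (z a - t * z' a)) =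
     (\<Sum>a\<in>s. response_weight a * z a * z a) - 2 * t * (\<Sum>a\<in>s. response_weight a * z a * z' a) + t\<^sup>2
         * (\<Sum>a\<in>s. response_weight a * z' a * z' a)"
    unfolding sum_distrib_left sum_subtractf[symmetric] sum.distrib[symmetric]
    by (rule sum.cong) (simp_all add: algebra_simps power2_eq_square)
  show ?thesis
    unfolding response_form_def 1 2 by (simp add: algebra_simps power2_eq_square)
qed

text \<open>The matrix of \<open>response_form\<close> thus inverts the Jacobian up to the factor
  \<open>6 * sqrt Q / w i\<close>. \<open>row_identity\<close> clears the denominators of the
  derivatives and \<open>column_identity\<close> evaluates the outcome.\<close>

lemma response_row_angle_deriv:
  assumes Q: "Q > 0" and i: "i \<in> s" and z: "z = tetra_angle_deriv s y d"
  shows "(\<Sum>a\<in>s. z a) + 3 * (P / y i) * (\<Sum>a\<in>s. z a / y a) + 3 * response_weight i * z i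
      = 6 * sqrt Q * d i / w i"
proof -
  obtain j k l where s: "s = {i, j, k, l}" "distinct [i, j, k, l]"
    using card_4E[OF card_s i] .
  have fA: "4 * sqrt Q * (A m * half_dihedral_deriv s y d m)
      = Q * coth_excess s d m - X m * (\<Sum>a\<in>s. X a * d a)" if "m \<in> s" for m
    using face_form_gt_1[OF that] Q by (simp add: half_dihedral_deriv_def)
  have mem: "j \<in> s" "k \<in> s" "l \<in> s" using s by auto
  have yp: "y i > 0" "y j > 0" "y k > 0" "y l > 0" and wp: "w i > 0"
    using y_pos w_pos[OF i] i mem by auto
  have sum4: "(\<Sum>a\<in>s. f a) = f i + f j + f k + f l" for f :: "'a \<Rightarrow> real"
    unfolding s(1) using s(2) by simp
  have prod4: "P = y i * y j * y k * y l"
    unfolding s(1) using s(2) by simp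
  note xv = coth_excess_explicit[OF s(2), folded s(1)] and fa
      = face_form_explicit[OF s(2), folded s(1)]
  have Om: "Om = 1 + y i * y j + y i * y k + y i * y l + y j * y k + y j * y l + y k * y l + y i *
      y j * y k * y l"
    unfolding sum4 prod4 by (simp add: field_simps power2_eq_square)
  let ?u = "half_dihedral_deriv s y d"
  have diff: "s - {i} = {j, k, l}" "s - {j} = {i, k, l}" "s - {k} = {i, j, l}" "s - {l} = {i, j, k}"
    using s(2) unfolding s(1) by auto
  have z': "z i / 2 = ?u j + ?u k + ?u l" "z j / 2 = ?u i + ?u k + ?u l" "z k / 2
      = ?u i + ?u j + ?u l"
    "z l / 2 = ?u i + ?u j + ?u k"
    using s(2) unfolding z tetra_angle_deriv_def diff by simp_all
  have *: "w i * (z i / 2 + z j / 2 + z k / 2 + z l / 2)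
      + 3 * w i * (y k * y l * (z j / 2) + y j * y l * (z k / 2) + y j * y k * (z l / 2)) + 3 *
          (Om - w i) * (z i / 2)
    = 3 * (w i * (A i * ?u i) + (1 + y i * y j) * (A j * ?u j) + (1 + y i * y k) * (A k * ?u k)
       + (1 + y i * y l) * (A l * ?u l))"
    unfolding fa by (rule row_identity[OF Om z'])
  have xi: "(\<Sum>a\<in>s. X a * d a) = (y j + y k + y l - y i) * d i + (y i + y k + y l - y j) * d j
     + (y i + y j + y l - y k) * d k + (y i + y j + y k - y l) * d l"
    unfolding sum4 xv by (rule refl)
  note Q4 = coth_Q_explicit[OF s(2), folded s(1)]
  have expand: "4 * r * (p1 * (m1 * u1) + p2 * (m2 * u2) + p3 * (m3 * u3) + p4 * (m4 * u4)) =
     p1 * (4 * r * (m1 * u1)) + p2 * (4 * r * (m2 * u2)) + p3 * (4 * r * (m3 * u3)) + p4 * (4 * r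
         * (m4 * u4))"
    for r p1 p2 p3 p4 m1 m2 m3 m4 u1 u2 u3 u4 :: real
    by (simp add: algebra_simps)
  have "4 * sqrt Q * (w i * (A i * ?u i) + (1 + y i * y j) * (A j * ?u j) + (1 + y i * y k) * (A k
      * ?u k)
       + (1 + y i * y l) * (A l * ?u l)) = 4 * Q * d i"
    unfolding expand fA[OF i] fA[OF mem(1)] fA[OF mem(2)] fA[OF mem(3)] xv
    by (rule column_identity[OF Q4 xi])
  also have "\<dots> = 4 * sqrt Q * (sqrt Q * d i)"
    using Q by (simp flip: mult.assoc add: real_sqrt_mult_self)
  finally have **: "w i * (A i * ?u i) + (1 + y i * y j) * (A j * ?u j) + (1 + y i * y k) * (A k *
      ?u k)
       + (1 + y i * y l) * (A l * ?u l) = sqrt Q * d i"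
    using Q by simp
  have "(\<Sum>a\<in>s. z a) + 3 * (P / y i) * (\<Sum>a\<in>s. z a / y a) + 3 * response_weight i * z i
     = (z i + z j + z k + z l) + 3 * (y k * y l * z j + y j * y l * z k + y j * y k * z l)
        + 3 * (Om / w i - 1) * z i"
  proof -
    have "P / y i * (z i / y i + z j / y j + z k / y k + z l / y l) =
       P / (y i)\<^sup>2 * z i + (y k * y l * z j + y j * y l * z k + y j * y k * z l)"
      unfolding prod4 using yp by (simp add: field_simps power2_eq_square)
    moreover have "u + 3 * pp * S + 3 * (r - q - 1) * v = u + 3 * t + 3 * (r - 1) * v"
      if "pp * S = q * v + t" for u pp S r q v t :: real
      using that by (simp add: algebra_simps)
    ultimately show ?thesis
      unfolding response_weight_def sum4[of z] sum4[of "\<lambda>a. z a / y a"] by blast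
  qed
  also have "w i * \<dots> = w i * (z i + z j + z k + z l)
      + 3 * w i * (y k * y l * z j + y j * y l * z k + y j * y k * z l) + 3 * (Om - w i) * z i"
    using wp by (simp add: field_simps)
  also have "\<dots> = 6 * (sqrt Q * d i)"
    using * unfolding ** by (simp add: field_simps)
  finally show ?thesis
    using wp by (simp add: field_simps)
qed

text \<open>\<open>w i * response_weight i\<close> is \<open>y i * X i\<close> plus positive
  terms.\<close>

lemma response_weight_nonpos_imp:
  assumes "i \<in> s" "response_weight i \<le> 0" shows "X i < 0"
proof -
  obtain j k l where s: "s = {i, j, k, l}" "distinct [i, j, k, l]"
    using card_4E[OF card_s assms(1)] .
  have sum4: "(\<Sum>a\<in>s. f a) = f i + f j + f k + f l" for f :: "'a \<Rightarrow> real"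
    unfolding s(1) using s(2) by simp
  have P: "P = y i * y j * y k * y l"
    unfolding s(1) using s(2) by simp
  have yp: "y i > 0" "y j > 0" "y k > 0" "y l > 0"
    using y_pos s(1) by auto
  have "w i * response_weight i = Om - w i * (P / (y i)\<^sup>2) - w i"
    using w_pos[OF assms(1)] by (simp add: response_weight_def field_simps)
  also have "\<dots> = P / (y i)\<^sup>2 + ((\<Sum>a\<in>s. y a)\<^sup>2 - (\<Sum>a\<in>s. (y a)\<^sup>2)) / 2 + 2 - (y i)\<^sup>2"
    using yp by (simp add: field_simps power2_eq_square)
  also have "\<dots> = P / (y i)\<^sup>2 + y i * (y j + y k + y l - y i) + (y j * y k + y j * y l + y k * y l)
      + 2"
    unfolding sum4 by (simp add: field_simps power2_eq_square)
  finally have "P / (y i)\<^sup>2 + y i * (y j + y k + y l - y i) + (y j * y k + y j * y l + y k * y l)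
      + 2 \<le> 0"
    using assms(2) w_pos[OF assms(1)] by (metis mult_le_0_iff less_eq_real_def)
  moreover have "P / (y i)\<^sup>2 > 0" "y j * y k + y j * y l + y k * y l > 0"
    unfolding P using yp by (simp_all add: add_pos_pos)
  ultimately have "y i * (y j + y k + y l - y i) < 0"
    by linarith
  then have "y j + y k + y l - y i < 0"
    using yp by (simp add: mult_less_0_iff)
  then show ?thesis
    unfolding coth_excess_explicit[OF s(2), folded s(1)] .
qed

lemma response_form_nonneg:
  assumes "\<And>a. a \<in> s \<Longrightarrow> z a \<noteq> 0 \<Longrightarrow> response_weight a > 0"
  shows "response_form z z \<ge> 0" and "b \<in> s \<Longrightarrow> z b \<noteq> 0 \<Longrightarrow> response_form z z > 0"
proof -
  have P: "P > 0"
    using y_pos by (simp add: prod_pos)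
  have nn: "response_weight a * z a * z a \<ge> 0" if "a \<in> s" for a
    using assms[OF that] by (cases "z a = 0") (auto simp: mult.assoc intro!: mult_nonneg_nonneg)
  then have k: "(\<Sum>a\<in>s. response_weight a * z a * z a) \<ge> 0"
    by (rule sum_nonneg)
  have sq: "sum z s * sum z s \<ge> 0" "3 * P * (\<Sum>a\<in>s. z a / y a) * (\<Sum>a\<in>s. z a / y a) \<ge> 0"
    using P by (simp_all add: mult.assoc)
  show "response_form z z \<ge> 0"
    unfolding response_form_def using k sq by linarith
  show "response_form z z > 0" if b: "b \<in> s" "z b \<noteq> 0"
  proof -
    have "response_weight b * z b * z b > 0"
      using assms[OF b] b(2) by (auto simp: mult.assoc zero_less_mult_iff)
    then have "(\<Sum>a\<in>s. response_weight a * z a * z a) > 0"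
      using nn b(1) by (intro sum_pos2[of s b]) auto
    then show ?thesis
      unfolding response_form_def using sq by linarith
  qed
qed

lemma response_form_angle_deriv:
  assumes "Q > 0"
  shows "response_form z (tetra_angle_deriv s y d) = 6 * sqrt Q * (\<Sum>i\<in>s. z i * d i / w i)"
proof -
  have "response_form z (tetra_angle_deriv s y d) = (\<Sum>i\<in>s. z i * (6 * sqrt Q * d i / w i))"
    unfolding response_form_rows by (intro sum.cong refl) (simp only: response_row_angle_deriv[OF
      assms _ refl])
  then show ?thesis
    by (simp add: sum_distrib_left mult_ac)
qed

text \<open>At most one \<open>response_weight m\<close> fails to be positive. The response \<open>tetra_angle_deriv s y d\<close>
  to a variation \<open>d\<close> of \<open>y m\<close> alone is orthogonal, for the form, to all vectors with vanishing
  \<open>m\<close>-th entry, so splitting it off reduces positivity to those vectors.\<close>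

lemma response_form_pos:
  assumes Q: "Q > 0" and b: "b \<in> s" "z b \<noteq> 0"
  shows "response_form z z > 0"
proof (cases "\<exists>m\<in>s. response_weight m \<le> 0 \<and> z m \<noteq> 0")
  case False
  then show ?thesis
    using response_form_nonneg(2)[of z b] b by force
next
  case True
  then obtain m where m: "m \<in> s" "response_weight m \<le> 0" "z m \<noteq> 0" by blast
  have Xm: "X m < 0" using response_weight_nonpos_imp[OF m(1,2)] .
  have response_weight: "response_weight a > 0" if "a \<in> s" "a \<noteq> m" for a
    using response_weight_nonpos_imp[OF that(1)] coth_excess_neg_unique[of m a] Xm m(1) that by
      force
  \<comment> \<open>The factor \<open>w m\<close> cancels the denominator in
    \<open>response_form_angle_deriv\<close>, so pairing with \<open>v\<close> reads off the
    \<open>m\<close>-th entry up to \<open>6 * sqrt Q\<close>.\<close>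
  define d where "d a = (if a = m then w m else 0)" for a
  define v where "v = tetra_angle_deriv s y d"
  have w: "w m > 0" using w_pos[OF m(1)] .
  \<comment> \<open>Since \<open>X m < 0 < X j\<close>, both terms in the numerator of the
    derivative are positive.\<close>
  have pos: "half_dihedral_deriv s y d j > 0" if j: "j \<in> s - {m}" for j
  proof -
    have s: "(\<Sum>a\<in>s. X a * d a) = X m * w m" "(\<Sum>a\<in>s. d a) = w m"
      using m(1) by (simp_all add: d_def if_distrib[of "(*) _"] cong: if_cong)
    have "coth_excess s d j = w m"
      unfolding coth_excess_def s using j by (simp add: d_def)
    moreover have "X j * (X m * w m) < 0"
      using coth_excess_neg_unique[of m j] Xm m(1) j w by (auto simp: mult_pos_neg mult_neg_pos)
    moreover have "Q * w m > 0" using Q w by simp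
    ultimately show ?thesis
      unfolding half_dihedral_deriv_def s using face_form_gt_1[of j] Q j by simp
  qed
  have "s - {m} \<noteq> {}"
    using card_s m(1) by (metis Diff_eq_empty_iff card_mono card.empty card_insert_disjoint
      finite.emptyI
        finite.insertI empty_iff numeral_le_one_iff One_nat_def semiring_norm(69))
  then have "sum (half_dihedral_deriv s y d) (s - {m}) > 0"
    using pos by (intro sum_pos) auto
  then have vm: "v m > 0"
    unfolding v_def tetra_angle_deriv_def by simp
  have zv: "response_form u v = 6 * sqrt Q * u m" for u
  proof -
    have "(\<Sum>i\<in>s. u i * d i / w i) = (\<Sum>i\<in>s. if i = m then u m else 0)"
      using w by (intro sum.cong) (auto simp: d_def)
    then show ?thesis
      unfolding v_def response_form_angle_deriv[OF Q] using m(1) by simp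
  qed
  define t where "t = z m / v m"
  have "response_form (\<lambda>a. z a - t * v a) (\<lambda>a. z a - t * v a) \<ge> 0"
  proof (rule response_form_nonneg(1))
    show "response_weight a > 0" if "a \<in> s" "z a - t * v a \<noteq> 0" for a
      using response_weight[of a] that vm by (cases "a = m") (auto simp: t_def)
  qed
  then have "response_form z z \<ge> 2 * t * (6 * sqrt Q * z m) - t\<^sup>2 * (6 * sqrt Q * v m)"
    unfolding response_form_diff zv by linarith
  also have "2 * t * (6 * sqrt Q * z m) - t\<^sup>2 * (6 * sqrt Q * v m) = 6 * sqrt Q * ((z m)\<^sup>2 / v m)"
    using vm by (simp add: t_def field_simps power2_eq_square)
  finally show ?thesis
    using vm m(3) Q by (smt (verit) divide_pos_pos mult_pos_pos real_sqrt_gt_zero zero_less_power2)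
qed

text \<open>A variation \<open>v\<close> of the radii induces \<open>d i = - w i * v i\<close>, so
  this sum is minus the quadratic form of the Jacobian in the radii. Up to a positive factor it is
  \<open>response_form z z\<close> for the response \<open>z\<close>, which is nonzero because the
  Jacobian is injective.\<close>

theorem tetra_angle_deriv_definite:
  assumes Q: "Q > 0" and b: "b \<in> s" "d b \<noteq> 0"
  shows "(\<Sum>i\<in>s. tetra_angle_deriv s y d i * d i / w i) > 0"
proof -
  define z where "z = tetra_angle_deriv s y d"
  have "\<exists>i\<in>s. z i \<noteq> 0"
  proof (rule ccontr)
    assume "\<not> (\<exists>i\<in>s. z i \<noteq> 0)"
    then have "6 * sqrt Q * d b / w b = 0"
      using response_row_angle_deriv[OF Q b(1) z_def] b(1) by simp
    then show False
      using Q b w_pos[OF b(1)] by simp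
  qed
  then have "response_form z z > 0"
    using response_form_pos[OF Q] by blast
  then have "6 * sqrt Q * (\<Sum>i\<in>s. z i * d i / w i) > 0"
    using response_form_angle_deriv[OF Q, of z d] by (simp flip: z_def)
  then show ?thesis
    using Q by (simp add: zero_less_mult_iff z_def)
qed

end

section \<open>Monotonicity of the extended angles\<close>

lemma DERIV_coth:
  assumes "x \<noteq> 0"
  shows "(coth has_real_derivative - ((coth x)\<^sup>2 - 1)) (at x)"
proof -
  have s: "sinh x \<noteq> 0" using assms by simp
  have "((\<lambda>x. cosh x / sinh x) has_real_derivative - ((coth x)\<^sup>2 - 1)) (at x)"
    by (rule derivative_eq_intros refl s)+
      (use s in \<open>simp add: coth_def field_simps power2_eq_square\<close>)
  then show ?thesis
    by (rule DERIV_cong_ev[THEN iffD1, rotated -1]) (auto simp: coth_def)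
qed

lemma coth_gt_1:
  assumes "x > 0" shows "coth x > 1"
proof -
  have "cosh x - sinh x = exp (-x)" by (rule cosh_minus_sinh)
  then have "sinh x < cosh x" by (metis diff_gt_0_iff_gt exp_gt_zero)
  then show ?thesis using assms by (simp add: coth_def)
qed

lemma continuous_on_coth:
  assumes "continuous_on S f" "\<And>x. x \<in> S \<Longrightarrow> f x \<noteq> 0"
  shows "continuous_on S (\<lambda>x. coth (f x))"
  unfolding coth_def using assms by (intro continuous_intros) auto

lemma continuous_on_coth_Q:
  assumes "\<And>a. a \<in> s \<Longrightarrow> continuous_on S (\<lambda>x. Y x a)"
  shows "continuous_on S (\<lambda>x. coth_Q s (Y x))"
  unfolding coth_Q_def using assms by (intro continuous_intros) auto

lemma continuous_on_coth_excess:
  assumes "\<And>a. a \<in> s \<Longrightarrow> continuous_on S (\<lambda>x. Y x a)" "i \<in> s"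
  shows "continuous_on S (\<lambda>x. coth_excess s (Y x) i)"
  unfolding coth_excess_def using assms by (intro continuous_intros) auto

lemma continuous_on_face_form:
  assumes "\<And>a. a \<in> s \<Longrightarrow> continuous_on S (\<lambda>x. Y x a)" "i \<in> s"
  shows "continuous_on S (\<lambda>x. face_form s (Y x) i)"
  unfolding face_form_def using assms by (intro continuous_intros continuous_on_coth_Q
    continuous_on_coth_excess) auto

lemma continuous_on_tetra_angle:
  assumes "\<And>a. a \<in> s \<Longrightarrow> continuous_on S (\<lambda>x. Y x a)" "\<And>x. x \<in> S \<Longrightarrow> coth_tetra s (Y x)"
  shows "continuous_on S (\<lambda>x. tetra_angle s (Y x) i)"
proof -
  have "continuous_on S (\<lambda>x. half_dihedral s (Y x) j)" if j: "j \<in> s" for j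
    unfolding half_dihedral_def
  proof (intro continuous_intros continuous_on_coth_excess continuous_on_face_form ballI conjI)
    show "2 * sqrt (face_form s (Y x) j) \<noteq> 0" if "x \<in> S" for x
      using coth_tetra.face_form_gt_1[OF assms(2)[OF that] j] by simp
  qed (use assms j in auto)
  then show ?thesis
    unfolding tetra_angle_def by (intro continuous_intros) auto
qed

lemma continuous_on_tetra_angle_deriv:
  assumes "\<And>a. a \<in> s \<Longrightarrow> continuous_on S (\<lambda>x. Y x a)" "\<And>x. x \<in> S \<Longrightarrow> coth_tetra s (Y x)"
    "\<And>x. x \<in> S \<Longrightarrow> coth_Q s (Y x) > 0"
    "\<And>a. a \<in> s \<Longrightarrow> continuous_on S (\<lambda>x. D x a)"
  shows "continuous_on S (\<lambda>x. tetra_angle_deriv s (Y x) (D x) i)"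
proof -
  have "continuous_on S (\<lambda>x. half_dihedral_deriv s (Y x) (D x) j)" if j: "j \<in> s" for j
    unfolding half_dihedral_deriv_def
  proof (intro continuous_intros continuous_on_coth_excess continuous_on_face_form
      continuous_on_coth_Q ballI)
    show "4 * sqrt (coth_Q s (Y x)) * face_form s (Y x) j \<noteq> 0" if "x \<in> S" for x
      using coth_tetra.face_form_gt_1[OF assms(2)[OF that] j] assms(3)[OF that] by simp
  qed (use assms j in auto)
  then show ?thesis
    unfolding tetra_angle_deriv_def by (intro continuous_intros) auto
qed

lemma DERIV_half_dihedral:
  assumes coth_tetra: "coth_tetra s (Y t)" and Q: "coth_Q s (Y t) > 0" and i: "i \<in> s"
    and Y: "\<And>a. a \<in> s \<Longrightarrow> ((\<lambda>t. Y t a) has_real_derivative d a) (at t)"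
  shows "((\<lambda>t. half_dihedral s (Y t) i) has_real_derivative half_dihedral_deriv s (Y t) d i) (at t)"
proof -
  interpret coth_tetra s "Y t" by fact
  have cont: "isCont (\<lambda>t. Y t a) t" if "a \<in> s" for a
    using Y[OF that] DERIV_isCont by blast
  have dX: "((\<lambda>t. coth_excess s (Y t) i) has_real_derivative coth_excess s d i) (at t)"
    unfolding coth_excess_def using Y i by (auto intro!: derivative_eq_intros)
  have dQ: "((\<lambda>t. coth_Q s (Y t)) has_real_derivative 2 * (\<Sum>a\<in>s. X a * d a)) (at t)"
  proof -
    have "(\<Sum>a\<in>s. X a * d a) = (\<Sum>a\<in>s. Y t a) * (\<Sum>a\<in>s. d a) - 2 * (\<Sum>a\<in>s. Y t a * d a)"
      by (simp add: coth_excess_def left_diff_distrib sum_subtractf sum_distrib_left mult.assoc)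
    then show ?thesis
      unfolding coth_Q_def using Y
      by (auto intro!: derivative_eq_intros simp: sum_distrib_left mult_ac)
  qed
  have evQ: "eventually (\<lambda>t. coth_Q s (Y t) > 0) (nhds t)"
    using DERIV_isCont[OF dQ] Q by (metis eventually_nhds_x_imp_x isContD isCont_def
      order_tendstoD(1) tendsto_at_iff_tendsto_nhds)
  have "eventually (\<lambda>t. Y t a > 1) (nhds t)" if "a \<in> s" for a
    using cont[OF that] y_gt_1[OF that] by (metis isCont_def order_tendstoD(1)
      tendsto_at_iff_tendsto_nhds)
  then have "eventually (\<lambda>t. \<forall>a\<in>s. Y t a > 1) (nhds t)"
    by (simp add: eventually_ball_finite)
  then have ev: "eventually (\<lambda>t. half_dihedral s (Y t) i = arctan (coth_excess s (Y t) i / sqrt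
      (coth_Q s (Y t)))) (nhds t)"
    using evQ
  proof eventually_elim
    case (elim u)
    interpret u: coth_tetra s "Y u"
      using elim card_s by unfold_locales auto
    show ?case
      using u.half_dihedral_real[OF elim(2) i] .
  qed
  have "((\<lambda>t. arctan (coth_excess s (Y t) i / sqrt (coth_Q s (Y t)))) has_real_derivative
      half_dihedral_deriv s (Y t) d i) (at t)"
  proof -
    have dS: "((\<lambda>t. sqrt (coth_Q s (Y t))) has_real_derivative
        inverse (sqrt Q) / 2 * (2 * (\<Sum>a\<in>s. X a * d a))) (at t)"
      by (rule DERIV_chain2[OF DERIV_real_sqrt[OF Q] dQ])
    have nz: "sqrt Q \<noteq> 0" using Q by simp
    define q where "q = sqrt Q"
    have q: "q > 0" "Q = q\<^sup>2" using Q by (auto simp: q_def)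
    have A: "4 * A i = q\<^sup>2 + (X i)\<^sup>2" "A i > 0" using four_face_form[of i] face_form_gt_1[OF i] q
        by auto
    have "inverse (1 + (X i / q)\<^sup>2) = q\<^sup>2 / (4 * A i)"
      unfolding A(1) using q by (simp add: field_simps)
    then have "inverse (1 + (X i / q)\<^sup>2) * ((v * q - X i * (inverse q / 2 * (2 * S))) / (q * q)) =
       (Q * v - X i * S) / (4 * q * A i)" for v S
      unfolding q(2) using q(1) A(2) by (simp add: field_simps power2_eq_square)
    from this[of "coth_excess s d i" "\<Sum>a\<in>s. X a * d a"] have "inverse (1 + (X i / sqrt Q)\<^sup>2) *
        ((coth_excess s d i * sqrt Q - X i * (inverse (sqrt Q) / 2 * (2 * (\<Sum>a\<in>s. X a * d a)))) /
            (sqrt Q * sqrt Q)) =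
      half_dihedral_deriv s (Y t) d i"
      unfolding half_dihedral_deriv_def q_def .
    then show ?thesis
      using DERIV_chain2[OF DERIV_arctan DERIV_divide[OF dX dS nz]] by simp
  qed
  then show ?thesis
    using DERIV_cong_ev[OF refl ev refl] by simp
qed

lemma DERIV_tetra_angle:
  assumes coth_tetra: "coth_tetra s (Y t)" and Q: "coth_Q s (Y t) > 0" 
    and Y: "\<And>a. a \<in> s \<Longrightarrow> ((\<lambda>t. Y t a) has_real_derivative d a) (at t)"
  shows "((\<lambda>t. tetra_angle s (Y t) i) has_real_derivative tetra_angle_deriv s (Y t) d i) (at t)"
  unfolding tetra_angle_def tetra_angle_deriv_def
  by (auto intro!: derivative_eq_intros DERIV_half_dihedral[OF coth_tetra Q _ Y])

text \<open>Were \<open>g b > g a\<close>, take a level \<open>v\<close> strictly between them and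
  outside \<open>V\<close>, and the last time \<open>t\<close> with \<open>g t \<le> v\<close>.
  There \<open>g t = v\<close>, so the derivative is negative and \<open>g\<close> stays below
  \<open>v\<close> a little longer. The argument tolerates infinitely many crossings of the
  wall.\<close>

lemma nonincreasing_off_finite:
  fixes g :: "real \<Rightarrow> real"
  assumes "a \<le> b" "finite V" and cont: "continuous_on {a..b} g"
    and g: "\<And>t. t \<in> {a..b} \<Longrightarrow> g t \<in> V \<or> (\<exists>D<0. (g has_real_derivative D) (at t))"
  shows "g b \<le> g a"
proof (rule ccontr)
  assume "\<not> g b \<le> g a"
  then have "infinite {g a<..<g b}" by (simp add: infinite_Ioo)
  then obtain v where v: "g a < v" "v < g b" "v \<notin> V"
    using assms(2) by (metis greaterThanLessThan_iff rev_finite_subset subsetI)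
  define S where "S = {a..b} \<inter> g -` {..v}"
  have "closed S"
    unfolding S_def using cont by (intro continuous_closed_preimage) auto
  moreover have "bounded S"
    using bounded_closed_interval[of a b] unfolding S_def by (rule bounded_subset) auto
  moreover have "a \<in> S"
    using assms(1) v by (simp add: S_def)
  ultimately obtain t where t: "t \<in> S" "\<And>u. u \<in> S \<Longrightarrow> u \<le> t"
    using compact_attains_sup[of S] by (auto simp: compact_eq_bounded_closed)
  have "t < b" using t v by (cases "t = b") (auto simp: S_def)
  have "g t = v"
  proof (rule ccontr)
    assume "g t \<noteq> v"
    then have "g t < v" using t by (auto simp: S_def)
    moreover have "continuous_on {t..b} g"
      using t by (intro continuous_on_subset[OF cont]) (auto simp: S_def)
    ultimately obtain u where "t \<le> u" "u \<le> b" "g u = v"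
      using IVT'[of g t v b] v \<open>t < b\<close> by auto
    moreover from this have "u \<in> S"
      using t(1) by (simp add: S_def)
    ultimately show False
      using t(2)[of u] \<open>g t \<noteq> v\<close> by simp
  qed
  then obtain D where "D < 0" "(g has_real_derivative D) (at t)"
    using g[of t] t v by (auto simp: S_def)
  then obtain e where e: "e > 0" "\<And>h. 0 < h \<Longrightarrow> h < e \<Longrightarrow> g (t + h) < g t"
    using DERIV_neg_dec_right[of g D t] by blast
  define h where "h = min (e / 2) (b - t)"
  have h: "0 < h" "h < e" "t + h \<le> b" using e \<open>t < b\<close> by (auto simp: h_def)
  then have "t + h \<in> S"
    using e(2)[of h] \<open>g t = v\<close> t by (auto simp: S_def)
  then show False using t(2) h(1) by force
qed

section \<open>Pairing the angles with a variation of the radii\<close>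

definition coth_radii :: "real^'n::finite \<Rightarrow> 'n \<Rightarrow> real" where
  "coth_radii r a = coth (r $ a)"

lemma coth_tetra_radii:
  assumes "card s = 4" "ball_packing r" shows "coth_tetra s (coth_radii r)"
  using assms by unfold_locales (auto simp: coth_radii_def ball_packing_def coth_gt_1)

lemma ball_packing_nonzero: "ball_packing r \<Longrightarrow> r $ a \<noteq> 0"
  by (metis ball_packing_def less_irrefl)

lemma continuous_on_coth_radii:
  assumes "continuous_on S f" "\<And>x. x \<in> S \<Longrightarrow> ball_packing (f x)"
  shows "continuous_on S (\<lambda>x. coth_radii (f x) a)"
  unfolding coth_radii_def using assms ball_packing_nonzero
  by (intro continuous_on_coth continuous_intros) auto

lemma open_ball_packing: "open {r :: real^'n::finite. ball_packing r}"
proof -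
  have "{r :: real^'n. ball_packing r} = (\<Inter>i. {r. 0 < r $ i})"
    by (auto simp: ball_packing_def)
  also have "open \<dots>"
    by (intro open_INT finite ballI open_Collect_less continuous_intros)
  finally show ?thesis .
qed

definition coth_radii_deriv :: "real^'n::finite \<Rightarrow> real^'n \<Rightarrow> 'n \<Rightarrow> real" where
  "coth_radii_deriv r v a = - ((coth_radii r a)\<^sup>2 - 1) * v $ a"

text \<open>For fixed \<open>v\<close>, the derivative along \<open>r + t *\<^sub>R v\<close> is the
  quadratic form of the Jacobian at \<open>v\<close>; monotonicity of the curvature becomes decrease
  of this scalar function.\<close>

definition angle_pairing :: "'n::finite set \<Rightarrow> real^'n \<Rightarrow> real^'n \<Rightarrow> real" where
  "angle_pairing s r v = (\<Sum>i\<in>s. v $ i * tetra_angle s (coth_radii r) i)"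

definition angle_pairing_deriv :: "'n::finite set \<Rightarrow> real^'n \<Rightarrow> real^'n \<Rightarrow> real" where
  "angle_pairing_deriv s r v = (\<Sum>i\<in>s. v $ i * tetra_angle_deriv s (coth_radii r) (coth_radii_deriv
      r v) i)"

lemma DERIV_angle_pairing:
  assumes "card s = 4" "ball_packing (r + t *\<^sub>R v)" "coth_Q s (coth_radii (r + t *\<^sub>R v)) > 0"
  shows "((\<lambda>t. angle_pairing s (r + t *\<^sub>R v) v) has_real_derivative angle_pairing_deriv s (r + t
      *\<^sub>R v) v) (at t)"
proof -
  have "((\<lambda>t. coth_radii (r + t *\<^sub>R v) a) has_real_derivative coth_radii_deriv (r + t *\<^sub>R v) v a)
      (at t)" for a
  proof -
    have "(r + t *\<^sub>R v) $ a \<noteq> 0"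
      using ball_packing_nonzero[OF assms(2)] .
    then show ?thesis
      unfolding coth_radii_def coth_radii_deriv_def
      by (intro DERIV_chain2[OF DERIV_coth]) (auto intro!: derivative_eq_intros)
  qed
  then show ?thesis
    unfolding angle_pairing_def angle_pairing_deriv_def
    by (intro DERIV_sum DERIV_cmult DERIV_tetra_angle coth_tetra_radii assms)
qed

lemma angle_pairing_deriv_neg:
  assumes "card s = 4" "ball_packing r" "coth_Q s (coth_radii r) > 0" "a \<in> s" "v $ a \<noteq> 0"
  shows "angle_pairing_deriv s r v < 0"
proof -
  interpret coth_tetra s "coth_radii r" by (rule coth_tetra_radii) fact+
  have "0 < (\<Sum>i\<in>s. tetra_angle_deriv s (coth_radii r) (coth_radii_deriv r v) i * coth_radii_deriv
      r v i / w i)"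
    using w_pos[OF assms(4)] assms by (intro tetra_angle_deriv_definite)
      (auto simp: coth_radii_deriv_def)
  also have "\<dots> = (\<Sum>i\<in>s. - (v $ i * tetra_angle_deriv s (coth_radii r) (coth_radii_deriv r v) i))"
  proof (rule sum.cong[OF refl])
    fix i assume "i \<in> s"
    then show "tetra_angle_deriv s (coth_radii r) (coth_radii_deriv r v) i * coth_radii_deriv r v
        i / w i = - (v $ i * tetra_angle_deriv s (coth_radii r) (coth_radii_deriv r v) i)"
      using w_pos[of i] by (simp add: coth_radii_deriv_def field_simps)
  qed
  also have "\<dots> = - angle_pairing_deriv s r v"
    by (simp add: angle_pairing_deriv_def sum_negf)
  finally show ?thesis by simp
qed

lemma angle_pairing_deriv_eq_0:
  assumes "\<And>a. a \<in> s \<Longrightarrow> v $ a = 0"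
  shows "angle_pairing_deriv s r v = 0"
  using assms by (simp add: angle_pairing_deriv_def)

lemma angle_pairing_deriv_scale: "angle_pairing_deriv s r (c *\<^sub>R v)
    = c\<^sup>2 * angle_pairing_deriv s r v"
proof -
  have d: "half_dihedral_deriv s y (\<lambda>a. c * d a) j = c * half_dihedral_deriv s y d j" for y d j
  proof -
    have "(\<Sum>a\<in>s. coth_excess s y a * (c * d a)) = c * (\<Sum>a\<in>s. coth_excess s y a * d a)"
      by (simp add: sum_distrib_left mult_ac)
    moreover have "coth_excess s (\<lambda>a. c * d a) j = c * coth_excess s d j"
      by (simp add: coth_excess_def sum_distrib_left right_diff_distrib)
    ultimately show ?thesis
      by (simp add: half_dihedral_deriv_def right_diff_distrib mult_ac)
  qed
  have "coth_radii_deriv r (c *\<^sub>R v) = (\<lambda>a. c * coth_radii_deriv r v a)"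
    by (simp add: coth_radii_deriv_def fun_eq_iff)
  then show ?thesis
    by (simp add: angle_pairing_deriv_def tetra_angle_deriv_def d sum_distrib_left
      power2_eq_square mult_ac)
qed

lemma continuous_on_angle_pairing:
  assumes "card s = 4" "continuous_on S f" "continuous_on S g" "\<And>x. x \<in> S \<Longrightarrow> ball_packing (f x)"
  shows "continuous_on S (\<lambda>x. angle_pairing s (f x) (g x))"
  unfolding angle_pairing_def
  by (intro continuous_intros continuous_on_tetra_angle continuous_on_coth_radii coth_tetra_radii
    assms)

lemma continuous_on_angle_pairing_deriv:
  assumes "card s = 4" "continuous_on S f" "continuous_on S g" "\<And>x. x \<in> S \<Longrightarrow> ball_packing (f x)"
    "\<And>x. x \<in> S \<Longrightarrow> coth_Q s (coth_radii (f x)) > 0"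
  shows "continuous_on S (\<lambda>x. angle_pairing_deriv s (f x) (g x))"
  unfolding angle_pairing_deriv_def coth_radii_deriv_def
  by (intro continuous_intros continuous_on_tetra_angle_deriv continuous_on_coth_radii
    coth_tetra_radii assms)

lemma ball_packing_segment:
  assumes "ball_packing r" "ball_packing (r + v)" "0 \<le> t" "t \<le> 1"
  shows "ball_packing (r + t *\<^sub>R v)"
  unfolding ball_packing_def
proof
  fix a
  have p: "r $ a > 0" "r $ a + v $ a > 0" using assms(1,2) by (auto simp: ball_packing_def)
  have "(r + t *\<^sub>R v) $ a = (1 - t) * r $ a + t * (r $ a + v $ a)" by (simp add: algebra_simps)
  also have "\<dots> > 0"
    using p assms(3,4) by (cases "t = 1") (auto intro!: add_pos_nonneg mult_pos_pos
      mult_nonneg_nonneg)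
  finally show "(r + t *\<^sub>R v) $ a > 0" .
qed

lemma angle_pairing_antimono:
  assumes s: "card s = 4" and bp: "ball_packing r" "ball_packing (r + v)" and t: "0 \<le> t" "t \<le> 1"
  shows "angle_pairing s (r + v) v \<le> angle_pairing s (r + t *\<^sub>R v) v"
proof (cases "\<exists>a\<in>s. v $ a \<noteq> 0")
  case False
  then show ?thesis by (simp add: angle_pairing_def)
next
  case True
  then obtain a where a: "a \<in> s" "v $ a \<noteq> 0" by blast
  have fin: "finite s" by simp
  \<comment> \<open>In a virtual tetrahedron the angle is \<open>2 * pi\<close> at one vertex and 0
    at the others, so the pairing has at most one value per vertex.\<close>
  define V where "V = (\<lambda>m. \<Sum>i\<in>s. v $ i * (if i = m then 2 * pi else 0)) ` s"
  have "angle_pairing s (r + 1 *\<^sub>R v) v \<le> angle_pairing s (r + t *\<^sub>R v) v"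
  proof (rule nonincreasing_off_finite[where V = V and g = "\<lambda>t. angle_pairing s (r + t *\<^sub>R v) v"])
    show "continuous_on {t..1} (\<lambda>t. angle_pairing s (r + t *\<^sub>R v) v)"
      using t by (intro continuous_on_angle_pairing s continuous_intros ball_packing_segment bp)
        auto
    fix u assume "u \<in> {t..1}"
    then have bpu: "ball_packing (r + u *\<^sub>R v)"
      using t bp by (auto intro!: ball_packing_segment)
    interpret coth_tetra s "coth_radii (r + u *\<^sub>R v)" by (rule coth_tetra_radii) fact+
    show "angle_pairing s (r + u *\<^sub>R v) v \<in> V \<or>
        (\<exists>D<0. ((\<lambda>t. angle_pairing s (r + t *\<^sub>R v) v) has_real_derivative D) (at u))"
    proof (cases "Q > 0")
      case True
      then show ?thesis
        using DERIV_angle_pairing[OF s bpu] angle_pairing_deriv_neg[OF s bpu _ a] by blast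
    next
      case False
      then have Q: "Q \<le> 0" by simp
      obtain m where m: "m \<in> s" "X m < 0" "\<And>j. j \<in> s \<Longrightarrow> j \<noteq> m \<Longrightarrow> X j > 0"
        using virtual_vertex[OF Q] by blast
      have "tetra_angle s (coth_radii (r + u *\<^sub>R v)) i = (if i = m then 2 * pi else 0)" if "i \<in> s"
          for i
        using tetra_angle_virtual[OF Q that] m(2) m(3)[OF that] by (cases "i = m") auto
      then show ?thesis
        using m(1) by (auto simp: angle_pairing_def V_def intro!: image_eqI[of _ _ m] sum.cong)
    qed
  qed (use t in \<open>auto simp: V_def\<close>)
  then show ?thesis by simp
qed

text \<open>On the part of the segment inside a ball around \<open>r\<close> the decrease is
  quadratic by compactness, and by \<open>angle_pairing_antimono\<close> the rest gives nothing
  back. The bound \<open>R\<close> enters because the angles are bounded, so the left side is at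
  most linear in \<open>norm v\<close>.\<close>

theorem angle_pairing_strict:
  fixes TT :: "'n::finite set set"
  assumes TT: "\<And>s. s \<in> TT \<Longrightarrow> card s = 4" "\<And>i. \<exists>s\<in>TT. i \<in> s"
    and r: "ball_packing r" "\<And>s. s \<in> TT \<Longrightarrow> coth_Q s (coth_radii r) > 0"
    and R: "R > 0"
  obtains c where "c > 0"
    "\<And>v. ball_packing (r + v) \<Longrightarrow> norm v \<le> R \<Longrightarrow>
       (\<Sum>s\<in>TT. angle_pairing s (r + v) v - angle_pairing s r v) \<le> - c * (norm v)\<^sup>2"
proof -
  have bpo: "open {r :: real^'n. ball_packing r}" by (rule open_ball_packing)
  have "open {p. ball_packing p \<and> coth_Q s (coth_radii p) > 0}" if "s \<in> TT" for s
  proof -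
    have "continuous_on {r. ball_packing r} (\<lambda>p. coth_Q s (coth_radii p))"
      by (intro continuous_on_coth_Q continuous_on_coth_radii continuous_intros) auto
    then have "open ({r. ball_packing r} \<inter> (\<lambda>p. coth_Q s (coth_radii p)) -` {0<..})"
      using bpo by (intro continuous_open_preimage) auto
    moreover have "{r. ball_packing r} \<inter> (\<lambda>p. coth_Q s (coth_radii p)) -` {0<..}
        = {p. ball_packing p \<and> coth_Q s (coth_radii p) > 0}"
      by auto
    ultimately show ?thesis by simp
  qed
  moreover define U where "U = {r. ball_packing r} \<inter> (\<Inter>s\<in>TT. {p. ball_packing p
      \<and> coth_Q s (coth_radii p) > 0})"
  ultimately have "open U"
    unfolding U_def using bpo by (intro open_Int open_INT) auto
  moreover have "r \<in> U"
    using r by (auto simp: U_def)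
  ultimately obtain e where e: "e > 0" "cball r e \<subseteq> U"
    by (meson open_contains_cball)
  have near: "ball_packing p" if "p \<in> cball r e" for p
    using subsetD[OF e(2) that] by (simp add: U_def)
  have nearQ: "coth_Q s (coth_radii p) > 0" if "p \<in> cball r e" "s \<in> TT" for p s
    using subsetD[OF e(2) that(1)] that(2) by (simp add: U_def)
  \<comment> \<open>Base points near \<open>r\<close> and unit directions form a compact set on
    which \<open>G\<close> is continuous and negative; its maximum gives the constant.\<close>
  define K where "K = cball r e \<times> sphere (0 :: real^'n) 1"
  define G where "G x = (\<Sum>s\<in>TT. angle_pairing_deriv s (fst x) (snd x))" for x ::
      "(real^'n) \<times> (real^'n)"
  have "compact K" unfolding K_def by (intro compact_Times) auto
  moreover have "continuous_on K G"
    unfolding G_def K_def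
  proof (intro continuous_on_sum continuous_on_angle_pairing_deriv continuous_on_fst
      continuous_on_snd continuous_on_id)
    fix s and x :: "(real^'n) \<times> (real^'n)" assume s: "s \<in> TT"
    show "card s = 4" using TT(1)[OF s] .
    assume "x \<in> cball r e \<times> sphere 0 1"
    then have x: "fst x \<in> cball r e" by auto
    show "ball_packing (fst x)" "coth_Q s (coth_radii (fst x)) > 0"
      using near[OF x] nearQ[OF x s] .
  qed
  moreover have "K \<noteq> {}"
  proof -
    have "(r, axis undefined 1) \<in> K" using e by (simp add: K_def)
    then show ?thesis by blast
  qed
  ultimately obtain x where x: "x \<in> K" "\<And>y. y \<in> K \<Longrightarrow> G y \<le> G x"
    using continuous_attains_sup by metis
  have Gneg: "G y < 0" if "y \<in> K" for y
  proof -
    have y: "fst y \<in> cball r e" "norm (snd y) = 1" using that by (auto simp: K_def)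
    have le: "angle_pairing_deriv s (fst y) (snd y) \<le> 0" if "s \<in> TT" for s
    proof (cases "\<exists>a\<in>s. snd y $ a \<noteq> 0")
      case True
      then obtain a where "a \<in> s" "snd y $ a \<noteq> 0" by blast
      then show ?thesis
        using angle_pairing_deriv_neg[OF TT(1)[OF that] near[OF y(1)] nearQ[OF y(1) that]] by force
    next
      case False
      then show ?thesis
        using angle_pairing_deriv_eq_0[of s "snd y"] by force
    qed
    have "snd y \<noteq> 0" using y by auto
    then obtain i where i: "snd y $ i \<noteq> 0" by (metis vec_eq_iff zero_index)
    obtain s where s: "s \<in> TT" "i \<in> s" using TT(2) by blast
    have "angle_pairing_deriv s (fst y) (snd y) < 0"
      by (rule angle_pairing_deriv_neg[OF TT(1)[OF s(1)] near[OF y(1)] nearQ[OF y(1) s(1)] s(2) i])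
    then have "(\<Sum>s\<in>TT. angle_pairing_deriv s (fst y) (snd y)) < (\<Sum>s\<in>TT. 0)"
      using le s(1) by (intro sum_strict_mono_ex1) auto
    then show ?thesis
      by (simp add: G_def)
  qed
  define c where "c = - G x"
  have c: "c > 0" using Gneg[OF x(1)] by (simp add: c_def)
  have Gc: "G (p, v) \<le> - c * (norm v)\<^sup>2" if "p \<in> cball r e" for p v
  proof (cases "v = 0")
    case True
    then show ?thesis by (simp add: G_def angle_pairing_deriv_eq_0)
  next
    case False
    then have n: "norm v \<noteq> 0" by simp
    then have "(p, (1 / norm v) *\<^sub>R v) \<in> K" using that by (simp add: K_def)
    then have "G (p, (1 / norm v) *\<^sub>R v) \<le> - c" using x(2) by (simp add: c_def)
    moreover have "G (p, norm v *\<^sub>R ((1 / norm v) *\<^sub>R v)) = (norm v)\<^sup>2 * G (p, (1 / norm v) *\<^sub>R v)"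
      unfolding G_def fst_conv snd_conv angle_pairing_deriv_scale sum_distrib_left ..
    moreover have "(norm v)\<^sup>2 * G (p, (1 / norm v) *\<^sub>R v) \<le> (norm v)\<^sup>2 * - c"
      using calculation(1) by (intro mult_left_mono) auto
    ultimately show ?thesis
      using n by (simp add: mult.commute)
  qed
  define g where "g v t = (\<Sum>s\<in>TT. angle_pairing s (r + t *\<^sub>R v) v)" for v t
  have local: "g v t - g v 0 \<le> - c * t * (norm v)\<^sup>2" if t: "0 < t" "t * norm v \<le> e" for v t
  proof -
    have in_ball: "r + u *\<^sub>R v \<in> cball r e" if "0 \<le> u" "u \<le> t" for u
    proof -
      have "u * norm v \<le> t * norm v" using that by (intro mult_right_mono) auto
      then show ?thesis using that t by (simp add: dist_norm)
    qed
    have "(g v has_real_derivative G (r + u *\<^sub>R v, v)) (at u)" if "0 \<le> u" "u \<le> t" for u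
      unfolding g_def G_def fst_conv snd_conv
      by (intro DERIV_sum DERIV_angle_pairing TT near nearQ in_ball that)
    then obtain u where u: "0 < u" "u < t" "g v t - g v 0 = (t - 0) * G (r + u *\<^sub>R v, v)"
      using MVT2[of 0 t "g v" "\<lambda>u. G (r + u *\<^sub>R v, v)"] t by auto
    have "t * G (r + u *\<^sub>R v, v) \<le> t * (- c * (norm v)\<^sup>2)"
      using u t by (intro mult_left_mono Gc in_ball) auto
    then show ?thesis using u(3) by (simp add: mult_ac)
  qed
  define c' where "c' = c * min 1 (e / R)"
  have "c' > 0" using c e R by (simp add: c'_def)
  moreover have "(\<Sum>s\<in>TT. angle_pairing s (r + v) v - angle_pairing s r v) \<le> - c' * (norm v)\<^sup>2"
    if v: "ball_packing (r + v)" "norm v \<le> R" for v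
  proof -
    \<comment> \<open>Up to this time the segment stays in the ball, uniformly for all
      \<open>v\<close> of norm at most \<open>R\<close>; the constant shrinks by the same
      factor.\<close>
    define t where "t = min 1 (e / R)"
    have t: "0 < t" "t \<le> 1" "t * R \<le> e"
      using e R by (auto simp: t_def min_def field_simps)
    have "t * norm v \<le> t * R" using v t by (intro mult_left_mono) auto
    then have "g v t - g v 0 \<le> - c * t * (norm v)\<^sup>2"
      using local[of t v] t by linarith
    moreover have "g v 1 \<le> g v t"
      unfolding g_def using angle_pairing_antimono[OF TT(1) r(1) v(1), of _ t] t by
        (auto intro!: sum_mono)
    ultimately have "g v 1 - g v 0 \<le> - c * t * (norm v)\<^sup>2" by linarith
    then show ?thesis
      by (simp add: g_def c'_def t_def sum_subtractf)
  qed
  ultimately show ?thesis using that by blast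
qed

section \<open>Hyperbolic tetrahedra\<close>

lemma lorentz_add_left: "lorentz (x + y) z = lorentz x z + lorentz y z"
  and lorentz_add_right: "lorentz z (x + y) = lorentz z x + lorentz z y"
  and lorentz_diff_left: "lorentz (x - y) z = lorentz x z - lorentz y z"
  and lorentz_diff_right: "lorentz z (x - y) = lorentz z x - lorentz z y"
  and lorentz_scale_left: "lorentz (c *\<^sub>R x) z = c * lorentz x z"
  and lorentz_scale_right: "lorentz z (c *\<^sub>R x) = c * lorentz z x"
  by (simp_all add: lorentz_def algebra_simps inner_add_left inner_add_right inner_diff_left
    inner_diff_right)

lemmas lorentz_bilinear = lorentz_add_left lorentz_add_right lorentz_diff_left lorentz_diff_right
  lorentz_scale_left lorentz_scale_right

lemma lorentz_commute: "lorentz x y = lorentz y x"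
  by (simp add: lorentz_def inner_commute mult.commute)

lemma hyp_space_D:
  assumes "p \<in> hyp_space" shows "lorentz p p = -1" "(fst p)\<^sup>2 = 1 + (norm (snd p))\<^sup>2" "fst p > 0"
  using assms by (auto simp: hyp_space_def lorentz_def dot_square_norm power2_eq_square)

lemma lorentz_hyp_le:
  assumes "p \<in> hyp_space" "q \<in> hyp_space" shows "- lorentz p q \<ge> 1"
proof -
  note p = hyp_space_D[OF assms(1)] and q = hyp_space_D[OF assms(2)]
  have "snd p \<bullet> snd q \<le> norm (snd p) * norm (snd q)"
    by (rule norm_cauchy_schwarz)
  moreover have "1 + norm (snd p) * norm (snd q) \<le> fst p * fst q"
  proof (rule power2_le_imp_le)
    have "(fst p * fst q)\<^sup>2 - (1 + norm (snd p) * norm (snd q))\<^sup>2 = (norm (snd p) - norm (snd q))\<^sup>2"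
      unfolding power_mult_distrib p q by (simp add: algebra_simps power2_eq_square)
    then show "(1 + norm (snd p) * norm (snd q))\<^sup>2 \<le> (fst p * fst q)\<^sup>2"
      by (metis diff_ge_0_iff_ge zero_le_power2)
  qed (use p q in auto)
  ultimately show ?thesis by (simp add: lorentz_def)
qed

lemma hyp_dist_eq_iff:
  assumes "p \<in> hyp_space" "q \<in> hyp_space" "l \<ge> 0"
  shows "hyp_dist p q = l \<longleftrightarrow> lorentz p q = - cosh l"
proof
  assume "hyp_dist p q = l"
  then have "cosh l = - lorentz p q"
    using lorentz_hyp_le[OF assms(1,2)] by (auto simp: hyp_dist_def)
  then show "lorentz p q = - cosh l" by simp
qed (use assms in \<open>simp add: hyp_dist_def arcosh_cosh_real\<close>)

lemma lorentz_tangent_pos: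
  assumes p: "p \<in> hyp_space" and x: "lorentz x p = 0" "x \<noteq> 0"
  shows "lorentz x x > 0"
proof -
  note p = hyp_space_D[OF p]
  have "fst x * fst p = snd x \<bullet> snd p" using x by (simp add: lorentz_def)
  then have "(fst x)\<^sup>2 * (fst p)\<^sup>2 = (snd x \<bullet> snd p)\<^sup>2" by (metis power_mult_distrib)
  also have "\<dots> \<le> (norm (snd x))\<^sup>2 * (norm (snd p))\<^sup>2"
    using Cauchy_Schwarz_ineq[of "snd x" "snd p"] by (simp add: power2_norm_eq_inner)
  finally have *: "(fst x)\<^sup>2 + (fst x)\<^sup>2 * (norm (snd p))\<^sup>2 \<le> (norm (snd x))\<^sup>2 * (norm (snd p))\<^sup>2"
    unfolding p by (simp add: algebra_simps)
  have "(fst x)\<^sup>2 < (norm (snd x))\<^sup>2"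
  proof (rule ccontr)
    assume "\<not> ?thesis"
    then have le: "(norm (snd x))\<^sup>2 \<le> (fst x)\<^sup>2" by simp
    then have "(norm (snd x))\<^sup>2 * (norm (snd p))\<^sup>2 \<le> (fst x)\<^sup>2 * (norm (snd p))\<^sup>2"
      by (rule mult_right_mono) simp
    then have "(fst x)\<^sup>2 \<le> 0" using * by linarith
    then have "fst x = 0" "snd x = 0" using le by auto
    then show False using x(2) by (simp add: prod_eq_iff)
  qed
  then show ?thesis by (simp add: lorentz_def dot_square_norm power2_eq_square)
qed

lemma lorentz_direction:
  assumes "lorentz p p = -1"
  shows "lorentz (hyp_direction p u) (hyp_direction p w) = lorentz u w + lorentz p u * lorentz p w"
    and "lorentz (hyp_direction p u) p = 0"
  unfolding hyp_direction_def lorentz_bilinear assms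
  by (simp_all add: lorentz_commute algebra_simps)

lemma lorentz_reject:
  assumes "lorentz a a \<noteq> 0"
  shows "lorentz (lorentz_reject a x) (lorentz_reject a z) = lorentz x z - lorentz x a * lorentz z
      a / lorentz a a"
  unfolding lorentz_reject_def lorentz_bilinear using assms
  by (simp add: lorentz_commute field_simps)

section \<open>Gram matrices in terms of the coth of the radii\<close>

lemma cosh_add_coth:
  assumes "a > 0" "b > 0"
  shows "cosh (a + b) = sinh a * sinh b * (coth a * coth b + 1)"
  using assms by (simp add: cosh_add coth_def field_simps)

lemma sinh_coth:
  assumes "a > 0"
  shows "(sinh a)\<^sup>2 * ((coth a)\<^sup>2 - 1) = 1"
proof -
  have "(cosh a)\<^sup>2 = 1 + (sinh a)\<^sup>2" by (simp add: cosh_square_eq)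
  then show ?thesis using assms by (simp add: coth_def field_simps)
qed

text \<open>Multiplying the first term by \<open>sa\<^sup>2 * (a\<^sup>2 - 1)\<close>, which is 1,
  gives both terms the same sinh factors; a polynomial identity in the coth remains.\<close>

lemma direction_identity:
  fixes a b c sa sb sc :: real
  assumes "sa\<^sup>2 * (a\<^sup>2 - 1) = 1"
  shows "- (sb * sc * (b * c + 1)) + (sa * sb * (a * b + 1)) * (sa * sc * (a * c + 1))
    = sb * sc * sa\<^sup>2 * ((a + b) * (a + c) - 2 * (a\<^sup>2 - 1))"
proof -
  have "sb * sc * (b * c + 1) = sb * sc * (b * c + 1) * (sa\<^sup>2 * (a\<^sup>2 - 1))"
    unfolding assms by simp
  then have "- (sb * sc * (b * c + 1)) + (sa * sb * (a * b + 1)) * (sa * sc * (a * c + 1))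
     = sb * sc * sa\<^sup>2 * ((a * b + 1) * (a * c + 1) - (b * c + 1) * (a\<^sup>2 - 1))"
    by (simp add: algebra_simps power2_eq_square)
  then show ?thesis
    by (simp add: algebra_simps power2_eq_square)
qed

lemma direction_identity_same:
  fixes a b sa sb :: real
  assumes "sa\<^sup>2 * (a\<^sup>2 - 1) = 1" "sb\<^sup>2 * (b\<^sup>2 - 1) = 1"
  shows "- 1 + (sa * sb * (a * b + 1))\<^sup>2 = sb\<^sup>2 * sa\<^sup>2 * (a + b)\<^sup>2"
proof -
  have "1 = (sa\<^sup>2 * (a\<^sup>2 - 1)) * (sb\<^sup>2 * (b\<^sup>2 - 1))" unfolding assms by simp
  then have "- 1 + (sa * sb * (a * b + 1))\<^sup>2 = sb\<^sup>2 * sa\<^sup>2 * ((a * b + 1)\<^sup>2 - (a\<^sup>2 - 1) * (b\<^sup>2 -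
      1))"
    by (simp add: algebra_simps power2_eq_square)
  then show ?thesis
    by (simp add: algebra_simps power2_eq_square)
qed

text \<open>With \<open>a\<close>, \<open>b\<close>, \<open>c\<close> the coth of the radii at \<open>p\<close>, \<open>q\<close>, \<open>u\<close>, the Lorentz product of the
  directions from \<open>p\<close> to \<open>q\<close> and to \<open>u\<close> is \<open>direction_form a b c\<close> up to sinh factors.\<close>

definition direction_form :: "real \<Rightarrow> real \<Rightarrow> real \<Rightarrow> real" where
  "direction_form a b c = (a + b) * (a + c) - 2 * (a\<^sup>2 - 1)"

lemma reject_identity_same:
  fixes a b c :: real
  assumes "a + b \<noteq> 0"
  shows "(a + c)\<^sup>2 - (direction_form a b c)\<^sup>2 / (a + b)\<^sup>2 = 4 * (a\<^sup>2 - 1) * (1 + a * b + b * c + c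
      * a) / (a + b)\<^sup>2"
proof -
  have "(a + c)\<^sup>2 * (a + b)\<^sup>2 - (direction_form a b c)\<^sup>2 = 4 * (a\<^sup>2 - 1) * (1 + a * b + b * c + c
      * a)"
    unfolding direction_form_def by (simp add: algebra_simps power2_eq_square)
  then show ?thesis using assms by (simp add: field_simps)
qed

text \<open>The product of two directions after removing their components along an edge; the factor
  \<open>a\<^sup>2 - 1\<close> will cancel the squared sinh at the vertex. This is how
  \<open>Q\<close> enters the geometry.\<close>

lemma reject_identity:
  fixes a b c d :: real
  assumes "a + b \<noteq> 0" "Q = (a + b + c + d)\<^sup>2 - 2 * (a\<^sup>2 + b\<^sup>2 + c\<^sup>2 + d\<^sup>2) + 4"
  shows "direction_form a c d - direction_form a b c * direction_form a b d / (a + b)\<^sup>2 =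
    (a\<^sup>2 - 1) * (Q - (a + b + d - c) * (a + b + c - d)) / (a + b)\<^sup>2"
proof -
  have "direction_form a c d * (a + b)\<^sup>2 - direction_form a b c * direction_form a b d =
     (a\<^sup>2 - 1) * (Q - (a + b + d - c) * (a + b + c - d))"
    unfolding direction_form_def assms(2) by (simp add: algebra_simps power2_eq_square)
  then show ?thesis using assms(1) by (simp add: field_simps)
qed

context coth_tetra
begin

lemma cos_sin_half_dihedral:
  assumes "Q > 0" "i \<in> s"
  shows "cos (half_dihedral s y i) = sqrt Q / (2 * sqrt (A i))" "sin (half_dihedral s y i)
      = X i / (2 * sqrt (A i))"
proof -
  have "2 * sqrt (A i) = sqrt (Q + (X i)\<^sup>2)"
    using four_face_form[of i] by (metis real_sqrt_four real_sqrt_mult)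
  also have "\<dots> = sqrt Q * sqrt (1 + (X i / sqrt Q)\<^sup>2)"
    using assms by (simp add: real_sqrt_mult[symmetric] power_divide field_simps)
  finally have *: "sqrt (1 + (X i / sqrt Q)\<^sup>2) = 2 * sqrt (A i) / sqrt Q"
    using assms by (simp add: field_simps)
  show "cos (half_dihedral s y i) = sqrt Q / (2 * sqrt (A i))"
    unfolding half_dihedral_real[OF assms] cos_arctan * by simp
  show "sin (half_dihedral s y i) = X i / (2 * sqrt (A i))"
    unfolding half_dihedral_real[OF assms] sin_arctan * using assms by simp
qed

lemma half_dihedral_bounds:
  assumes "Q > 0" "i \<in> s" shows "- (pi / 2) < half_dihedral s y i" "half_dihedral s y i < pi / 2"
  unfolding half_dihedral_real[OF assms] using arctan_lbound[of "X i / sqrt Q"] arctan_ubound[of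
    "X i / sqrt Q"] by simp_all

text \<open>The bounds let arccos invert the cosine. The lower one is
  \<open>coth_excess_pair_pos\<close>, as arctan is odd and increasing.\<close>

lemma half_dihedral_pair:
  assumes Q: "Q > 0" and ij: "i \<in> s" "j \<in> s" "i \<noteq> j"
  shows "0 < half_dihedral s y i + half_dihedral s y j" "half_dihedral s y i + half_dihedral s y j
      < pi"
    "arccos ((Q - X i * X j) / (4 * sqrt (A i) * sqrt (A j)))
        = half_dihedral s y i + half_dihedral s y j"
proof -
  have "- X j / sqrt Q < X i / sqrt Q"
    using coth_excess_pair_pos[OF ij] Q by (intro divide_strict_right_mono) auto
  then have "arctan (- (X j / sqrt Q)) < arctan (X i / sqrt Q)"
    by (simp add: arctan_less_iff)
  then show 0: "0 < half_dihedral s y i + half_dihedral s y j"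
    unfolding half_dihedral_real[OF Q ij(1)] half_dihedral_real[OF Q ij(2)] arctan_minus by linarith
  show 1: "half_dihedral s y i + half_dihedral s y j < pi"
    using half_dihedral_bounds[OF Q ij(1)] half_dihedral_bounds[OF Q ij(2)] by linarith
  have "cos (half_dihedral s y i + half_dihedral s y j) = (sqrt Q * sqrt Q - X i * X j) / (4 *
      sqrt (A i) * sqrt (A j))"
    unfolding cos_add cos_sin_half_dihedral[OF Q ij(1)] cos_sin_half_dihedral[OF Q ij(2)] by
      (simp add: diff_divide_distrib)
  also have "sqrt Q * sqrt Q = Q" using Q by simp
  finally show "arccos ((Q - X i * X j) / (4 * sqrt (A i) * sqrt (A j)))
      = half_dihedral s y i + half_dihedral s y j"
    using 0 1 arccos_cos[of "half_dihedral s y i + half_dihedral s y j"] by simp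
qed

text \<open>Up to a square factor, the Gram determinant of the two normals to an edge. It ties the
  sign of \<open>Q\<close> to non-degeneracy and supplies the height in the construction of a
  tetrahedron.\<close>

lemma face_form_gram: "(4 * A i) * (4 * A j) - (Q - X i * X j)\<^sup>2 = Q * (X i + X j)\<^sup>2"
  unfolding four_face_form by (simp add: algebra_simps power2_eq_square)

end

lemma realizes_tetra_lorentz:
  assumes "realizes_tetra r s v" "ball_packing r" "a \<in> s" "b \<in> s" "a \<noteq> b"
  shows "lorentz (v a) (v b) = - (sinh (r $ a) * sinh (r $ b) * (coth_radii r a * coth_radii r b +
      1))"
    and "lorentz (v a) (v a) = -1" "v a \<in> hyp_space"
proof -
  have pos: "r $ a > 0" "r $ b > 0" using assms(2) by (auto simp: ball_packing_def)
  have h: "v a \<in> hyp_space" "v b \<in> hyp_space" using assms by (auto simp: realizes_tetra_def)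
  have "hyp_dist (v a) (v b) = r $ a + r $ b" using assms by (simp add: realizes_tetra_def)
  then have "lorentz (v a) (v b) = - cosh (r $ a + r $ b)"
    using hyp_dist_eq_iff[OF h] pos by simp
  then show "lorentz (v a) (v b) = - (sinh (r $ a) * sinh (r $ b) * (coth_radii r a * coth_radii r
      b + 1))"
    using cosh_add_coth[OF pos] by (simp add: coth_radii_def)
  show "lorentz (v a) (v a) = -1" "v a \<in> hyp_space"
    using h hyp_space_D by auto
qed

lemma direction_form_commute: "direction_form a b c = direction_form a c b"
  by (simp add: direction_form_def mult.commute)

text \<open>The normal towards \<open>k\<close> involves \<open>face_form\<close> at
  \<open>l\<close> because it lies in the face opposite to \<open>l\<close>. The quotients of sinh
  by \<open>y i + y j\<close> cancel in the angle.\<close>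

lemma lorentz_reject_directions:
  assumes v: "realizes_tetra r s v" and r: "ball_packing r"
    and s: "s = {i, j, k, l}" "distinct [i, j, k, l]"
  defines "a \<equiv> hyp_direction (v i) (v j)"
  defines "x \<equiv> lorentz_reject a (hyp_direction (v i) (v k))"
    and "z \<equiv> lorentz_reject a (hyp_direction (v i) (v l))"
  defines "y \<equiv> coth_radii r"
  shows "lorentz x x = (sinh (r $ k) / (y i + y j))\<^sup>2 * (4 * face_form s y l)"
    and "lorentz z z = (sinh (r $ l) / (y i + y j))\<^sup>2 * (4 * face_form s y k)"
    and "lorentz x z = (sinh (r $ k) / (y i + y j)) * (sinh (r $ l) / (y i + y j)) *
      (coth_Q s y - coth_excess s y k * coth_excess s y l)"
    and "lorentz a a \<noteq> 0"
proof -
  have card: "card s = 4" using s by simp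
  interpret coth_tetra s y unfolding y_def by (rule coth_tetra_radii) fact+
  have mem: "i \<in> s" "j \<in> s" "k \<in> s" "l \<in> s" using s by auto
  have ne: "i \<noteq> j" "i \<noteq> k" "i \<noteq> l" "j \<noteq> k" "j \<noteq> l" "k \<noteq> l" using s(2) by auto
  let ?s = "\<lambda>b. sinh (r $ b)"
  have unit: "(?s b)\<^sup>2 * ((y b)\<^sup>2 - 1) = 1" for b
    using sinh_coth[of "r $ b"] r by (simp add: y_def coth_radii_def ball_packing_def)
  have spos: "?s b > 0" for b using r by (simp add: ball_packing_def)
  note vii = realizes_tetra_lorentz(2)[OF v r mem(1,2) ne(1)]
  have L: "lorentz (v b) (v c) = - (?s b * ?s c * (y b * y c + 1))" if "b \<in> s" "c \<in> s" "b \<noteq> c"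
      for b c
    using realizes_tetra_lorentz(1)[OF v r that] by (simp add: y_def)
  have L1: "lorentz (v b) (v b) = - 1" if "b \<in> s" for b
    using realizes_tetra_lorentz(2)[OF v r that] mem ne by metis
  have D: "lorentz (hyp_direction (v i) (v b)) (hyp_direction (v i) (v c))
      = ?s b * ?s c * (?s i)\<^sup>2 * direction_form (y i) (y b) (y c)"
    if "b \<in> s" "c \<in> s" "b \<noteq> c" "i \<noteq> b" "i \<noteq> c" for b c
    unfolding lorentz_direction(1)[OF vii] L[OF that(1,2,3)] L[OF mem(1) that(1) that(4)] L[OF
      mem(1) that(2) that(5)]
    unfolding minus_mult_minus direction_form_def by (rule direction_identity[OF unit])
  have D1: "lorentz (hyp_direction (v i) (v b)) (hyp_direction (v i) (v b))
      = (?s b)\<^sup>2 * (?s i)\<^sup>2 * (y i + y b)\<^sup>2"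
    if "b \<in> s" "i \<noteq> b" for b
    unfolding lorentz_direction(1)[OF vii] L1[OF that(1)] L[OF mem(1) that]
    using direction_identity_same[OF unit[of i] unit[of b]] unfolding minus_mult_minus
      power2_eq_square .
  have yij: "y i + y j > 0" using y_pos mem by (simp add: add_pos_pos)
  have aa: "lorentz a a = (?s j)\<^sup>2 * (?s i)\<^sup>2 * (y i + y j)\<^sup>2"
    unfolding a_def by (rule D1[OF mem(2) ne(1)])
  then show aa0: "lorentz a a \<noteq> 0" using spos yij by (simp add: less_imp_neq[symmetric])
  have si0: "?s b \<noteq> 0" for b using spos[of b] by simp
  have quot: "(?s b * ?s j * (?s i)\<^sup>2 * g) * (?s c * ?s j * (?s i)\<^sup>2 * g') / lorentz a a
      = ?s b * ?s c * (?s i)\<^sup>2 * (g * g' / (y i + y j)\<^sup>2)" for b c g g'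
  proof -
    have gen: "(p * sj * si\<^sup>2 * g) * (q * sj * si\<^sup>2 * g') / (sj\<^sup>2 * si\<^sup>2 * F\<^sup>2)
        = p * q * si\<^sup>2 * (g * g' / F\<^sup>2)"
      if "sj \<noteq> 0" "si \<noteq> 0" "F \<noteq> 0" for p q sj si F :: real
      using that by (simp add: field_simps power2_eq_square)
    show ?thesis
      unfolding aa by (rule gen) (use si0[of i] si0[of j] yij in auto)
  qed
  have wi: "(?s i)\<^sup>2 * (w i * t / (y i + y j)\<^sup>2) = t / (y i + y j)\<^sup>2" for t
  proof -
    have "(?s i)\<^sup>2 * (w i * t / (y i + y j)\<^sup>2) = ((?s i)\<^sup>2 * w i) * (t / (y i + y j)\<^sup>2)"
      by (simp only: mult.assoc times_divide_eq_right)
    then show ?thesis unfolding unit mult_1 .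
  qed
  note xv = coth_excess_explicit[OF s(2), folded s(1)] and fa
      = face_form_explicit[OF s(2), folded s(1)]
  have yij0: "y i + y j \<noteq> 0" using yij by simp
  have gen: "S\<^sup>2 * I\<^sup>2 * (4 * W * E / F\<^sup>2) = (S / F)\<^sup>2 * (4 * E)" if "I\<^sup>2 * W = 1"
      for S I W E F :: real
  proof -
    have "S\<^sup>2 * I\<^sup>2 * (4 * W * E / F\<^sup>2) = S\<^sup>2 * (I\<^sup>2 * W) * (4 * E / F\<^sup>2)"
      by simp
    then show ?thesis unfolding that by (simp add: power_divide)
  qed
  have same: "lorentz (lorentz_reject a (hyp_direction (v i) (v b))) (lorentz_reject a
      (hyp_direction (v i) (v b)))
     = (?s b / (y i + y j))\<^sup>2 * (4 * (1 + y i * y j + y j * y b + y b * y i))"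
    if b: "b \<in> s" "b \<noteq> i" "b \<noteq> j" for b
  proof -
    have "lorentz (lorentz_reject a (hyp_direction (v i) (v b))) (lorentz_reject a (hyp_direction
        (v i) (v b)))
      = (?s b)\<^sup>2 * (?s i)\<^sup>2 * ((y i + y b)\<^sup>2 - (direction_form (y i) (y j) (y b))\<^sup>2 / (y i + y
          j)\<^sup>2)"
      using b unfolding lorentz_reject[OF aa0] unfolding a_def D1[OF b(1) b(2)[symmetric]] D[OF
        b(1) mem(2) b(3) b(2)[symmetric] ne(1)]
      unfolding a_def[symmetric] quot direction_form_commute[of "y i" "y b"] by
        (simp only: power2_eq_square right_diff_distrib)
    also have "\<dots> = (?s b / (y i + y j))\<^sup>2 * (4 * (1 + y i * y j + y j * y b + y b * y i))"
      unfolding reject_identity_same[OF yij0] by (rule gen[OF unit])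
    finally show ?thesis .
  qed
  show "lorentz x x = (?s k / (y i + y j))\<^sup>2 * (4 * face_form s y l)"
    unfolding x_def fa by (rule same[OF mem(3) ne(2)[symmetric] ne(4)[symmetric]])
  show "lorentz z z = (?s l / (y i + y j))\<^sup>2 * (4 * face_form s y k)"
    unfolding z_def fa by (rule same[OF mem(4) ne(3)[symmetric] ne(5)[symmetric]])
  have "lorentz x z = ?s k * ?s l * (?s i)\<^sup>2 * (direction_form (y i) (y k) (y l) - direction_form
      (y i) (y k) (y j) * direction_form (y i) (y l) (y j) / (y i + y j)\<^sup>2)"
    unfolding x_def z_def lorentz_reject[OF aa0] unfolding a_def
    unfolding D[OF mem(3,4) ne(6,2,3)] D[OF mem(3,2) ne(4)[symmetric] ne(2,1)] D[OF mem(4,2)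
      ne(5)[symmetric] ne(3,1)]
    unfolding a_def[symmetric] quot right_diff_distrib ..
  also have "direction_form (y i) (y k) (y j) = direction_form (y i) (y j) (y k)"
    by (rule direction_form_commute)
  also have "direction_form (y i) (y l) (y j) = direction_form (y i) (y j) (y l)"
    by (rule direction_form_commute)
  also note reject_identity[OF yij0 coth_Q_explicit[OF s(2), folded s(1)], folded xv]
  also have "?s k * ?s l * (?s i)\<^sup>2 * (w i * (Q - X k * X l) / (y i + y j)\<^sup>2) =
     ?s k * ?s l * ((?s i)\<^sup>2 * (w i * (Q - X k * X l) / (y i + y j)\<^sup>2))"
    by (rule mult.assoc)
  finally show "lorentz x z = (?s k / (y i + y j)) * (?s l / (y i + y j)) * (Q - X k * X l)"
    unfolding wi by (simp add: power2_eq_square)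
qed

lemma dihedral_angle_eq:
  assumes v: "realizes_tetra r s v" and r: "ball_packing r" and Q: "coth_Q s (coth_radii r) > 0"
    and s: "s = {i, j, k, l}" "distinct [i, j, k, l]"
  shows "dihedral_angle (v i) (v j) (v k) (v l) = half_dihedral s (coth_radii r) k + half_dihedral
      s (coth_radii r) l"
proof -
  have card: "card s = 4" using s by simp
  interpret coth_tetra s "coth_radii r" by (rule coth_tetra_radii) fact+
  have mem: "i \<in> s" "j \<in> s" "k \<in> s" "l \<in> s" using s by auto
  have "k \<noteq> l" using s(2) by auto
  have pos: "sinh (r $ b) / (coth_radii r i + coth_radii r j) > 0" for b
    using y_pos[OF mem(1)] y_pos[OF mem(2)] r by (simp add: ball_packing_def)
  have A: "sqrt (A b) > 0" if "b \<in> s" for b using face_form_gt_1[OF that] by simp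
  have sq: "sqrt (t\<^sup>2 * (4 * f)) = t * (2 * sqrt f)" if "t > 0" for t f
    using that by (simp add: real_sqrt_mult)
  have cancel: "p * q * N / (p * (2 * f) * (q * (2 * g))) = N / (4 * g * f)"
    if "p \<noteq> 0" "q \<noteq> 0" "f \<noteq> 0" "g \<noteq> 0" for p q N f g :: real
    using that by (simp add: field_simps)
  have "dihedral_angle (v i) (v j) (v k) (v l) = arccos ((Q - X k * X l) / (4 * sqrt (A k) * sqrt
      (A l)))"
    unfolding dihedral_angle_def Let_def lorentz_angle_def lorentz_reject_directions[OF v r s]
      sq[OF pos]
    by (intro arg_cong[where f = arccos] cancel less_imp_neq[OF pos, symmetric]
        less_imp_neq[OF A, symmetric] mem)
  then show ?thesis
    unfolding half_dihedral_pair(3)[OF Q mem(3,4) \<open>k \<noteq> l\<close>] .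
qed

lemma hyp_solid_angle_eq:
  assumes v: "realizes_tetra r s v" and r: "ball_packing r" and Q: "coth_Q s (coth_radii r) > 0"
    and s: "s = {i, j, k, l}" "distinct [i, j, k, l]"
  shows "hyp_solid_angle (v i) (v j) (v k) (v l) = tetra_angle s (coth_radii r) i"
proof -
  have s': "s = {i, k, j, l}" "distinct [i, k, j, l]" "s = {i, l, j, k}" "distinct [i, l, j, k]"
    using s by auto
  have "s - {i} = {j, k, l}" using s by auto
  then have "(\<Sum>a\<in>s - {i}. half_dihedral s (coth_radii r) a) = half_dihedral s (coth_radii r) j +
      half_dihedral s (coth_radii r) k + half_dihedral s (coth_radii r) l"
    using s(2) by simp
  then show ?thesis
    unfolding hyp_solid_angle_def tetra_angle_def dihedral_angle_eq[OF v r Q s]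
      dihedral_angle_eq[OF v r Q s'(1,2)] dihedral_angle_eq[OF v r Q s'(3,4)] by simp
qed

text \<open>The two normals to an edge are independent because the vertices span, and the Lorentz
  form is definite on the tangent space, so their Gram determinant is positive. By
  \<open>face_form_gram\<close> it is a square times \<open>Q\<close>.\<close>

lemma coth_Q_pos_of_realizes:
  assumes v: "realizes_tetra r s v" and r: "ball_packing r" and card: "card s = 4"
  shows "coth_Q s (coth_radii r) > 0"
proof -
  interpret coth_tetra s "coth_radii r" by (rule coth_tetra_radii) fact+
  obtain i where "i \<in> s" using card by fastforce
  then obtain j k l where s: "s = {i, j, k, l}" "distinct [i, j, k, l]"
    using card_4E[OF card] by metis
  have mem: "i \<in> s" "j \<in> s" "k \<in> s" "l \<in> s" using s by auto
  define a where "a = hyp_direction (v i) (v j)"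
  define x where "x = lorentz_reject a (hyp_direction (v i) (v k))"
  define z where "z = lorentz_reject a (hyp_direction (v i) (v l))"
  define m where "m = sinh (r $ k) / (coth_radii r i + coth_radii r j)"
  define n where "n = sinh (r $ l) / (coth_radii r i + coth_radii r j)"
  note L = lorentz_reject_directions[OF v r s, folded a_def, folded x_def z_def m_def n_def]
  have hi: "v i \<in> hyp_space"
    using v mem by (auto simp: realizes_tetra_def)
  note vi = hi hyp_space_D(1)[OF hi]
  have mn: "m > 0" "n > 0"
    using y_pos[OF mem(1)] y_pos[OF mem(2)] r by (simp_all add: m_def n_def ball_packing_def)
  have A: "A k > 0" "A l > 0" using face_form_gt_1 mem by force+
  have tang: "lorentz x (v i) = 0" "lorentz z (v i) = 0"
    unfolding x_def z_def lorentz_reject_def a_def lorentz_bilinear lorentz_direction(2)[OF vi(2)]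
      by simp_all
  define b where "b = lorentz z z"
  define g where "g = lorentz x z"
  have b: "b > 0" unfolding b_def L using mn A by simp
  \<comment> \<open>Dependent normals would put \<open>v k\<close> into the span of the other three
    vertices, but the ambient space has dimension four.\<close>
  have nz: "b *\<^sub>R x - g *\<^sub>R z \<noteq> 0"
  proof
    assume eq: "b *\<^sub>R x - g *\<^sub>R z = 0"
    obtain c1 c2 c3 c4 where x: "x = v k + c1 *\<^sub>R v i + c2 *\<^sub>R v j" and z: "z
        = v l + c3 *\<^sub>R v i + c4 *\<^sub>R v j"
    proof
      let ?cx = "lorentz (hyp_direction (v i) (v k)) a / lorentz a a"
      let ?cz = "lorentz (hyp_direction (v i) (v l)) a / lorentz a a"
      show "x = v k + (lorentz (v i) (v k) - ?cx * lorentz (v i) (v j)) *\<^sub>R v i + (- ?cx) *\<^sub>R v j"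
        unfolding x_def lorentz_reject_def hyp_direction_def[of _ "v k"]
        by (simp add: a_def hyp_direction_def algebra_simps)
      show "z = v l + (lorentz (v i) (v l) - ?cz * lorentz (v i) (v j)) *\<^sub>R v i + (- ?cz) *\<^sub>R v j"
        unfolding z_def lorentz_reject_def hyp_direction_def[of _ "v l"]
        by (simp add: a_def hyp_direction_def algebra_simps)
    qed
    have "b *\<^sub>R x = g *\<^sub>R z" using eq by simp
    then have "(1 / b) *\<^sub>R (b *\<^sub>R x) = (g / b) *\<^sub>R z" by simp
    then have "x = (g / b) *\<^sub>R z" using b by simp
    then have "v k = (g / b) *\<^sub>R z - c1 *\<^sub>R v i - c2 *\<^sub>R v j"
      using x by (simp add: algebra_simps)
    also have "\<dots> \<in> span {v i, v j, v l}"
      unfolding z by (intro span_diff span_scale span_add span_base) auto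
    finally have k: "v k \<in> span {v i, v j, v l}" .
    have "v ` s \<subseteq> span {v i, v j, v l}"
      using k unfolding s(1) by (auto intro: span_base)
    then have "span (v ` s) \<subseteq> span {v i, v j, v l}"
      by (rule span_minimal) simp
    then have "UNIV \<subseteq> span {v i, v j, v l}"
      using v by (simp add: realizes_tetra_def)
    then have "dim (UNIV :: (real \<times> (real^3)) set) \<le> card {v i, v j, v l}"
      using real_vector.dim_le_card[of UNIV "{v i, v j, v l}"] by simp
    moreover have "card {v i, v j, v l} \<le> 3"
      using card_insert_le_m1[of 3 "{v j, v l}" "v i"] card_insert_le_m1[of 2 "{v l}" "v j"] by simp
    ultimately show False by (simp add: dim_UNIV)
  qed
  have "0 < lorentz (b *\<^sub>R x - g *\<^sub>R z) (b *\<^sub>R x - g *\<^sub>R z)"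
    by (rule lorentz_tangent_pos[OF vi(1) _ nz]) (simp add: lorentz_bilinear tang)
  also have "\<dots> = b * (b * lorentz x x - g\<^sup>2)"
    unfolding lorentz_bilinear by (simp add: b_def g_def lorentz_commute[of z x] algebra_simps
      power2_eq_square)
  finally have "b * lorentz x x - g\<^sup>2 > 0"
    using b by (simp add: zero_less_mult_iff)
  also have "b * lorentz x x - g\<^sup>2 = m\<^sup>2 * n\<^sup>2 * ((4 * A k) * (4 * A l) - (Q - X k * X l)\<^sup>2)"
    unfolding b_def g_def L by (simp add: algebra_simps power2_eq_square)
  also have "\<dots> = m\<^sup>2 * n\<^sup>2 * (X k + X l)\<^sup>2 * Q"
    unfolding face_form_gram by simp
  finally show ?thesis
    by (metis mult_nonneg_nonpos not_less zero_le_mult_iff zero_le_power2)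
qed

text \<open>Vertex \<open>i\<close> is put at the apex of the hyperboloid. The Gram matrix of the
  directions to the other vertices is then prescribed by \<open>direction_form\<close>, and
  \<open>Q > 0\<close> allows a real triangular factor with nonzero diagonal.\<close>

lemma realizes_tetra_exists:
  fixes r :: "real^'n::finite"
  assumes r: "ball_packing r" and card: "card s = 4" and Q: "coth_Q s (coth_radii r) > 0"
  shows "\<exists>v. realizes_tetra r s v"
proof -
  interpret coth_tetra s "coth_radii r" by (rule coth_tetra_radii) fact+
  obtain i where "i \<in> s" using card by fastforce
  then obtain j k l where s: "s = {i, j, k, l}" "distinct [i, j, k, l]"
    using card_4E[OF card] by metis
  have mem: "i \<in> s" "j \<in> s" "k \<in> s" "l \<in> s" using s by auto
  have ne: "i \<noteq> j" "i \<noteq> k" "i \<noteq> l" "j \<noteq> k" "j \<noteq> l" "k \<noteq> l" using s(2) by auto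
  let ?s = "\<lambda>b. sinh (r $ b)" and ?y = "coth_radii r"
  have rpos: "r $ b > 0" for b using r by (simp add: ball_packing_def)
  have spos: "?s b > 0" for b using rpos by simp
  have unit: "(?s b)\<^sup>2 * ((?y b)\<^sup>2 - 1) = 1" for b
    using sinh_coth[OF rpos] by (simp add: coth_radii_def)
  have ch: "cosh (r $ b + r $ c) = ?s b * ?s c * (?y b * ?y c + 1)" for b c
    using cosh_add_coth[OF rpos rpos] by (simp add: coth_radii_def)
  note xv = coth_excess_explicit[OF s(2), folded s(1)] and fa
      = face_form_explicit[OF s(2), folded s(1)]
  define F where "F = ?y i + ?y j"
  have F: "F > 0" using y_pos[OF mem(1)] y_pos[OF mem(2)] by (simp add: F_def)
  define al where "al = sqrt (A l)"
  have al: "al > 0" "al\<^sup>2 = A l" using face_form_gt_1[OF mem(4)] by (simp_all add: al_def)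
  have w: "w i > 0" using w_pos[OF mem(1)] .
  define om where "om = sqrt (w i)"
  have om: "om > 0" "om\<^sup>2 = w i" using w by (simp_all add: om_def)
  \<comment> \<open>Entries of this Cholesky factor: direction \<open>j\<close> lies on the first
    axis, \<open>k\<close> in the first coordinate plane, and \<open>zl\<close> is the height of
    \<open>l\<close> over that plane.\<close>
  define gk where "gk = direction_form (?y i) (?y j) (?y k) / F"
  define gl where "gl = direction_form (?y i) (?y j) (?y l) / F"
  define hk where "hk = 2 * om * al / F"
  define hl where "hl = om * (Q - X k * X l) / (2 * F * al)"
  define zl where "zl = om * sqrt Q * (X k + X l) / (2 * F * al)"
  have Q4: "Q = (?y i + ?y j + ?y k + ?y l)\<^sup>2 - 2 * ((?y i)\<^sup>2 + (?y j)\<^sup>2 + (?y k)\<^sup>2 + (?y l)\<^sup>2) + 4"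
    by (rule coth_Q_explicit[OF s(2), folded s(1)])
  have gram_kk: "gk\<^sup>2 + hk\<^sup>2 = (?y i + ?y k)\<^sup>2"
  proof -
    have "hk\<^sup>2 = 4 * w i * A l / F\<^sup>2"
      unfolding hk_def by (simp add: power_divide power_mult_distrib om al)
    then show ?thesis
      using reject_identity_same[of "?y i" "?y j" "?y k", folded F_def] F
      unfolding fa gk_def by (simp add: power_divide)
  qed
  have gram_kl: "gk * gl + hk * hl = direction_form (?y i) (?y k) (?y l)"
  proof -
    have "hk * hl = om\<^sup>2 * (Q - X k * X l) / F\<^sup>2"
      unfolding hk_def hl_def using al F by (simp add: field_simps power2_eq_square)
    moreover have "gk * gl = direction_form (?y i) (?y j) (?y k) * direction_form (?y i) (?y j)
        (?y l) / F\<^sup>2"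
      unfolding gk_def gl_def by (simp add: power2_eq_square)
    ultimately show ?thesis
      using reject_identity[OF _ Q4, folded xv F_def] F unfolding om by simp
  qed
  have gram_ll: "gl\<^sup>2 + hl\<^sup>2 + zl\<^sup>2 = (?y i + ?y l)\<^sup>2"
  proof -
    have "hl\<^sup>2 + zl\<^sup>2 = om\<^sup>2 * ((Q - X k * X l)\<^sup>2 + (sqrt Q)\<^sup>2 * (X k + X l)\<^sup>2) / (4 * F\<^sup>2 * al\<^sup>2)"
    proof -
      have "hl\<^sup>2 = om\<^sup>2 * (Q - X k * X l)\<^sup>2 / (4 * F\<^sup>2 * al\<^sup>2)"
        "zl\<^sup>2 = om\<^sup>2 * ((sqrt Q)\<^sup>2 * (X k + X l)\<^sup>2) / (4 * F\<^sup>2 * al\<^sup>2)"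
        unfolding hl_def zl_def power_divide power_mult_distrib by simp_all
      then show ?thesis
        by (simp only: distrib_left add_divide_distrib)
    qed
    also have "(Q - X k * X l)\<^sup>2 + (sqrt Q)\<^sup>2 * (X k + X l)\<^sup>2 = (4 * A k) * (4 * A l)"
      using face_form_gram[of k l] Q by simp
    also have "om\<^sup>2 * (4 * A k * (4 * A l)) / (4 * F\<^sup>2 * al\<^sup>2) = 4 * w i * A k / F\<^sup>2"
    proof -
      have "p * (4 * q * (4 * m)) / (4 * f * m) = 4 * p * q / f" if "m \<noteq> 0" for p q m f :: real
        using that by simp
      then show ?thesis
        unfolding om al(2) using face_form_gt_1[OF mem(4)] by simp
    qed
    finally show ?thesis
      using reject_identity_same[of "?y i" "?y j" "?y l", folded F_def] F
      unfolding fa gl_def by (simp add: power_divide)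
  qed
  \<comment> \<open>\<open>T b * (?y i + ?y b)\<close> is \<open>sinh (r $ i + r $ b)\<close>, the
    Euclidean norm that the hyperboloid requires.\<close>
  define T where "T b = ?s b * ?s i" for b
  have T: "T b > 0" for b using spos by (simp add: T_def)
  define U :: "'n \<Rightarrow> real^3" where
    "U b = (if b = j then vector [F, 0, 0] else if b = k then vector [gk, hk, 0] else vector [gl,
        hl, zl])" for b
  define v :: "'n \<Rightarrow> real \<times> (real^3)" where
    "v b = (if b = i then (1, 0) else (cosh (r $ i + r $ b), T b *\<^sub>R U b))" for b
  have gF: "gk * F = direction_form (?y i) (?y j) (?y k)" "gl * F
      = direction_form (?y i) (?y j) (?y l)"
    using F by (simp_all add: gk_def gl_def)
  have U: "U j \<bullet> U j = (?y i + ?y j)\<^sup>2" "U k \<bullet> U k = (?y i + ?y k)\<^sup>2" "U l \<bullet> U l = (?y i + ?y l)\<^sup>2"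
    "U j \<bullet> U k = direction_form (?y i) (?y j) (?y k)" "U j \<bullet> U l
        = direction_form (?y i) (?y j) (?y l)"
    "U k \<bullet> U l = direction_form (?y i) (?y k) (?y l)"
    using ne gram_kk gram_kl gram_ll gF
    by (simp_all add: U_def inner_vec_def sum_3 vector_3 F_def[symmetric] power2_eq_square
      mult.commute)
  have diag: "lorentz (v b) (v b) = -1" if "U b \<bullet> U b = (?y i + ?y b)\<^sup>2" "b \<noteq> i" for b
  proof -
    have "lorentz (v b) (v b) = (?s b)\<^sup>2 * (?s i)\<^sup>2 * (U b \<bullet> U b) - (cosh (r $ i + r $ b))\<^sup>2"
      using that(2) by (simp add: v_def lorentz_def T_def power2_eq_square)
    then show ?thesis
      unfolding that(1) ch using direction_identity_same[OF unit[of i] unit[of b]] by simp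
  qed
  have off: "lorentz (v b) (v c) = - cosh (r $ b + r $ c)"
    if "U b \<bullet> U c = direction_form (?y i) (?y b) (?y c)" "b \<noteq> i" "c \<noteq> i" for b c
  proof -
    have "lorentz (v b) (v c) = ?s b * ?s c * (?s i)\<^sup>2 * (U b \<bullet> U c) - cosh (r $ i + r $ b) * cosh
        (r $ i + r $ c)"
      using that(2,3) by (simp add: v_def lorentz_def T_def power2_eq_square)
    then show ?thesis
      unfolding that(1) ch direction_form_def using direction_identity[OF unit[of i], of "?s b"
        "?s c" "?y b" "?y c"] by simp
  qed
  have offi: "lorentz (v i) (v b) = - cosh (r $ i + r $ b)" if "b \<noteq> i" for b
    using that by (simp add: v_def lorentz_def)
  have ip: "lorentz (v i) (v i) = -1" by (simp add: v_def lorentz_def)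
  have hyp: "v b \<in> hyp_space" if "b \<in> s" for b
  proof -
    have "lorentz (v b) (v b) = -1"
      using that ip diag U ne unfolding s(1) by auto
    moreover have "fst (v b) > 0" by (simp add: v_def)
    ultimately show ?thesis by (simp add: hyp_space_def)
  qed
  have off_all: "lorentz (v b) (v c) = - cosh (r $ b + r $ c)" if "b \<in> s" "c \<in> s" "b \<noteq> c" for b c
  proof -
    define L where "L b c \<longleftrightarrow> lorentz (v b) (v c) = - cosh (r $ b + r $ c)" for b c
    have "L j k" "L j l" "L k l"
      unfolding L_def using ne by (auto intro!: off U)
    moreover have "L i j" "L i k" "L i l"
      unfolding L_def using ne by (auto intro!: offi)
    moreover have "L c b" if "L b c" for b c
      using that unfolding L_def by (simp add: lorentz_commute add.commute)
    ultimately have "L b c"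
      using that unfolding s(1) by blast
    then show ?thesis unfolding L_def .
  qed
  have "realizes_tetra r s v"
    unfolding realizes_tetra_def
  proof (intro conjI ballI impI)
    show "v ` s \<subseteq> hyp_space" using hyp by auto
    show "hyp_dist (v b) (v c) = r $ b + r $ c" if "b \<in> s" "c \<in> s" "b \<noteq> c" for b c
      using hyp_dist_eq_iff[OF hyp hyp] off_all that rpos[of b] rpos[of c] by simp
    let ?S = "span (v ` s)"
    have base: "v b \<in> ?S" if "b \<in> s" for b using that by (intro span_base) auto
    have e0: "(1, 0) \<in> ?S" using base[OF mem(1)] by (simp add: v_def)
    have UinS: "(0, U b) \<in> ?S" if "b \<in> s" "b \<noteq> i" for b
    proof -
      have "(0, U b) = (1 / T b) *\<^sub>R (v b - cosh (r $ i + r $ b) *\<^sub>R (1, 0))"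
        using T[of b] that(2) by (simp add: v_def)
      also have "\<dots> \<in> ?S"
        by (intro span_scale span_diff base e0 that)
      finally show ?thesis .
    qed
    have Xkl: "zl > 0" "hk > 0"
      using coth_excess_pair_pos[OF mem(3,4) ne(6)] om al F Q by (simp_all add: zl_def hk_def)
    have ax: "(0, vector [1, 0, 0] :: real^3) \<in> ?S" 
    proof -
      have "(0, vector [1, 0, 0] :: real^3) = (1 / F) *\<^sub>R (0, U j)"
        using F by (simp add: U_def vec_eq_iff forall_3 vector_3)
      then show ?thesis using UinS[OF mem(2)] ne by (metis span_scale)
    qed
    have ay: "(0, vector [0, 1, 0] :: real^3) \<in> ?S" 
    proof -
      have "(0, vector [0, 1, 0] :: real^3) = (1 / hk) *\<^sub>R ((0, U k) - gk *\<^sub>R (0, vector [1, 0,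
          0]))"
        using Xkl ne by (simp add: U_def vec_eq_iff forall_3 vector_3)
      then show ?thesis using UinS[OF mem(3)] ne ax by (metis span_scale span_diff)
    qed
    have az: "(0, vector [0, 0, 1] :: real^3) \<in> ?S" 
    proof -
      have "(0, vector [0, 0, 1] :: real^3) =
          (1 / zl) *\<^sub>R ((0, U l) - gl *\<^sub>R (0, vector [1, 0, 0]) - hl *\<^sub>R (0, vector [0, 1, 0]))"
        using Xkl ne by (simp add: U_def vec_eq_iff forall_3 vector_3)
      then show ?thesis using UinS[OF mem(4)] ne ax ay by (metis span_scale span_diff)
    qed
    have "(t, q) \<in> ?S" for t and q :: "real^3"
    proof -
      have "(t, q) = t *\<^sub>R (1, 0) + (q $ 1) *\<^sub>R (0, vector [1, 0, 0]) + (q $ 2) *\<^sub>R (0, vector [0,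
          1, 0])
         + (q $ 3) *\<^sub>R (0, vector [0, 0, 1])"
        by (simp add: vec_eq_iff forall_3 vector_3)
      also have "\<dots> \<in> ?S"
        by (intro span_add span_scale e0 ax ay az)
      finally show ?thesis .
    qed
    then show "?S = UNIV" by auto
  qed
  then show ?thesis by blast
qed

section \<open>Identification of the extended solid angle\<close>

lemma solid_angle_eq:
  assumes r: "ball_packing r" and card: "card s = 4" and Q: "coth_Q s (coth_radii r) > 0" and i:
      "i \<in> s"
  shows "solid_angle r s i = tetra_angle s (coth_radii r) i"
  unfolding solid_angle_def
proof (rule the_equality)
  obtain v where v: "realizes_tetra r s v"
    using realizes_tetra_exists[OF r card Q] by blast
  obtain j k l where s: "s = {i, j, k, l}" "distinct [i, j, k, l]"
    using card_4E[OF card i] .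
  show "\<exists>v j k l. realizes_tetra r s v \<and> s = {i, j, k, l} \<and> distinct [i, j, k, l] \<and>
      tetra_angle s (coth_radii r) i = hyp_solid_angle (v i) (v j) (v k) (v l)"
    using v s hyp_solid_angle_eq[OF v r Q s] by metis
  show "\<alpha> = tetra_angle s (coth_radii r) i"
    if "\<exists>v j k l. realizes_tetra r s v \<and> s = {i, j, k, l} \<and> distinct [i, j, k, l] \<and>
      \<alpha> = hyp_solid_angle (v i) (v j) (v k) (v l)" for \<alpha>
    using that hyp_solid_angle_eq[OF _ r Q] by blast
qed

lemma tetra_Q_eq_coth_Q: "tetra_Q r s = coth_Q s (coth_radii r)"
  by (simp add: tetra_Q_def coth_Q_def coth_radii_def)

lemma real_tetra_imp_Q_pos:
  assumes "real_tetra r s" "ball_packing r" "card s = 4"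
  shows "coth_Q s (coth_radii r) > 0"
  using assms coth_Q_pos_of_realizes by (auto simp: real_tetra_def)

text \<open>Membership in \<open>D_i\<close> reads \<open>X i \<le> - (2 * sqrt (A i))\<close>.
  Where \<open>Q \<le> 0\<close>, the modulus of \<open>X i\<close> is at least
  \<open>2 * sqrt (A i)\<close>, so only the sign counts.\<close>

lemma virtual_at_iff:
  assumes r: "ball_packing r" and card: "card s = 4" and Q: "coth_Q s (coth_radii r) \<le> 0" and i:
      "i \<in> s"
  shows "virtual_at r s i \<longleftrightarrow> coth_excess s (coth_radii r) i < 0"
proof -
  interpret coth_tetra s "coth_radii r" by (rule coth_tetra_radii) fact+
  obtain j k l where s: "s = {i, j, k, l}" "distinct [i, j, k, l]"
    using card_4E[OF card i] .
  have d: "s - {i} = {j, k, l}" using s by auto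
  have "{e. e \<subseteq> {j, k, l} \<and> card e = 2} = {{j, k}, {k, l}, {l, j}}"
  proof (intro equalityI subsetI)
    fix e assume "e \<in> {e. e \<subseteq> {j, k, l} \<and> card e = 2}"
    then obtain a b where "e = {a, b}" "a \<noteq> b" "a \<in> {j, k, l}" "b \<in> {j, k, l}"
      by (auto simp: card_2_iff)
    then show "e \<in> {{j, k}, {k, l}, {l, j}}" by auto
  qed (use s(2) in auto)
  moreover have "{j, k} \<noteq> {k, l}" "{j, k} \<noteq> {l, j}" "{k, l} \<noteq> {l, j}"
    using s(2) by (auto simp: doubleton_eq_iff)
  ultimately have 1: "(\<Sum>e | e \<subseteq> s - {i} \<and> card e = 2. \<Prod>b\<in>e. coth (r $ b)) + 1 = A i"
    unfolding d face_form_explicit[OF s(2), folded s(1)] using s(2) not_sym[of j l] by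
      (simp add: coth_radii_def)
  have 2: "(\<Sum>b\<in>s - {i}. coth (r $ b)) - coth (r $ i) = X i"
    unfolding d coth_excess_explicit[OF s(2), folded s(1)] using s(2) by (simp add: coth_radii_def)
  have eq: "virtual_at r s i \<longleftrightarrow> X i \<le> - (2 * sqrt (A i))"
    unfolding virtual_at_def 1 using 2 by linarith
  have A: "A i > 1" using face_form_gt_1[OF i] .
  show ?thesis
  proof
    assume "virtual_at r s i"
    then show "X i < 0" using eq A real_sqrt_gt_zero[of "A i"] by linarith
  next
    assume neg: "X i < 0"
    have "4 * A i \<le> (- X i)\<^sup>2" using four_face_form[of i] Q by simp
    then have "sqrt (4 * A i) \<le> - X i" using neg by (intro real_le_lsqrt) auto
    then show "virtual_at r s i" using eq by (simp add: real_sqrt_mult)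
  qed
qed

theorem ext_solid_angle_eq:
  assumes r: "ball_packing r" and card: "card s = 4" and i: "i \<in> s"
  shows "ext_solid_angle r s i = tetra_angle s (coth_radii r) i"
proof -
  interpret coth_tetra s "coth_radii r" by (rule coth_tetra_radii) fact+
  show ?thesis
    unfolding ext_solid_angle_def tetra_Q_eq_coth_Q
    using solid_angle_eq[OF r card _ i] virtual_at_iff[OF r card _ i] tetra_angle_virtual[OF _ i]
      by auto
qed

section \<open>Bounds for the extended angles\<close>

lemma arctan_ge_cubic:
  assumes "0 \<le> x" shows "x - x ^ 3 / 3 \<le> arctan x"
proof -
  have "arctan 0 - (0 - 0 ^ 3 / 3) \<le> arctan x - (x - x ^ 3 / 3)"
  proof (rule DERIV_nonneg_imp_nondecreasing[OF assms])
    fix u :: real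
    have "((\<lambda>x. arctan x - (x - x ^ 3 / 3)) has_real_derivative inverse (1 + u\<^sup>2) - (1 - u\<^sup>2))
        (at u)"
      by (auto intro!: derivative_eq_intros)
    moreover have "(1 - u\<^sup>2) * (1 + u\<^sup>2) = 1 - (u\<^sup>2)\<^sup>2"
      by (simp add: algebra_simps power2_eq_square)
    then have "(1 - u\<^sup>2) * (1 + u\<^sup>2) \<le> 1"
      by simp
    then have "1 - u\<^sup>2 \<le> inverse (1 + u\<^sup>2)"
      by (simp add: inverse_eq_divide pos_le_divide_eq add_pos_nonneg)
    ultimately show "\<exists>y. ((\<lambda>x. arctan x - (x - x ^ 3 / 3)) has_real_derivative y) (at u) \<and> 0 \<le> y"
      by (intro exI[of _ "inverse (1 + u\<^sup>2) - (1 - u\<^sup>2)"]) auto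
  qed
  then show ?thesis by simp
qed

lemma arctan_le_quintic:
  assumes "0 \<le> x" shows "arctan x \<le> x - x ^ 3 / 3 + x ^ 5 / 5"
proof -
  have "(0 - 0 ^ 3 / 3 + 0 ^ 5 / 5) - arctan 0 \<le> (x - x ^ 3 / 3 + x ^ 5 / 5) - arctan x"
  proof (rule DERIV_nonneg_imp_nondecreasing[OF assms])
    fix u :: real
    have "((\<lambda>x. (x - x ^ 3 / 3 + x ^ 5 / 5) - arctan x) has_real_derivative
        (1 - u\<^sup>2 + u ^ 4) - inverse (1 + u\<^sup>2)) (at u)"
      by (auto intro!: derivative_eq_intros)
    moreover have "(1 - u\<^sup>2 + u ^ 4) * (1 + u\<^sup>2) = 1 + u ^ 6"
      by (simp add: algebra_simps power2_eq_square power_numeral_reduce)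
    then have "(1 - u\<^sup>2 + u ^ 4) * (1 + u\<^sup>2) \<ge> 1"
      by simp
    then have "inverse (1 + u\<^sup>2) \<le> 1 - u\<^sup>2 + u ^ 4"
      by (simp only: inverse_eq_divide pos_divide_le_eq add_pos_nonneg zero_less_one zero_le_power2)
    ultimately show "\<exists>y. ((\<lambda>x. (x - x ^ 3 / 3 + x ^ 5 / 5) - arctan x) has_real_derivative y)
        (at u) \<and> 0 \<le> y"
      by (intro exI[of _ "(1 - u\<^sup>2 + u ^ 4) - inverse (1 + u\<^sup>2)"]) auto
  qed
  then show ?thesis by simp
qed

text \<open>Machin's formula with truncated series bounds pi from above. The two sides are about
  0.2732 and 0.2749, and the cubic bound 0.2745 for the right one suffices.\<close>

lemma two_pi_23_less: "2 * pi / 23 < arctan (282 / 1000)"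
proof -
  have "arctan (1 / 5) \<le> (1/5) - (1/5) ^ 3 / 3 + (1/5) ^ 5 / (5::real)"
    by (rule arctan_le_quintic) simp
  moreover have "(1 / 239) - (1 / 239) ^ 3 / 3 \<le> arctan (1 / (239::real))"
    by (rule arctan_ge_cubic) simp
  moreover have "(282 / 1000) - (282 / 1000) ^ 3 / 3 \<le> arctan (282 / (1000::real))"
    by (rule arctan_ge_cubic) simp
  ultimately show ?thesis
    using machin by (simp add: power_numeral_reduce)
qed

text \<open>Schur's inequality of degree one in elementary symmetric functions; it serves to bound
  \<open>a * b * c\<close> from below.\<close>

lemma schur_inequality:
  fixes a b c :: real
  assumes "a \<ge> 0" "b \<ge> 0" "c \<ge> 0"
  shows "(a + b + c) ^ 3 + 9 * (a * b * c) \<ge> 4 * (a + b + c) * (a * b + b * c + c * a)"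
proof -
  have *: "z * (z - x) * (z - y) + y * (y - x) * (y - z) + x * (x - y) * (x - z) \<ge> 0"
    if "x \<ge> y" "y \<ge> z" "z \<ge> 0" for x y z :: real
  proof -
    have "z * ((x - z) * (y - z)) \<ge> 0" using that by (intro mult_nonneg_nonneg) auto
    moreover have "(x - y) * ((x - y) * (x + y - z)) \<ge> 0" using that
        by (intro mult_nonneg_nonneg) auto
    ultimately show ?thesis by (simp add: algebra_simps)
  qed
  have "a * (a - b) * (a - c) + b * (b - a) * (b - c) + c * (c - a) * (c - b) \<ge> 0"
    using *[of a b c] *[of a c b] *[of b a c] *[of b c a] *[of c a b] *[of c b a] assms
    by (cases "a \<ge> b"; cases "b \<ge> c"; cases "a \<ge> c") (auto simp: algebra_simps)
  then show ?thesis
    by (simp add: algebra_simps power3_eq_cube)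
qed

text \<open>Applied to \<open>tan (\<phi> j)\<close>, \<open>tan (\<phi> k)\<close>, \<open>tan (\<phi> l)\<close>, this bounds \<open>tan (\<alpha> / 2)\<close> for the solid
  angle \<open>\<alpha>\<close> from below. The sharp constant for regular Euclidean tetrahedra is
  \<open>sqrt 2 / 5 = 0.2828\<dots>\<close>, with \<open>1 / 9\<close> in place of \<open>111 / 1000\<close>.\<close>

lemma angle_sum_inequality:
  fixes a b c :: real
  assumes abc: "a \<ge> 0" "b \<ge> 0" "c \<ge> 0"
    and e: "a * b + b * c + c * a - 1 \<ge> 111 / 1000 * (a + b + c)\<^sup>2"
  shows "a * b + b * c + c * a - 1 \<ge> 282 / 1000 * ((a + b + c) - a * b * c)"
proof -
  define T where "T = a + b + c"
  define e2 where "e2 = a * b + b * c + c * a"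
  define e3 where "e3 = a * b * c"
  have T: "T \<ge> 0" and e3: "e3 \<ge> 0" using abc by (auto simp: T_def e3_def)
  have e: "e2 - 1 \<ge> 111 / 1000 * T\<^sup>2" using assms by (simp add: T_def e2_def)
  have sch: "T ^ 3 + 9 * e3 \<ge> 4 * T * e2"
    using schur_inequality[OF abc] by (simp add: T_def e2_def e3_def)
  have "T\<^sup>2 - 3 * e2 = ((a - b)\<^sup>2 + (b - c)\<^sup>2 + (c - a)\<^sup>2) / 2"
    by (simp add: T_def e2_def field_simps power2_eq_square)
  then have e2: "3 * e2 \<le> T\<^sup>2"
    by (smt (verit) zero_le_power2 divide_nonneg_nonneg)
  show ?thesis
  proof (cases "T \<ge> 3")
    case True
    \<comment> \<open>Here the hypothesis suffices, since
      \<open>111 / 1000 * T\<^sup>2 \<ge> 333 / 1000 * T\<close>.\<close>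
    then have "T * 3 \<le> T * T" by (intro mult_left_mono) auto
    then have "282 / 1000 * (T - e3) \<le> e2 - 1"
      using e e3 T by (simp add: power2_eq_square)
    then show ?thesis by (simp add: T_def e2_def e3_def)
  next
    case False
    \<comment> \<open>\<open>e2\<close> lies between \<open>1 + 111 / 1000 * T\<^sup>2\<close> and
      \<open>T\<^sup>2 / 3\<close>, which forces \<open>T \<ge> 212 / 100\<close>. Between this
      value and 3, the square is bounded by the chord
      \<open>512 / 100 * T - 636 / 100\<close>.\<close>
    have T2: "T\<^sup>2 \<ge> (212 / 100)\<^sup>2"
      using e e2 by (simp add: power2_eq_square)
    then have T212: "T \<ge> 212 / 100"
      using T by (rule power2_le_imp_le)
    have "(T - 212 / 100) * (3 - T) \<ge> 0"
      using T212 False by simp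
    then have "T * T \<le> 512 / 100 * T - 636 / 100"
      by (simp add: field_simps)
    \<comment> \<open>\<open>999 / 1000\<close> is \<open>9 * 111 / 1000\<close> and
      \<open>556 / 1000\<close> is \<open>1 - 4 * 111 / 1000\<close>: both arise from replacing
      \<open>e2 - 1\<close> by its lower bound.\<close>
    moreover have "999 / 1000 * T \<ge> 282 / 1000 * (5 + 556 / 1000 * u)" if "u
        \<le> 512 / 100 * T - 636 / 100" for u
      using that T212 by (simp add: field_simps)
    ultimately have "999 / 1000 * T \<ge> 282 / 1000 * (5 + 556 / 1000 * (T * T))"
      by blast
    then have "T * (999 / 1000 * T) \<ge> T * (282 / 1000 * (5 + 556 / 1000 * (T * T)))"
      using T by (intro mult_left_mono) auto
    moreover have "(9 + 4 * (282 / 1000) * T) * (e2 - 1) \<ge> (9 + 4 * (282 / 1000) * T) * (111 /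
        1000 * T\<^sup>2)"
      using e T by (intro mult_left_mono) auto
    moreover have "9 * e \<ge> 282 / 1000 * (T * (5 + T * T) - 4 * (T * e))"
      if "T * (999 / 1000 * T) \<ge> T * (282 / 1000 * (5 + 556 / 1000 * (T * T)))"
        "(9 + 4 * (282 / 1000) * T) * e \<ge> (9 + 4 * (282 / 1000) * T) * (111 / 1000 * T\<^sup>2)" for e
      using that by (simp add: field_simps power2_eq_square)
    ultimately have "9 * (e2 - 1) \<ge> 282 / 1000 * (T * (5 + T * T) - 4 * (T * (e2 - 1)))"
      by blast
    moreover have "T * (5 + T * T) - 4 * (T * (e2 - 1)) = 9 * T + T ^ 3 - 4 * T * e2"
      by (simp add: algebra_simps power3_eq_cube)
    ultimately have "9 * (e2 - 1) \<ge> 282 / 1000 * (9 * T + T ^ 3 - 4 * T * e2)"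
      by simp
    moreover have "282 / 1000 * (9 * T + T ^ 3 - 4 * T * e2) \<ge> 282 / 1000 * (9 * (T - e3))"
      using sch by (intro mult_left_mono) auto
    ultimately have "282 / 1000 * (T - e3) \<le> e2 - 1"
      by simp
    then show ?thesis by (simp add: T_def e2_def e3_def)
  qed
qed

lemma sin_add3: "sin (a + b + c) = sin a * cos b * cos c + cos a * sin b * cos c + cos a * cos b *
    sin c
    - sin a * sin b * sin (c::real)"
  and cos_add3: "cos (a + b + c) = cos a * cos b * cos c - cos a * sin b * sin c - sin a * cos b *
      sin c
    - sin a * sin b * cos (c::real)"
  by (simp_all add: sin_add cos_add algebra_simps)

section \<open>Angles at vertices of large and of minimal radius\<close>

context coth_tetra
begin

text \<open>Addition formulas for three half dihedral angles, shifted by \<open>pi / 2\<close>;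
  \<open>4 * w i\<close> appears when \<open>Q\<close> is expressed by the excesses. The range from
  \<open>- pi / 2\<close> to \<open>pi\<close> is short enough for sine and cosine to locate the
  angle.\<close>

lemma half_tetra_angle:
  assumes Q: "Q > 0" and s: "s = {i, j, k, l}" "distinct [i, j, k, l]"
  defines "D \<equiv> 8 * (sqrt (A j) * sqrt (A k) * sqrt (A l))"
  shows "tetra_angle s y i / 2 = half_dihedral s y j + half_dihedral s y k + half_dihedral s y l -
      pi / 2"
    and "sin (tetra_angle s y i / 2) = 4 * w i * sqrt Q / D"
    and "cos (tetra_angle s y i / 2) = (Q * (X j + X k + X l) - X j * X k * X l) / D"
    and "D > 0" and "- (pi / 2) < tetra_angle s y i / 2" and "tetra_angle s y i / 2 < pi"
    and "Q = X j * X k + X k * X l + X l * X j - 4 * w i"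
    and "sin (tetra_angle s y i / 2) \<le> w i"
proof -
  have mem: "i \<in> s" "j \<in> s" "k \<in> s" "l \<in> s" using s by auto
  have ne: "j \<noteq> k" "j \<noteq> l" "k \<noteq> l" using s(2) by auto
  have "s - {i} = {j, k, l}" using s by auto
  then have sum: "(\<Sum>a\<in>s - {i}. half_dihedral s y a) = half_dihedral s y j + half_dihedral s y k +
      half_dihedral s y l"
    using s(2) by simp
  show half: "tetra_angle s y i / 2 = half_dihedral s y j + half_dihedral s y k + half_dihedral s
      y l - pi / 2"
    unfolding tetra_angle_def sum by simp
  note xv = coth_excess_explicit[OF s(2), folded s(1)]
  show QE: "Q = X j * X k + X k * X l + X l * X j - 4 * w i"
    unfolding xv coth_Q_explicit[OF s(2), folded s(1)] by (simp add: algebra_simps power2_eq_square)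
  have A: "sqrt (A j) > 1" "sqrt (A k) > 1" "sqrt (A l) > 1" using face_form_gt_1 mem by auto
  then show D: "D > 0" by (simp add: D_def)
  have qq: "sqrt Q * sqrt Q = Q" using Q by simp
  have gen: "p / (2 * f) * (q / (2 * g)) * (r / (2 * h)) = p * q * r / (8 * (f * g * h))"
      for p q r f g h :: real
    by simp
  have "sin (tetra_angle s y i / 2) = - cos (half_dihedral s y j + half_dihedral s y k +
      half_dihedral s y l)"
    unfolding half by (simp add: sin_diff)
  also have "\<dots> = - ((sqrt Q * sqrt Q * sqrt Q - sqrt Q * X k * X l - X j * sqrt Q * X l - X j * X
      k * sqrt Q) / D)"
    unfolding cos_add3 cos_sin_half_dihedral[OF Q mem(2)] cos_sin_half_dihedral[OF Q mem(3)]
      cos_sin_half_dihedral[OF Q mem(4)] gen D_def[symmetric]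
    by (simp only: diff_divide_distrib)
  also note minus_divide_left
  also have "- (sqrt Q * sqrt Q * sqrt Q - sqrt Q * X k * X l - X j * sqrt Q * X l - X j * X k *
      sqrt Q)
     = sqrt Q * (X j * X k + X k * X l + X l * X j - sqrt Q * sqrt Q)"
    by (simp add: algebra_simps)
  also have "\<dots> = 4 * w i * sqrt Q"
    unfolding qq using QE by (metis add_diff_cancel_left' diff_add_cancel diff_diff_eq2
      mult.commute)
  finally show sin: "sin (tetra_angle s y i / 2) = 4 * w i * sqrt Q / D" .
  have "cos (tetra_angle s y i / 2) = sin (half_dihedral s y j + half_dihedral s y k +
      half_dihedral s y l)"
    unfolding half by (simp add: cos_diff)
  also have "\<dots> = (X j * sqrt Q * sqrt Q + sqrt Q * X k * sqrt Q + sqrt Q * sqrt Q * X l - X j * X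
      k * X l) / D"
    unfolding sin_add3 cos_sin_half_dihedral[OF Q mem(2)] cos_sin_half_dihedral[OF Q mem(3)]
      cos_sin_half_dihedral[OF Q mem(4)] gen D_def[symmetric]
    by (simp only: diff_divide_distrib add_divide_distrib)
  also have "X j * sqrt Q * sqrt Q + sqrt Q * X k * sqrt Q + sqrt Q * sqrt Q * X l
     = (sqrt Q * sqrt Q) * (X j + X k + X l)"
    by (simp only: distrib_left mult_ac)
  finally show "cos (tetra_angle s y i / 2) = (Q * (X j + X k + X l) - X j * X k * X l) / D"
    unfolding qq .
  show "- (pi / 2) < tetra_angle s y i / 2"
    unfolding half using half_dihedral_pair(1)[OF Q mem(2,3) ne(1)] half_dihedral_pair(1)[OF Q
      mem(2,4) ne(2)]
      half_dihedral_pair(1)[OF Q mem(3,4) ne(3)] by linarith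
  show "tetra_angle s y i / 2 < pi"
    unfolding half using half_dihedral_bounds[OF Q mem(2)] half_dihedral_bounds[OF Q mem(3)]
      half_dihedral_bounds[OF Q mem(4)] by linarith
  \<comment> \<open>One factor of \<open>D\<close> absorbs \<open>sqrt Q\<close>; the other two
    roots exceed 1.\<close>
  have "sqrt Q \<le> sqrt (4 * A j)"
    using four_face_form[of j] by (intro real_sqrt_le_mono) auto
  then have "sqrt Q \<le> 2 * sqrt (A j)" by (simp add: real_sqrt_mult)
  also have "\<dots> \<le> 2 * sqrt (A j) * (sqrt (A k) * sqrt (A l))"
    using A mult_mono[of 1 "sqrt (A k)" 1 "sqrt (A l)"] by simp
  finally have "4 * sqrt Q \<le> D" by (simp add: D_def)
  then have "w i * (4 * sqrt Q) \<le> w i * D"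
    using w_pos[OF mem(1)] by (intro mult_left_mono) auto
  then show "sin (tetra_angle s y i / 2) \<le> w i"
    unfolding sin using D by (simp add: field_simps)
qed

text \<open>A large radius means small \<open>w i\<close>, which bounds the sine of half the angle.
  Positivity of the cosine is needed too, to exclude half angles close to \<open>pi\<close>.\<close>

lemma tetra_angle_le_of_large_radius:
  assumes i: "i \<in> s" and e: "0 < e" "e < pi" and w: "w i \<le> sin (e / 2)"
  shows "tetra_angle s y i \<le> e"
proof -
  have w1: "w i \<le> 1" using w sin_le_one[of "e / 2"] by linarith
  then have "(y i)\<^sup>2 < 3\<^sup>2" by simp
  then have y3: "y i < 3" by (rule power_less_imp_less_base) simp
  obtain j k l where s: "s = {i, j, k, l}" "distinct [i, j, k, l]"
    using card_4E[OF card_s i] .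
  have ys: "y i > 1" "y j > 1" "y k > 1" "y l > 1" using y_gt_1 s(1) by auto
  note xv = coth_excess_explicit[OF s(2), folded s(1)]
  show ?thesis
  proof (cases "Q > 0")
    case False
    \<comment> \<open>\<open>y i < 3\<close>, while the other three values sum to more than 3: the
      virtual vertex is not \<open>i\<close>.\<close>
    have "X i > 0" unfolding xv using ys y3 by simp
    then show ?thesis using tetra_angle_virtual[OF _ i] False e by simp
  next
    case Q: True
    note h = half_tetra_angle[OF Q s]
    have "Q * (X j + X k + X l) - X j * X k * X l
       = (X j + X k) * (X k + X l) * (X j + X l) - 4 * w i * (X j + X k + X l)"
      unfolding h(7) by (simp add: algebra_simps)
    also have "\<dots> = 8 * ((y i + y l) * (y i + y j) * (y i + y k)) - 4 * w i * (3 * y i + y j + y k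
        + y l)"
      unfolding xv by (simp add: algebra_simps)
    also have "\<dots> > 0"
    proof -
      have *: "8 * (a * b * c) > 4 * (a + b + c)" if "a > 2" "b > 2" "c > 2" for a b c :: real
      proof -
        have "b * c \<ge> 2 * 2" "a * c \<ge> 2 * 2" "a * b \<ge> 2 * 2"
          using that by (intro mult_mono; simp)+
        then have "a * (b * c) \<ge> a * (2 * 2)" "b * (a * c) \<ge> b * (2 * 2)" "c * (a * b)
            \<ge> c * (2 * 2)"
          using that by (intro mult_left_mono; simp)+
        then have "4 * a \<le> a * b * c" "4 * b \<le> a * b * c" "4 * c \<le> a * b * c"
          by (simp_all add: mult_ac)
        moreover have "4 * (a + b + c) < 8 * p" if "4 * a \<le> p" "4 * b \<le> p" "4 * c \<le> p" for p
          using that \<open>a > 2\<close> \<open>b > 2\<close> \<open>c > 2\<close> by simp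
        ultimately show ?thesis by blast
      qed
      have "4 * w i * (3 * y i + y j + y k + y l) \<le> 4 * 1 * (3 * y i + y j + y k + y l)"
        using w1 ys by (intro mult_right_mono) auto
      then show ?thesis
        using *[of "y i + y l" "y i + y j" "y i + y k"] ys by simp
    qed
    finally have c: "cos (tetra_angle s y i / 2) > 0"
      unfolding h(3) using h(4) by simp
    have lt: "tetra_angle s y i / 2 < pi / 2"
    proof (rule ccontr)
      assume "\<not> tetra_angle s y i / 2 < pi / 2"
      then have "cos (tetra_angle s y i / 2) \<le> cos (pi / 2)"
        using h(6) by (intro cos_monotone_0_pi_le) auto
      then show False using c by simp
    qed
    show ?thesis
    proof (rule ccontr)
      assume "\<not> tetra_angle s y i \<le> e"
      then have "sin (e / 2) < sin (tetra_angle s y i / 2)"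
        using lt e by (intro sin_monotone_2pi) auto
      then show False using w h(8) by linarith
    qed
  qed
qed

lemma tetra_angle_gt_of_min_radius:
  assumes i: "i \<in> s" and max: "\<And>a. a \<in> s \<Longrightarrow> y a \<le> y i" and large: "(y i)\<^sup>2 \<ge> 1000"
  shows "tetra_angle s y i > 4 * pi / 23"
proof (cases "Q > 0")
  case False
  then have "X i < 0" using coth_excess_neg_if_max[of i] i max by auto
  then have "tetra_angle s y i = 2 * pi" using tetra_angle_virtual[OF _ i] False by simp
  then show ?thesis using pi_gt_zero by simp
next
  case Q: True
  obtain j k l where s: "s = {i, j, k, l}" "distinct [i, j, k, l]"
    using card_4E[OF card_s i] .
  have mem: "j \<in> s" "k \<in> s" "l \<in> s" and ne: "j \<noteq> i" "k \<noteq> i" "l \<noteq> i" using s by auto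
  note h = half_tetra_angle[OF Q s] and xv = coth_excess_explicit[OF s(2), folded s(1)]
  define q where "q = sqrt Q"
  have q: "q > 0" "q\<^sup>2 = Q" using Q by (simp_all add: q_def)
  have Xpos: "X j > 0" "X k > 0" "X l > 0"
    using coth_excess_pos_of_max[OF i max] mem ne by auto
  have le: "y j \<le> y i" "y k \<le> y i" "y l \<le> y i" using max mem by auto
  have "X j + X k + X l \<le> 6 * y i" unfolding xv using le by simp
  then have "(X j + X k + X l)\<^sup>2 \<le> (6 * y i)\<^sup>2" using Xpos by (intro power_mono) auto
  \<comment> \<open>\<open>4 * w i / (6 * y i)\<^sup>2\<close> is
    \<open>(1 - 1 / (y i)\<^sup>2) / 9\<close>, and \<open>(y i)\<^sup>2 \<ge> 1000\<close> makes
    this at least \<open>111 / 1000\<close>.\<close>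
  then have e: "4 * w i \<ge> 111 / 1000 * (X j + X k + X l)\<^sup>2"
    using large by (simp add: power_mult_distrib)
  define a b c where "a = X j / q" and "b = X k / q" and "c = X l / q"
  have e2: "a * b + b * c + c * a - 1 = 4 * w i / Q"
  proof -
    have "a * b + b * c + c * a = (X j * X k + X k * X l + X l * X j) / Q"
      by (simp add: a_def b_def c_def add_divide_distrib power2_eq_square flip: q(2))
    also have "X j * X k + X k * X l + X l * X j = Q + 4 * w i" using h(7) by simp
    finally show ?thesis using Q by (simp add: field_simps)
  qed
  have sum: "a + b + c = (X j + X k + X l) / q" by (simp add: a_def b_def c_def add_divide_distrib)
  have "a * b + b * c + c * a - 1 \<ge> 111 / 1000 * (a + b + c)\<^sup>2"
    unfolding e2 sum power_divide q(2) using divide_right_mono[OF e, of Q] Q by simp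
  then have key: "a * b + b * c + c * a - 1 \<ge> 282 / 1000 * ((a + b + c) - a * b * c)"
    using Xpos q by (intro angle_sum_inequality) (auto simp: a_def b_def c_def)
  have "(a + b + c) - a * b * c = (Q * (X j + X k + X l) - X j * X k * X l) / (Q * q)"
    using q(1) by (simp add: a_def b_def c_def field_simps power2_eq_square flip: q(2))
  then have "4 * w i / Q * (Q * q) \<ge> 282 / 1000 * ((Q * (X j + X k + X l) - X j * X k * X l) / (Q
      * q)) * (Q * q)"
    using key q(1) Q unfolding e2 by (intro mult_right_mono) auto
  then have "4 * w i * sqrt Q \<ge> 282 / 1000 * (Q * (X j + X k + X l) - X j * X k * X l)"
    using Q q(1) by (simp add: q_def)
  then have "4 * w i * sqrt Q / (8 * (sqrt (A j) * sqrt (A k) * sqrt (A l))) \<ge>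
     282 / 1000 * (Q * (X j + X k + X l) - X j * X k * X l) / (8 * (sqrt (A j) * sqrt (A k) * sqrt
         (A l)))"
    using h(4) by (intro divide_right_mono) auto
  \<comment> \<open>The cosine may be nonpositive, so the bound on the tangent is kept in product
    form; in that case half the angle is at least \<open>pi / 2\<close>.\<close>
  then have sc: "sin (tetra_angle s y i / 2) \<ge> 282 / 1000 * cos (tetra_angle s y i / 2)"
    unfolding h(2,3) by simp
  show ?thesis
  proof (cases "tetra_angle s y i / 2 < pi / 2")
    case True
    then have "cos (tetra_angle s y i / 2) > 0" using h(5) by (intro cos_gt_zero_pi) auto
    then have "282 / 1000 \<le> tan (tetra_angle s y i / 2)"
      using sc by (simp add: tan_def field_simps)
    then have "arctan (282 / 1000) \<le> arctan (tan (tetra_angle s y i / 2))"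
      by (simp add: arctan_le_iff)
    also have "\<dots> = tetra_angle s y i / 2" using True h(5) by (intro arctan_tan) auto
    finally show ?thesis using two_pi_23_less by simp
  next
    case False
    then show ?thesis using pi_gt_zero by linarith
  qed
qed

end

section \<open>The extended curvature and its flow\<close>

lemma coth_square: 
  assumes "x > 0" shows "(coth x)\<^sup>2 = 1 + 1 / (sinh x)\<^sup>2"
  using sinh_coth[OF assms] assms by (simp add: field_simps)

lemma coth_antimono:
  assumes "0 < a" "a \<le> b" shows "coth b \<le> coth a"
proof (rule power2_le_imp_le)
  have "(sinh a)\<^sup>2 \<le> (sinh b)\<^sup>2" using assms by (intro power_mono) auto
  then show "(coth b)\<^sup>2 \<le> (coth a)\<^sup>2"
    using assms by (simp add: coth_square frac_le)
  show "0 \<le> coth a" using coth_gt_1[OF assms(1)] by simp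
qed

lemma tetrahedra_card: "s \<in> tetrahedra T \<Longrightarrow> card s = 4"
  by (simp add: tetrahedra_def)

lemma ext_curvature_eq:
  assumes "ball_packing r"
  shows "ext_curvature T r $ i = 4 * pi - (\<Sum>s | s \<in> tetrahedra T
      \<and> i \<in> s. tetra_angle s (coth_radii r) i)"
proof -
  have "(\<Sum>s | s \<in> tetrahedra T \<and> i \<in> s. ext_solid_angle r s i) =
      (\<Sum>s | s \<in> tetrahedra T \<and> i \<in> s. tetra_angle s (coth_radii r) i)"
    by (intro sum.cong refl ext_solid_angle_eq assms) (auto simp: tetrahedra_card)
  then show ?thesis
    by (simp add: ext_curvature_def)
qed

lemma continuous_on_ext_curvature:
  "continuous_on {r. ball_packing r} (\<lambda>r. ext_curvature T r $ i)"
proof -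
  have "continuous_on {r. ball_packing r}
      (\<lambda>r. 4 * pi - (\<Sum>s | s \<in> tetrahedra T \<and> i \<in> s. tetra_angle s (coth_radii r) i))"
    by (intro continuous_intros continuous_on_tetra_angle continuous_on_coth_radii
      coth_tetra_radii) (auto simp: tetrahedra_card)
  then show ?thesis
    by (rule continuous_on_eq) (simp add: ext_curvature_eq)
qed

text \<open>\<open>sinh \<le> 1 / 32\<close> gives \<open>coth\<^sup>2 \<ge> 1025\<close>, enough
  for the bound \<open>4 * pi / 23\<close>; at least 23 such angles exceed \<open>4 * pi\<close> in
  total.\<close>

lemma ext_curvature_neg_at_min:
  assumes r: "ball_packing r" and deg: "tetra_degree T i \<ge> 23"
    and min: "\<And>j. r $ i \<le> r $ j" and small: "sinh (r $ i) \<le> 1 / 32"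
  shows "ext_curvature T r $ i < 0"
proof -
  let ?S = "{s. s \<in> tetrahedra T \<and> i \<in> s}"
  have rpos: "r $ j > 0" for j using r by (simp add: ball_packing_def)
  have "sinh (r $ i) > 0" using rpos by simp
  then have "(sinh (r $ i))\<^sup>2 \<le> (1 / 32)\<^sup>2" using small by (intro power_mono) auto
  then have "1 / (1 / 32)\<^sup>2 \<le> 1 / (sinh (r $ i))\<^sup>2"
    using \<open>sinh (r $ i) > 0\<close> by (intro divide_left_mono) auto
  then have large: "(coth_radii r i)\<^sup>2 \<ge> 1000"
    unfolding coth_radii_def coth_square[OF rpos] by (simp add: power2_eq_square)
  have tetra_angle: "tetra_angle s (coth_radii r) i > 4 * pi / 23" if "s \<in> ?S" for s
  proof -
    interpret coth_tetra s "coth_radii r" using that r by (auto intro: coth_tetra_radii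
        tetrahedra_card)
    show ?thesis
      using that large by (intro tetra_angle_gt_of_min_radius)
        (auto simp: coth_radii_def intro!: coth_antimono rpos min)
  qed
  have card: "card ?S \<ge> 23"
    using deg by (simp add: tetra_degree_def)
  have "4 * pi = 23 * (4 * pi / 23)" by simp
  also have "\<dots> \<le> real (card ?S) * (4 * pi / 23)"
    using card by (intro mult_right_mono) auto
  also have "\<dots> = (\<Sum>s\<in>?S. 4 * pi / 23)" by simp
  also have "\<dots> < (\<Sum>s\<in>?S. tetra_angle s (coth_radii r) i)"
    using tetra_angle by (intro sum_strict_mono finite) (use card in force)+
  finally show ?thesis
    unfolding ext_curvature_eq[OF r] by simp
qed

lemma ext_curvature_pos_at_large:
  fixes T :: "'n::finite set set"
  obtains C where "C > 0" "\<And>r i. ball_packing r \<Longrightarrow> r $ i \<ge> C \<Longrightarrow> ext_curvature T r $ i > 0"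
proof
  \<comment> \<open>The summand 5 keeps \<open>e\<close> below \<open>pi\<close>, and at most
    \<open>card (tetrahedra T)\<close> angles of size \<open>e\<close> add up to less than
    \<open>4 * pi\<close>.\<close>
  define e where "e = 4 * pi / (real (card (tetrahedra T)) + 5)"
  have e: "0 < e" "e < pi"
    using pi_gt_zero by (simp_all add: e_def pos_divide_less_eq mult.commute[of pi])
  define m where "m = sin (e / 2)"
  have m: "m > 0" using e by (auto simp: m_def intro!: sin_gt_zero)
  define C where "C = arsinh (1 / sqrt m)"
  show "C > 0" using m by (simp add: C_def)
  fix r :: "real^'n" and i assume r: "ball_packing r" and C: "r $ i \<ge> C"
  let ?S = "{s. s \<in> tetrahedra T \<and> i \<in> s}"
  have rpos: "r $ j > 0" for j using r by (simp add: ball_packing_def)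
  have "sinh C \<le> sinh (r $ i)" using C by simp
  then have "1 / sqrt m \<le> sinh (r $ i)" by (simp add: C_def)
  then have "(1 / sqrt m)\<^sup>2 \<le> (sinh (r $ i))\<^sup>2" using m by (intro power_mono) auto
  then have "1 / m \<le> (sinh (r $ i))\<^sup>2" using m by (simp add: power_divide)
  moreover have "(sinh (r $ i))\<^sup>2 > 0" using rpos[of i] by simp
  ultimately have w: "(coth_radii r i)\<^sup>2 - 1 \<le> m"
    unfolding coth_radii_def coth_square[OF rpos] using m by
      (simp add: pos_divide_le_eq field_simps)
  have tetra_angle: "tetra_angle s (coth_radii r) i \<le> e" if "s \<in> ?S" for s
  proof -
    interpret coth_tetra s "coth_radii r" using that r by (auto intro: coth_tetra_radii
        tetrahedra_card)
    show ?thesis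
      using that e w by (intro tetra_angle_le_of_large_radius) (auto simp: m_def)
  qed
  have "(\<Sum>s\<in>?S. tetra_angle s (coth_radii r) i) \<le> real (card ?S) * e"
    using sum_bounded_above[of ?S "\<lambda>s. tetra_angle s (coth_radii r) i" e] tetra_angle by simp
  also have "\<dots> \<le> real (card (tetrahedra T)) * e"
    using e by (intro mult_right_mono of_nat_mono card_mono) auto
  also have "\<dots> < 4 * pi"
    by (simp add: e_def field_simps)
  finally show "ext_curvature T r $ i > 0"
    unfolding ext_curvature_eq[OF r] by simp
qed

theorem ext_curvature_zero_exists:
  fixes T :: "'n::finite set set"
  assumes deg: "\<And>i. tetra_degree T i \<ge> 23"
  shows "\<exists>r. ball_packing r \<and> ext_curvature T r = 0"
proof -
  obtain C where C: "C > 0" "\<And>r i. ball_packing r \<Longrightarrow> r $ i \<ge> C \<Longrightarrow> ext_curvature T r $ i > 0"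
    using ext_curvature_pos_at_large[of T] by blast
  define c where "c = min C (arsinh (1 / 32))"
  have c: "c > 0" "c \<le> C" "sinh c \<le> 1 / 32"
  proof -
    have "sinh c \<le> sinh (arsinh (1 / 32 :: real))" unfolding sinh_real_le_iff by (simp add: c_def)
    then show "sinh c \<le> 1 / 32" by simp
  qed (use C(1) in \<open>auto simp: c_def\<close>)
  define S where "S = cbox (\<chi> i. c) (\<chi> i. C :: real^'n)"
  have S: "r \<in> S \<longleftrightarrow> (\<forall>i. c \<le> r $ i \<and> r $ i \<le> C)" for r
    by (simp add: S_def mem_box_cart)
  have bp: "ball_packing r" if "r \<in> S" for r
    using that c unfolding S ball_packing_def by (meson less_le_trans)
  \<comment> \<open>One step against the curvature, projected back to the box. At a fixed point,
    nonzero curvature would pin \<open>r $ i\<close> to the side of the box where the curvature has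
    the opposite sign.\<close>
  define f where "f r = (\<chi> i. max c (min C (r $ i - ext_curvature T r $ i)))" for r
  have "continuous_on S f"
    unfolding f_def
    by (intro continuous_intros continuous_on_subset[OF continuous_on_ext_curvature])
      (auto simp: bp)
  moreover have "f \<in> S \<rightarrow> S"
    using c by (auto simp: S f_def)
  moreover have "S \<noteq> {}"
  proof -
    have "(\<chi> i. c) \<in> S" using c by (simp add: S)
    then show ?thesis by blast
  qed
  ultimately obtain r where r: "r \<in> S" "f r = r"
    using brouwer[of S f] by (auto simp: S_def compact_cbox convex_box)
  note bpr = bp[OF r(1)]
  have "ext_curvature T r $ i = 0" for i
  proof -
    have clamp: "max c (min C (r $ i - ext_curvature T r $ i)) = r $ i"
      using r(2) by (metis (no_types, lifting) f_def vec_lambda_beta)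
    have ri: "c \<le> r $ i" "r $ i \<le> C" using r(1) S by auto
    show ?thesis
    proof (rule linorder_cases)
      assume neg: "ext_curvature T r $ i < 0"
      then have "r $ i = C" using clamp ri by (auto simp: max_def min_def split: if_splits)
      then show ?thesis using C(2)[OF bpr, of i] neg by simp
    next
      assume pos: "ext_curvature T r $ i > 0"
      then have "r $ i = c" using clamp ri by (auto simp: max_def min_def split: if_splits)
      then have "ext_curvature T r $ i < 0"
        using c(3) r(1) S by (intro ext_curvature_neg_at_min[OF bpr deg]) auto
      then show ?thesis using pos by simp
    qed
  qed
  then show ?thesis
    using bpr by (auto simp: vec_eq_iff)
qed

section \<open>Confinement and convergence of the flow\<close>

lemma flow_barrier:
  fixes f :: "real \<Rightarrow> real^'n::finite"
  assumes der: "\<And>t i. t \<ge> 0 \<Longrightarrow> ((\<lambda>t. f t $ i) has_real_derivative D t i) (at t within {0..})"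
    and init: "\<And>i. b \<le> f 0 $ i"
    and inward: "\<And>t i. t \<ge> 0 \<Longrightarrow> f t $ i < b \<Longrightarrow> (\<And>j. f t $ i \<le> f t $ j) \<Longrightarrow> D t i > 0"
    and t: "t \<ge> 0"
  shows "b \<le> f t $ i"
proof (rule ccontr)
  assume less: "\<not> b \<le> f t $ i"
  have cont: "continuous_on {0..t} (\<lambda>t. f t $ j)" for j
  proof -
    have "continuous_on {0..} (\<lambda>t. f t $ j)"
      unfolding continuous_on_eq_continuous_within using der DERIV_continuous by fastforce
    then show ?thesis by (rule continuous_on_subset) auto
  qed
  have "\<exists>u\<in>{0..t}. \<forall>v\<in>{0..t}. f u $ j \<le> f v $ j" for j
    using continuous_attains_inf[OF compact_Icc _ cont[of j]] t by auto
  then obtain u where u: "\<And>j. u j \<in> {0..t}" "\<And>j v. v \<in> {0..t} \<Longrightarrow> f (u j) $ j \<le> f v $ j"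
    by metis
  define g where "g j = f (u j) $ j" for j
  \<comment> \<open>The least value over all coordinates and all times up to \<open>t\<close> is
    also least among the coordinates at its own time, so \<open>inward\<close> applies; the positive
    derivative then yields a smaller value slightly earlier.\<close>
  have "Min (range g) \<in> range g" by (intro Min_in) auto
  then obtain m where m: "Min (range g) = g m" by blast
  have g: "g m \<le> f v $ j" if "v \<in> {0..t}" for v j
  proof -
    have "g m \<le> g j" unfolding m[symmetric] by (intro Min_le) auto
    also have "\<dots> \<le> f v $ j" unfolding g_def using u(2)[OF that] .
    finally show ?thesis .
  qed
  have gb: "g m < b" using g[of t i] t less by simp
  define w where "w = u m"
  have w: "w \<in> {0..t}" "f w $ m = g m" using u by (auto simp: w_def g_def)
  have "w \<noteq> 0" using init[of m] gb w by auto
  then have w0: "w > 0" using w by simp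
  have "D w m > 0"
    using inward[of w m] w gb g[OF w(1)] by auto
  moreover have "((\<lambda>t. f t $ m) has_real_derivative D w m) (at w)"
    using der[of w m] w0 at_within_interior[of w "{0..}"] by simp
  ultimately obtain d where d: "d > 0" "\<And>h. 0 < h \<Longrightarrow> h < d \<Longrightarrow> f (w - h) $ m < f w $ m"
    using DERIV_pos_inc_left by blast
  define h where "h = min (d / 2) w"
  have "f (w - h) $ m < f w $ m" using d w0 by (intro d(2)) (auto simp: h_def)
  moreover have "w - h \<in> {0..t}" using w d by (auto simp: h_def)
  ultimately show False using g[of "w - h" m] w by simp
qed

lemma min_of_derivative_sign:
  fixes h :: "real \<Rightarrow> real"
  assumes der: "\<And>u. u \<in> {b..B} \<Longrightarrow> (h has_real_derivative (u - a) * k u) (at u)"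
    and k: "\<And>u. u \<in> {b..B} \<Longrightarrow> k u \<ge> 0" and "a \<in> {b..B}" "x \<in> {b..B}"
  shows "h a \<le> h x"
proof (cases "a \<le> x")
  case True
  show ?thesis
  proof (rule DERIV_nonneg_imp_nondecreasing[OF True])
    fix u assume "a \<le> u" "u \<le> x"
    then show "\<exists>y. (h has_real_derivative y) (at u) \<and> 0 \<le> y"
      using der[of u] k[of u] assms(3,4) by (intro exI[of _ "(u - a) * k u"]) auto
  qed
next
  case False
  then have "x \<le> a" by simp
  then show ?thesis
  proof (rule DERIV_nonpos_imp_nonincreasing)
    fix u assume "x \<le> u" "u \<le> a"
    then show "\<exists>y. (h has_real_derivative y) (at u) \<and> y \<le> 0"
      using der[of u] k[of u] assms(3,4)
      by (intro exI[of _ "(u - a) * k u"]) (auto simp: mult_nonpos_nonneg)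
  qed
qed

text \<open>The weight \<open>1 / sinh x\<close> cancels the factor \<open>sinh\<close> of the flow in the derivative of the
  Lyapunov function.\<close>

lemma potential_exists:
  fixes a b B :: real
  assumes b: "b > 0" and a: "a \<in> {b..B}"
  obtains l where "\<And>x. x \<in> {b..B} \<Longrightarrow> (l has_real_derivative (x - a) / sinh x) (at x)"
    "\<And>x. x \<in> {b..B} \<Longrightarrow> (x - a)\<^sup>2 / (2 * sinh B) \<le> l x"
    "\<And>x. x \<in> {b..B} \<Longrightarrow> l x \<le> (x - a)\<^sup>2 / (2 * sinh b)"
proof
  define g where "g x = (x - a) / sinh x" for x
  \<comment> \<open>The interval is enlarged on both sides to make the points of
    \<open>{b..B}\<close> interior, for two-sided derivatives.\<close>
  define G where "G x = integral {b / 2..x} g" for x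
  define l where "l x = G x - G a" for x
  have "continuous_on {b / 2..B + 1} g"
    unfolding g_def using b by (intro continuous_intros) auto
  then have G: "(G has_real_derivative g x) (at x within {b / 2..B + 1})" if "x \<in> {b / 2..B + 1}"
      for x
    unfolding G_def using that by (rule integral_has_real_derivative)
  have "(G has_real_derivative g x) (at x)" if "x \<in> {b..B}" for x
    using G[of x] that b at_within_Icc_at[of "b / 2" x "B + 1"] by simp
  then show der: "(l has_real_derivative (x - a) / sinh x) (at x)" if "x \<in> {b..B}" for x
    unfolding l_def using that by (auto intro!: derivative_eq_intros simp: g_def)
  have l0: "l a = 0" by (simp add: l_def)
  have B: "B > 0" using a b by auto
  show "(x - a)\<^sup>2 / (2 * sinh B) \<le> l x" if x: "x \<in> {b..B}" for x
  proof -
    have "l a - (a - a)\<^sup>2 / (2 * sinh B) \<le> l x - (x - a)\<^sup>2 / (2 * sinh B)"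
    proof (rule min_of_derivative_sign[where k = "\<lambda>u. 1 / sinh u - 1 / sinh B" and h =
        "\<lambda>x. l x - (x - a)\<^sup>2 / (2 * sinh B)", OF _ _ a x])
      fix u assume u: "u \<in> {b..B}"
      show "((\<lambda>x. l x - (x - a)\<^sup>2 / (2 * sinh B)) has_real_derivative (u - a) * (1 / sinh u - 1 /
          sinh B)) (at u)"
        using B by (auto intro!: derivative_eq_intros der[OF u] simp: field_simps)
      show "0 \<le> 1 / sinh u - 1 / sinh B"
        using u b by (simp add: frac_le)
    qed
    then show ?thesis using l0 by simp
  qed
  show "l x \<le> (x - a)\<^sup>2 / (2 * sinh b)" if x: "x \<in> {b..B}" for x
  proof -
    have "(a - a)\<^sup>2 / (2 * sinh b) - l a \<le> (x - a)\<^sup>2 / (2 * sinh b) - l x"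
    proof (rule min_of_derivative_sign[where k = "\<lambda>u. 1 / sinh b - 1 / sinh u" and h =
        "\<lambda>x. (x - a)\<^sup>2 / (2 * sinh b) - l x", OF _ _ a x])
      fix u assume u: "u \<in> {b..B}"
      show "((\<lambda>x. (x - a)\<^sup>2 / (2 * sinh b) - l x) has_real_derivative (u - a) * (1 / sinh b - 1 /
          sinh u)) (at u)"
        using b by (auto intro!: derivative_eq_intros der[OF u] simp: field_simps)
      show "0 \<le> 1 / sinh b - 1 / sinh u"
        using u b by (simp add: frac_le)
    qed
    then show ?thesis using l0 by simp
  qed
qed

lemma ext_yamabe_solution_bounded:
  fixes T :: "'n::finite set set"
  assumes deg: "\<And>i. tetra_degree T i \<ge> 23"
    and r0: "ball_packing r0" and sol: "ext_yamabe_solution T r0 \<rho>" and r: "ball_packing r"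
  obtains b B where "b > 0" "\<And>i. r $ i \<in> {b..B}" "\<And>t i. t \<ge> 0 \<Longrightarrow> \<rho> t $ i \<in> {b..B}"
proof -
  obtain C where C: "C > 0" "\<And>r i. ball_packing r \<Longrightarrow> r $ i \<ge> C \<Longrightarrow> ext_curvature T r $ i > 0"
    using ext_curvature_pos_at_large[of T] by blast
  \<comment> \<open>The target \<open>r\<close> is included so that the Lyapunov function lives on
    the same interval \<open>{b..B}\<close>.\<close>
  define V where "V = range (\<lambda>i. r0 $ i) \<union> range (\<lambda>i. r $ i)"
  define b where "b = Min (insert (arsinh (1 / 32)) V)"
  define B where "B = Max (insert C V)"
  have V: "finite V" by (simp add: V_def)
  have "\<forall>v\<in>insert (arsinh (1 / 32)) V. v > 0"
    using r r0 by (auto simp: V_def ball_packing_def)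
  then have b: "b > 0" unfolding b_def using V by (subst Min_gr_iff) auto
  have VbB: "b \<le> v" "v \<le> B" if "v \<in> V" for v
    using V that by (auto simp: b_def B_def)
  have bc: "b \<le> arsinh (1 / 32)" and BC: "C \<le> B" using V by (auto simp: b_def B_def)
  have sol0: "\<rho> 0 = r0" and bp: "\<And>t. t \<ge> 0 \<Longrightarrow> ball_packing (\<rho> t)"
    and der: "\<And>t i. t \<ge> 0 \<Longrightarrow> ((\<lambda>t. \<rho> t $ i) has_real_derivative
        - (ext_curvature T (\<rho> t) $ i) * sinh (\<rho> t $ i)) (at t within {0..})"
    using sol by (auto simp: ext_yamabe_solution_def)
  have spos: "sinh (\<rho> t $ i) > 0" if "t \<ge> 0" for t i
    using bp[OF that] by (simp add: ball_packing_def)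
  have low: "b \<le> \<rho> t $ i" if t: "t \<ge> 0" for t i
  proof (rule flow_barrier[OF der _ _ t])
    show "b \<le> \<rho> 0 $ i" for i unfolding sol0 by (intro VbB) (simp add: V_def)
    fix t i assume *: "(0 :: real) \<le> t" "\<rho> t $ i < b" "\<And>j. \<rho> t $ i \<le> \<rho> t $ j"
    have "sinh (\<rho> t $ i) \<le> sinh (arsinh (1 / 32))"
      using *(2) bc unfolding sinh_real_le_iff by simp
    then have "ext_curvature T (\<rho> t) $ i < 0"
      unfolding sinh_arsinh_real by (intro ext_curvature_neg_at_min bp deg *(1) *(3))
    then show "- (ext_curvature T (\<rho> t) $ i) * sinh (\<rho> t $ i) > 0"
      using spos[OF *(1)] by (simp add: mult_neg_pos)
  qed
  have high: "\<rho> t $ i \<le> B" if t: "t \<ge> 0" for t i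
  proof -
    have "- B \<le> (- \<rho> t) $ i"
    proof (rule flow_barrier[where f = "\<lambda>t. - \<rho> t", OF _ _ _ t])
      show "((\<lambda>t. (- \<rho> t) $ i) has_real_derivative ext_curvature T (\<rho> t) $ i * sinh (\<rho> t $ i))
          (at t within {0..})"
        if "t \<ge> 0" for t i
        using DERIV_minus[OF der[OF that, of i]] by simp
      show "- B \<le> (- \<rho> 0) $ i" for i unfolding sol0 using VbB(2)[of "r0 $ i"] by (simp add: V_def)
      fix t i assume *: "(0 :: real) \<le> t" "(- \<rho> t) $ i < - B"
      then show "ext_curvature T (\<rho> t) $ i * sinh (\<rho> t $ i) > 0"
        using spos[OF *(1)] BC by (intro mult_pos_pos C(2) bp) auto
    qed
    then show ?thesis by simp
  qed
  show ?thesis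
    using that[of b B] b VbB low high by (auto simp: V_def)
qed

text \<open>On the box, \<open>L\<close> and the squared distance to \<open>r\<close> bound each
  other up to constants, and \<open>L\<close> decreases at least at the rate \<open>c\<close> times
  the squared distance. The distance itself therefore decays at half the rate of
  \<open>L\<close>.\<close>

theorem ext_yamabe_converges:
  fixes T :: "'n::finite set set"
  assumes deg: "\<And>i. tetra_degree T i \<ge> 23"
    and r: "real_packing T r" and K0: "ext_curvature T r = 0"
    and r0: "ball_packing r0" and sol: "ext_yamabe_solution T r0 \<rho>"
  shows "converges_exponentially \<rho> r"
proof -
  have bpr: "ball_packing r" using r by (simp add: real_packing_def)
  obtain b B where b: "b > 0" and rB: "\<And>i. r $ i \<in> {b..B}" and \<rho>B: "\<And>t i. t \<ge> 0 \<Longrightarrow> \<rho> t $ i \<in> {b..B}"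
    using ext_yamabe_solution_bounded[OF deg r0 sol bpr] by blast
  have B: "B > 0" using rB b by (meson atLeastAtMost_iff less_le_trans)
  have bp: "\<And>t. t \<ge> 0 \<Longrightarrow> ball_packing (\<rho> t)"
    and der: "\<And>t i. t \<ge> 0 \<Longrightarrow> ((\<lambda>t. \<rho> t $ i) has_real_derivative
        - (ext_curvature T (\<rho> t) $ i) * sinh (\<rho> t $ i)) (at t within {0..})"
    using sol by (auto simp: ext_yamabe_solution_def)
  let ?TT = "tetrahedra T"
  have cover: "\<exists>s\<in>?TT. i \<in> s" for i
  proof -
    have "card {s \<in> ?TT. i \<in> s} > 0" using deg[of i] by (simp add: tetra_degree_def)
    then have "{s \<in> ?TT. i \<in> s} \<noteq> {}" by (metis card.empty less_irrefl)
    then show ?thesis by blast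
  qed
  have Q: "coth_Q s (coth_radii r) > 0" if "s \<in> ?TT" for s
    using r that by (intro real_tetra_imp_Q_pos tetrahedra_card) (auto simp: real_packing_def)
  define R where "R = real CARD('n) * B"
  have R: "R > 0" using B by (simp add: R_def)
  have normR: "norm (\<rho> t - r) \<le> R" if "t \<ge> 0" for t
  proof -
    have "\<bar>(\<rho> t - r) $ i\<bar> \<le> B" for i
      using rB[of i] \<rho>B[OF that, of i] b by auto
    then have "(\<Sum>i\<in>UNIV. \<bar>(\<rho> t - r) $ i\<bar>) \<le> R"
      unfolding R_def using sum_bounded_above[of UNIV "\<lambda>i. \<bar>(\<rho> t - r) $ i\<bar>" B] by simp
    then show ?thesis using norm_le_l1_cart[of "\<rho> t - r"] by linarith
  qed
  obtain c where c: "c > 0" "\<And>v. ball_packing (r + v) \<Longrightarrow> norm v \<le> R \<Longrightarrow>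
       (\<Sum>s\<in>?TT. angle_pairing s (r + v) v - angle_pairing s r v) \<le> - c * (norm v)\<^sup>2"
    by (rule angle_pairing_strict[OF tetrahedra_card cover bpr Q R]) blast+
  \<comment> \<open>Exchanging the sums over tetrahedra and vertices turns the pairings into
    curvatures.\<close>
  have angle_pairing: "(\<Sum>s\<in>?TT. angle_pairing s p v) = (\<Sum>i\<in>UNIV. v $ i * (4 * pi - ext_curvature T
      p $ i))"
    if "ball_packing p" for p v
  proof -
    have "(\<Sum>s\<in>?TT. angle_pairing s p v) = (\<Sum>s\<in>?TT. \<Sum>i\<in>{i\<in>UNIV. i \<in> s}. v $ i * tetra_angle s
        (coth_radii p) i)"
      by (simp add: angle_pairing_def)
    also have "\<dots> = (\<Sum>i\<in>UNIV. \<Sum>s\<in>{s\<in>?TT. i \<in> s}. v $ i * tetra_angle s (coth_radii p) i)"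
      by (rule sum.swap_restrict) auto
    also have "\<dots> = (\<Sum>i\<in>UNIV. v $ i * (4 * pi - ext_curvature T p $ i))"
      by (simp add: ext_curvature_eq[OF that] sum_distrib_left)
    finally show ?thesis .
  qed
  have strict: "(\<Sum>i\<in>UNIV. (\<rho> t $ i - r $ i) * ext_curvature T (\<rho> t) $ i) \<ge> c * (norm (\<rho> t - r))\<^sup>2"
    if "t \<ge> 0" for t
  proof -
    have "(\<Sum>s\<in>?TT. angle_pairing s (\<rho> t) (\<rho> t - r) - angle_pairing s r (\<rho> t - r))
        \<le> - c * (norm (\<rho> t - r))\<^sup>2"
      using c(2)[of "\<rho> t - r"] bp[OF that] normR[OF that] by simp
    moreover have "(\<Sum>s\<in>?TT. angle_pairing s (\<rho> t) (\<rho> t - r) - angle_pairing s r (\<rho> t - r)) =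
       - (\<Sum>i\<in>UNIV. (\<rho> t $ i - r $ i) * ext_curvature T (\<rho> t) $ i)"
      unfolding sum_subtractf angle_pairing[OF bp[OF that]] angle_pairing[OF bpr] K0
      unfolding sum_subtractf[symmetric] sum_negf[symmetric]
      by (intro sum.cong) (auto simp: algebra_simps)
    ultimately show ?thesis by simp
  qed
  have "\<exists>l. (\<forall>x\<in>{b..B}. (l has_real_derivative (x - r $ i) / sinh x) (at x)) \<and>
     (\<forall>x\<in>{b..B}. (x - r $ i)\<^sup>2 / (2 * sinh B) \<le> l x \<and> l x \<le> (x - r $ i)\<^sup>2 / (2 * sinh b))" for i
    using potential_exists[OF b rB[of i]] by metis
  then obtain l where l: "\<And>i x. x \<in> {b..B} \<Longrightarrow> (l i has_real_derivative (x - r $ i) / sinh x) (at x)"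
    "\<And>i x. x \<in> {b..B} \<Longrightarrow> (x - r $ i)\<^sup>2 / (2 * sinh B) \<le> l i x"
    "\<And>i x. x \<in> {b..B} \<Longrightarrow> l i x \<le> (x - r $ i)\<^sup>2 / (2 * sinh b)"
    by metis
  define L where "L t = (\<Sum>i\<in>UNIV. l i (\<rho> t $ i))" for t
  have norm2: "(norm v)\<^sup>2 = (\<Sum>i\<in>UNIV. (v $ i)\<^sup>2)" for v :: "real^'n"
    unfolding power2_norm_eq_inner inner_vec_def by (simp add: power2_eq_square)
  have L_lower: "(norm (\<rho> t - r))\<^sup>2 / (2 * sinh B) \<le> L t" if "t \<ge> 0" for t
    unfolding L_def norm2 sum_divide_distrib using l(2)[OF \<rho>B[OF that]] by (auto intro!: sum_mono)
  have L_upper: "L t \<le> (norm (\<rho> t - r))\<^sup>2 / (2 * sinh b)" if "t \<ge> 0" for t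
    unfolding L_def norm2 sum_divide_distrib using l(3)[OF \<rho>B[OF that]] by (auto intro!: sum_mono)
  define D where "D t = - (\<Sum>i\<in>UNIV. (\<rho> t $ i - r $ i) * ext_curvature T (\<rho> t) $ i)" for t
  have L_der: "(L has_real_derivative D t) (at t within {0..})" if t: "t \<ge> 0" for t
  proof -
    have "((\<lambda>t. l i (\<rho> t $ i)) has_real_derivative - ((\<rho> t $ i - r $ i) * ext_curvature T (\<rho> t) $
        i)) (at t within {0..})" for i
    proof -
      have "sinh (\<rho> t $ i) \<noteq> 0" using bp[OF t] ball_packing_nonzero by auto
      then have eq: "(\<rho> t $ i - r $ i) / sinh (\<rho> t $ i) * (- (ext_curvature T (\<rho> t) $ i) * sinh (\<rho>
          t $ i)) =
         - ((\<rho> t $ i - r $ i) * ext_curvature T (\<rho> t) $ i)"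
        by simp
      show ?thesis
        using DERIV_chain2[OF l(1)[OF \<rho>B[OF t], of i i] der[OF t, of i]] unfolding eq .
    qed
    then show ?thesis
      unfolding L_def D_def sum_negf[symmetric] by (intro DERIV_sum) auto
  qed
  define k where "k = c * (2 * sinh b)"
  have k: "k > 0" using c(1) b by (simp add: k_def)
  have D_le: "D t \<le> - k * L t" if t: "t \<ge> 0" for t
  proof -
    have "k * L t \<le> k * ((norm (\<rho> t - r))\<^sup>2 / (2 * sinh b))"
      using L_upper[OF t] k by (intro mult_left_mono) auto
    also have "\<dots> = c * (norm (\<rho> t - r))\<^sup>2" using b by (simp add: k_def)
    finally show ?thesis using strict[OF t] by (simp add: D_def)
  qed
  have decay: "L t * exp (k * t) \<le> L 0" if t: "t \<ge> 0" for t
  proof -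
    have der': "((\<lambda>t. L t * exp (k * t)) has_real_derivative (D u + k * L u) * exp (k * u))
        (at u within {0..})"
      if "u \<ge> 0" for u
      by (rule derivative_eq_intros refl L_der[OF that])+ (simp add: algebra_simps)
    have "L t * exp (k * t) \<le> L 0 * exp (k * 0)"
    proof (rule DERIV_nonpos_imp_decreasing_open[OF t])
      fix u assume u: "0 < u" "u < t"
      have "((\<lambda>t. L t * exp (k * t)) has_real_derivative (D u + k * L u) * exp (k * u)) (at u)"
        using der'[of u] u at_within_interior[of u "{0..}"] by simp
      moreover have "(D u + k * L u) * exp (k * u) \<le> 0"
        using D_le[of u] u by (intro mult_nonpos_nonneg) auto
      ultimately show "\<exists>y. ((\<lambda>t. L t * exp (k * t)) has_real_derivative y) (at u) \<and> y \<le> 0" by blast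
    next
      have "continuous_on {0..} (\<lambda>t. L t * exp (k * t))"
        unfolding continuous_on_eq_continuous_within using der' DERIV_continuous by fastforce
      then show "continuous_on {0..t} (\<lambda>t. L t * exp (k * t))"
        by (rule continuous_on_subset) auto
    qed
    then show ?thesis by simp
  qed
  have L0: "L 0 \<ge> 0" using L_lower[of 0] B by (smt (verit) divide_nonneg_nonneg
      sinh_real_nonneg_iff zero_le_power2)
  \<comment> \<open>The summand 1 keeps the constant positive when the flow starts at
    \<open>r\<close>, where \<open>L 0 = 0\<close>.\<close>
  define E where "E = 2 * sinh B * L 0 + 1"
  have E: "E > 0" using L0 B by (simp add: E_def add_nonneg_pos)
  have "norm (\<rho> t - r) \<le> sqrt E * exp (- (k / 2) * t)" if t: "t \<ge> 0" for t
  proof (rule power2_le_imp_le)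
    have "(norm (\<rho> t - r))\<^sup>2 \<le> 2 * sinh B * L t"
      using L_lower[OF t] B by (simp add: field_simps)
    also have "L t \<le> L 0 * exp (- (k * t))"
      using decay[OF t] by (simp add: exp_minus field_simps)
    then have "2 * sinh B * L t \<le> 2 * sinh B * (L 0 * exp (- (k * t)))"
      using B by (intro mult_left_mono) auto
    also have "\<dots> \<le> E * exp (- (k * t))"
      by (simp add: E_def algebra_simps)
    also have "\<dots> = (sqrt E * exp (- (k / 2) * t))\<^sup>2"
      using E by (simp add: power_mult_distrib flip: exp_double)
    finally show "(norm (\<rho> t - r))\<^sup>2 \<le> (sqrt E * exp (- (k / 2) * t))\<^sup>2" .
  qed (use E in simp)
  then show ?thesis
    unfolding converges_exponentially_def using E k by (intro exI[of _ "sqrt E"] exI[of _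
      "k / 2"]) auto
qed

theorem theorem1p3:
  fixes M :: "'m topology" and T :: "'n::finite set set"
  assumes "closed_3_manifold M"
    and "triangulates T M"
    and "\<forall>i. tetra_degree T i \<ge> 23"
  shows "(\<exists>r. ball_packing r \<and> ext_curvature T r = 0) \<and>
    (\<forall>r. real_packing T r \<and> ext_curvature T r = 0 \<longrightarrow>
      (\<forall>r0 \<rho>. ball_packing r0 \<and> ext_yamabe_solution T r0 \<rho> \<longrightarrow>
        converges_exponentially \<rho> r))"
proof -
  have "tetra_degree T i \<ge> 23" for i
    using assms(3) by blast
  then show ?thesis
    using ext_curvature_zero_exists[of T] ext_yamabe_converges[of T] by blast
qed

end
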